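(* Fix $q>0$ and $\lambda>0$. Then $$\lim_{n\to\infty}\frac{1}{n}\log Z_{n,\lambda,q}=\sup_{\theta\in[0,1]}\Phi(\theta,\lambda,q).$$
   Context: Let $K_n=(V_n,E_n)$ be the complete graph on $n$ vertices. For $\omega\in\{0,1\}^{E_n}$ let $k(\omega)$ be the number of connected components (isolated vertices count as components) of the graph on $V_n$ with edge set $\{e\in E_n:\omega_e=1\}$. For $q>0$, $\lambda>0$, $n\ge\lambda$, put $p=\lambda/n$ and define the random cluster partition function $$Z_{n,\lambda,q}=\sum_{\omega\in\{0,1\}^{E_n}}\Big\{\prod_{e\in E_n}p^{\omega_e}(1-p)^{1-\omega_e}\Big\}q^{k(\omega)}.$$ Let $S(\theta)=\theta\log\theta+(1-\theta)\log(1-\theta)$, $\pi_1(x)=1-e^{-x}$, and $\Psi(x)=\big(\log x-\tfrac12[x-\tfrac1x]\big)\wedge 0$ for $x\geq 0$ (with $\Psi(0)=0$ by continuity; $a\wedge b=\min\{a,b\}$). Define $$\Phi(\theta,\lambda,q)=-S(\theta)+(1-\theta)\log[1-\pi_1(\lambda\theta)]+\theta\log\pi_1(\lambda\theta)+(1-\theta)\Big\{\Psi\big(\tfrac{\lambda(1-\theta)}{q}\big)-\big(\tfrac{q-1}{2q}\big)\lambda(1-\theta)+\log q\Big\},$$ with the values at $\theta=0,1$ understood by continuity (i.e. $0\log 0=0$). *)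

theory Defs
  imports Complex_Main "HOL-Library.FuncSet"
begin

definition K_verts :: "nat \<Rightarrow> nat set" where
  "K_verts n = {1..n}"

definition K_edges :: "nat \<Rightarrow> nat set set" where
  "K_edges n = {{u, v} |u v. u \<in> K_verts n \<and> v \<in> K_verts n \<and> u \<noteq> v}"

(* Extensional functions, so that each element of {0,1}^(E_n) is counted exactly once. *)
definition rc_configs :: "nat \<Rightarrow> (nat set \<Rightarrow> nat) set" where
  "rc_configs n = K_edges n \<rightarrow>\<^sub>E {0, 1}"

definition open_adj :: "nat \<Rightarrow> (nat set \<Rightarrow> nat) \<Rightarrow> (nat \<times> nat) set" where
  "open_adj n \<omega> = {(u, v). {u, v} \<in> K_edges n \<and> \<omega> {u, v} = 1}"

(* The components are the classes of "joined by an open path" on the vertex set; the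
   reflexive closure makes each isolated vertex a class of its own. *)
definition rc_components :: "nat \<Rightarrow> (nat set \<Rightarrow> nat) \<Rightarrow> nat set set" where
  "rc_components n \<omega> = K_verts n // ((open_adj n \<omega>)\<^sup>* \<inter> K_verts n \<times> K_verts n)"

definition num_components :: "nat \<Rightarrow> (nat set \<Rightarrow> nat) \<Rightarrow> nat" where
  "num_components n \<omega> = card (rc_components n \<omega>)"

(* Meaningful for n \<ge> l (with n > 0), i.e. when p = l / n is a probability. *)
definition rc_partition :: "nat \<Rightarrow> real \<Rightarrow> real \<Rightarrow> real" where
  "rc_partition n l q =
     (let p = l / real n in
      \<Sum>\<omega>\<in>rc_configs n.
        (\<Prod>e\<in>K_edges n. p ^ \<omega> e * (1 - p) ^ (1 - \<omega> e)) * q ^ num_components n \<omega>)"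

(* Below, 0 * ln 0 = 0 holds automatically, which is the intended value by continuity. *)
definition entropy_S :: "real \<Rightarrow> real" where
  "entropy_S \<theta> = \<theta> * ln \<theta> + (1 - \<theta>) * ln (1 - \<theta>)"

definition pi1 :: "real \<Rightarrow> real" where
  "pi1 x = 1 - exp (- x)"

definition Psi :: "real \<Rightarrow> real" where
  "Psi x = (if x = 0 then 0 else min (ln x - (1 / 2) * (x - 1 / x)) 0)"

definition Phi :: "real \<Rightarrow> real \<Rightarrow> real \<Rightarrow> real" where
  "Phi \<theta> l q =
     - entropy_S \<theta> + (1 - \<theta>) * ln (1 - pi1 (l * \<theta>)) + \<theta> * ln (pi1 (l * \<theta>))
     + (1 - \<theta>) * (Psi (l * (1 - \<theta>) / q) - ((q - 1) / (2 * q)) * l * (1 - \<theta>) + ln q)"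

(* The supremum of Phi over [0,1] is thus an honest real supremum. *)
lemma bdd_above_Phi:
  fixes l q :: real
  assumes q: "q > 0" and l: "l > 0"
  shows "bdd_above ((\<lambda>\<theta>. Phi \<theta> l q) ` {0..1})"
proof (rule bdd_aboveI2)
  fix \<theta> :: real
  assume "\<theta> \<in> {0..1}"
  then have t: "0 \<le> \<theta>" "\<theta> \<le> 1" by auto
  have ent: "- (x * ln x) \<le> 1" if "0 \<le> x" "x \<le> 1" for x :: real
  proof (cases "x = 0")
    case False
    then have x: "x > 0" using that by simp
    have "ln (1 / x) \<le> 1 / x - 1" using x by (intro ln_le_minus_one) simp
    then have "x * ln (1 / x) \<le> x * (1 / x - 1)" using x by (intro mult_left_mono) auto
    then show ?thesis using x by (simp add: ln_div algebra_simps)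
  qed simp
  have 1: "- entropy_S \<theta> \<le> 2"
    using ent[of \<theta>] ent[of "1 - \<theta>"] t by (simp add: entropy_S_def)
  have 2: "(1 - \<theta>) * ln (1 - pi1 (l * \<theta>)) \<le> 0"
    using t l by (auto simp: pi1_def intro!: mult_nonneg_nonpos)
  have 3: "\<theta> * ln (pi1 (l * \<theta>)) \<le> 0"
  proof (cases "\<theta> = 0")
    case False
    then have "pi1 (l * \<theta>) > 0" "pi1 (l * \<theta>) \<le> 1" using t l by (auto simp: pi1_def)
    then show ?thesis using t by (intro mult_nonneg_nonpos) auto
  qed simp
  let ?B = "\<bar>(q - 1) / (2 * q) * l\<bar> + \<bar>ln q\<bar>"
  have "\<bar>((q - 1) / (2 * q) * l) * (1 - \<theta>)\<bar> \<le> \<bar>(q - 1) / (2 * q) * l\<bar>"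
    unfolding abs_mult[of _ "1 - \<theta>"] using t by (intro mult_right_le_one_le) auto
  moreover have "Psi (l * (1 - \<theta>) / q) \<le> 0" by (simp add: Psi_def)
  ultimately have b: "Psi (l * (1 - \<theta>) / q) - (q - 1) / (2 * q) * l * (1 - \<theta>) + ln q \<le> ?B"
    by linarith
  have "(1 - \<theta>) * (Psi (l * (1 - \<theta>) / q) - (q - 1) / (2 * q) * l * (1 - \<theta>) + ln q)
      \<le> (1 - \<theta>) * ?B" using b t by (intro mult_left_mono) auto
  also have "\<dots> \<le> ?B" using t by (intro mult_left_le_one_le) auto
  finally show "Phi \<theta> l q \<le> 2 + ?B" using 1 2 3 unfolding Phi_def by linarith
qed

end

theory Submission
  imports Defs "HOL-Analysis.Analysis"
begin

text \<open>
  Write \<open>p = l / n\<close> and \<open>s = 1 - p\<close>, and let \<open>C j\<close> be the probability that the random graph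
  \<open>G(j, p)\<close> is connected.  The component of a fixed vertex of \<open>G(N, p)\<close> has exactly \<open>j\<close> vertices
  with probability \<open>P N j = (N - 1 choose j - 1) * C j * s ^ (j * (N - j))\<close>, so these numbers sum
  to 1 over \<open>j\<close> for \<^emph>\<open>every\<close> volume \<open>N\<close> (\<open>size_prob_sum\<close>), while \<open>C j\<close> does not depend on \<open>N\<close>.
  All estimates come from comparing different volumes at the same edge probability: if \<open>j\<close> is the
  typical size of the giant component of \<open>G(N, p)\<close>, that is \<open>N = j / pi1 (p * j)\<close>, then \<open>P N j \<le> 1\<close>
  is the sharp exponential bound \<open>pi1 (p * j) ^ j\<close> on \<open>C j\<close>.  The first terms of \<open>Phi\<close> are the
  price of choosing \<open>\<theta> * n\<close> vertices, connecting them, and having no edge to the rest; the last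
  term is the free energy of the rest when it has small components only.

  Lower bound.  Comparing the volume \<open>N\<close> with slightly smaller and slightly larger ones shows that,
  in \<open>G(N, p)\<close> with \<open>N = \<theta> * n / pi1 (l * \<theta>)\<close>, the component of a vertex has about \<open>\<theta> * n\<close>
  vertices with probability bounded away from 0 (\<open>exists_giant_size\<close>).  Changing the volume from
  \<open>N\<close> to \<open>n\<close> and keeping only this component in the recursion for the partition function leaves the
  partition function of the other \<open>m\<close> vertices.  There the weight \<open>q\<close> per component can
  be traded for the edge probability \<open>p / q\<close>, because edges plus components exceed the number of
  vertices only by the number of independent cycles; Jensen's inequality reduces the error to the
  mean number of independent cycles, which is nonnegative and, below criticality, bounded
  (\<open>rc_Z_ge\<close>).  This gives the value of \<open>Phi\<close> at every \<open>\<theta>\<close> for which the rest is subcritical,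
  where \<open>Psi\<close> vanishes.  These \<open>\<theta>\<close> suffice, since \<open>Phi\<close> is nondecreasing on the remaining interval
  (\<open>Phi_mono_supercritical\<close>).

  Upper bound.  By the exponential formula the partition function is a sum over set partitions of
  products of block weights, and splitting the weights at size \<open>J\<close>, a small multiple of \<open>n\<close>,
  splits it into a sum over the number \<open>k\<close> of vertices in large components.  There are at most
  \<open>n / J\<close> large components, so the factor \<open>q\<close> per large component is negligible, and comparison
  over all volumes again bounds the large part by \<open>pi1 (p * k) ^ k\<close>
  (\<open>large_components_bound\<close>).  The small part is a coefficient of the exponential of a generating
  function, bounded by evaluating at a point of the form \<open>x = M * s ^ M\<close>.  Summing the normalisation
  identities for the volumes up to \<open>M\<close> bounds the generating function by about
  \<open>M - p * M\<^sup>2 / 2\<close> (\<open>small_gf_le\<close>), and the best choice \<open>M = min (m / q) (1 / p)\<close> produces exactly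
  the two regimes of \<open>Psi\<close> (\<open>saddle_value\<close>).
\<close>

section \<open>Random graphs on an arbitrary finite vertex set\<close>

definition edges :: "nat set \<Rightarrow> nat set set" where
  "edges V = {e. e \<subseteq> V \<and> card e = 2}"

definition adj :: "nat set set \<Rightarrow> (nat \<times> nat) set" where
  "adj F = {(u, v). {u, v} \<in> F}"

definition comp_of :: "nat set \<Rightarrow> nat set set \<Rightarrow> nat \<Rightarrow> nat set" where
  "comp_of V F x = {y \<in> V. (x, y) \<in> (adj F)\<^sup>*}"

definition comps :: "nat set \<Rightarrow> nat set set \<Rightarrow> nat set set" where
  "comps V F = comp_of V F ` V"

definition weight :: "real \<Rightarrow> nat set set \<Rightarrow> nat set set \<Rightarrow> real" where
  "weight p E F = p ^ card F * (1 - p) ^ (card E - card F)"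

definition part_fun :: "real \<Rightarrow> real \<Rightarrow> nat set \<Rightarrow> real" where
  "part_fun p q V = (\<Sum>F\<in>Pow (edges V). weight p (edges V) F * q ^ card (comps V F))"

text \<open>
  The probability that the random graph on \<open>A\<close> with edge probability \<open>p\<close> is connected.
\<close>
definition conn_weight :: "real \<Rightarrow> nat set \<Rightarrow> real" where
  "conn_weight p A = (\<Sum>F\<in>{F\<in>Pow (edges A). A \<in> comps A F}. weight p (edges A) F)"

lemma finite_edges [simp, intro]: "finite V \<Longrightarrow> finite (edges V)"
  by (rule finite_subset[of _ "Pow V"]) (auto simp: edges_def)

lemma card_edges: "finite V \<Longrightarrow> card (edges V) = card V choose 2"
  unfolding edges_def by (rule n_subsets)

lemma edges_mono: "A \<subseteq> B \<Longrightarrow> edges A \<subseteq> edges B"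
  by (auto simp: edges_def)

lemma edges_disjoint: "A \<inter> B = {} \<Longrightarrow> edges A \<inter> edges B = {}"
proof (rule ccontr)
  assume AB: "A \<inter> B = {}" and "edges A \<inter> edges B \<noteq> {}"
  then obtain e where "e \<subseteq> A" "e \<subseteq> B" "card e = 2" by (auto simp: edges_def)
  then have "e = {}" using AB by blast
  then show False using \<open>card e = 2\<close> by simp
qed

lemma edge_in_edges_iff: "{u, v} \<in> edges V \<longleftrightarrow> u \<in> V \<and> v \<in> V \<and> u \<noteq> v"
  by (auto simp: edges_def card_insert_if)

lemma sym_adj: "sym (adj F)"
  by (auto simp: sym_def adj_def insert_commute)

lemma adj_rtrancl_sym: "(x, y) \<in> (adj F)\<^sup>* \<Longrightarrow> (y, x) \<in> (adj F)\<^sup>*"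
  using sym_adj sym_rtrancl by (metis symD)

lemma comp_of_self: "x \<in> V \<Longrightarrow> x \<in> comp_of V F x"
  by (simp add: comp_of_def)

lemma comp_of_eq: "y \<in> comp_of V F x \<Longrightarrow> comp_of V F y = comp_of V F x"
  by (auto simp: comp_of_def intro: rtrancl_trans adj_rtrancl_sym)

lemma comp_of_in_comps: "x \<in> V \<Longrightarrow> comp_of V F x \<in> comps V F"
  by (simp add: comps_def)

lemma comps_sub: "A \<in> comps V F \<Longrightarrow> A \<subseteq> V \<and> A \<noteq> {}"
  using comp_of_self by (auto simp: comps_def comp_of_def)

lemma finite_comps [simp, intro]: "finite V \<Longrightarrow> finite (comps V F)"
  by (simp add: comps_def)

lemma comps_eq_comp_of: "A \<in> comps V F \<Longrightarrow> x \<in> A \<Longrightarrow> A = comp_of V F x"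
  using comp_of_eq by (auto simp: comps_def)

lemma connected_iff: "A \<in> comps A F \<longleftrightarrow> A \<noteq> {} \<and> comps A F = {A}"
proof
  assume A: "A \<in> comps A F"
  then have "comp_of A F x = A" if "x \<in> A" for x using comps_eq_comp_of that by metis
  then show "A \<noteq> {} \<and> comps A F = {A}"
    using comps_sub[OF A] by (auto simp: comps_def)
qed simp

lemma comp_of_Un:
  assumes "F1 \<subseteq> edges A" "F2 \<subseteq> edges B" "A \<inter> B = {}" "x \<in> A"
  shows "comp_of (A \<union> B) (F1 \<union> F2) x = comp_of A F1 x"
proof -
  have "y \<in> A \<and> (x, y) \<in> (adj F1)\<^sup>*" if "(x, y) \<in> (adj (F1 \<union> F2))\<^sup>*" for y
    using that
  proof (induction rule: rtrancl_induct)
    case base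
    then show ?case using assms by simp
  next
    case (step y z)
    then have "{y, z} \<in> F1 \<union> F2" by (simp add: adj_def)
    then have "{y, z} \<in> F1" and "z \<in> A"
      using step assms edge_in_edges_iff by blast+
    then show ?case using step by (auto simp: adj_def intro: rtrancl.rtrancl_into_rtrancl)
  qed
  moreover have "(adj F1)\<^sup>* \<subseteq> (adj (F1 \<union> F2))\<^sup>*"
    by (rule rtrancl_mono) (auto simp: adj_def)
  ultimately show ?thesis by (auto simp: comp_of_def)
qed

lemma comps_Un:
  assumes "F1 \<subseteq> edges A" "F2 \<subseteq> edges B" "A \<inter> B = {}"
  shows "comps (A \<union> B) (F1 \<union> F2) = comps A F1 \<union> comps B F2"
proof -
  have "comp_of (A \<union> B) (F1 \<union> F2) ` A = comp_of A F1 ` A"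
    using comp_of_Un assms by (intro image_cong) auto
  moreover have "comp_of (A \<union> B) (F1 \<union> F2) ` B = comp_of B F2 ` B"
    using comp_of_Un[of F2 B F1 A] assms by (intro image_cong) (auto simp: Un_commute Int_commute)
  ultimately show ?thesis by (simp add: comps_def image_Un)
qed

text \<open>
  No edge leaves a component, so a configuration with component \<open>A\<close> is the same thing as a connected
  configuration on \<open>A\<close> together with an arbitrary one on the complement.
\<close>
lemma component_split:
  assumes A: "A \<in> comps V F" and F: "F \<subseteq> edges V"
  shows "F = (F \<inter> edges A) \<union> (F \<inter> edges (V - A))" "A \<in> comps A (F \<inter> edges A)"
proof -
  have AV: "A \<subseteq> V" "A \<noteq> {}" using comps_sub[OF A] by auto
  have cl: "v \<in> A" if "{u, v} \<in> F" "u \<in> A" for u v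
  proof -
    have "A = comp_of V F u" using comps_eq_comp_of[OF A that(2)] .
    moreover have "v \<in> V" using that(1) F edge_in_edges_iff by blast
    ultimately show ?thesis using that(1) by (auto simp: comp_of_def adj_def)
  qed
  have "e \<in> edges A \<union> edges (V - A)" if eF: "e \<in> F" for e
  proof -
    obtain u v where e: "e = {u, v}" "u \<noteq> v" and uv: "u \<in> V" "v \<in> V"
      using eF F by (auto simp: edges_def card_2_iff)
    have "u \<in> A \<longleftrightarrow> v \<in> A" using cl[of u v] cl[of v u] eF e by (auto simp: insert_commute)
    then show ?thesis using e uv edge_in_edges_iff by auto
  qed
  then show eq: "F = (F \<inter> edges A) \<union> (F \<inter> edges (V - A))" by blast
  have "comps (A \<union> (V - A)) ((F \<inter> edges A) \<union> (F \<inter> edges (V - A)))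
      = comps A (F \<inter> edges A) \<union> comps (V - A) (F \<inter> edges (V - A))"
    by (rule comps_Un) auto
  then have "A \<in> comps A (F \<inter> edges A) \<union> comps (V - A) (F \<inter> edges (V - A))"
    using A AV eq by (metis Diff_partition)
  moreover have "A \<notin> comps (V - A) (F \<inter> edges (V - A))"
    using comps_sub AV by blast
  ultimately show "A \<in> comps A (F \<inter> edges A)" by blast
qed

lemma choose_two_add: "(a + b) choose 2 = (a choose 2) + (b choose 2) + a * (b::nat)"
proof (induction b)
  case (Suc b)
  have "(a + Suc b) choose 2 = (a + b) + ((a + b) choose 2)" "Suc b choose 2 = b + (b choose 2)"
    by (simp_all add: numeral_2_eq_2)
  then show ?case using Suc by (simp add: algebra_simps)
qed simp

text \<open>
  The \<open>card A * card (V - A)\<close> edges between the two parts are closed; they are counted by comparing the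
  numbers of all edges.
\<close>
lemma weight_split:
  assumes V: "finite V" "A \<subseteq> V" and F: "F1 \<subseteq> edges A" "F2 \<subseteq> edges (V - A)"
  shows "weight p (edges V) (F1 \<union> F2) =
     weight p (edges A) F1 * weight p (edges (V - A)) F2 * (1 - p) ^ (card A * card (V - A))"
proof -
  have fin: "finite A" "finite (V - A)" using V finite_subset by auto
  have "edges A \<inter> edges (V - A) = {}" by (rule edges_disjoint) auto
  then have cu: "card (F1 \<union> F2) = card F1 + card F2"
    using F fin by (intro card_Un_disjoint) (auto intro: finite_subset)
  have le: "card F1 \<le> card (edges A)" "card F2 \<le> card (edges (V - A))"
    using F fin by (auto intro: card_mono)
  have "card V = card (A \<union> (V - A))" using V by (simp add: Un_absorb1)
  also have "\<dots> = card A + card (V - A)" using fin by (intro card_Un_disjoint) auto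
  finally have cV: "card V = card A + card (V - A)" .
  have "card (edges V) = card (edges A) + card (edges (V - A)) + card A * card (V - A)"
    unfolding card_edges[OF V(1)] card_edges[OF fin(1)] card_edges[OF fin(2)] cV
    by (rule choose_two_add)
  then have "card (edges V) - card (F1 \<union> F2) = (card (edges A) - card F1)
      + (card (edges (V - A)) - card F2) + card A * card (V - A)"
    using le cu by linarith
  then show ?thesis unfolding weight_def by (simp only: cu power_add mult_ac)
qed

text \<open>
  The spatial Markov property: given that \<open>A\<close> is a component, the complement carries an independent
  configuration of the same kind.
\<close>
lemma sum_component:
  assumes V: "finite V" "A \<subseteq> V" "A \<noteq> {}"
  shows "(\<Sum>F\<in>{F\<in>Pow (edges V). A \<in> comps V F}. weight p (edges V) F * q ^ card (comps V F))
     = conn_weight p A * (1 - p) ^ (card A * card (V - A)) * q * part_fun p q (V - A)"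
proof -
  let ?L = "{F\<in>Pow (edges V). A \<in> comps V F}"
  let ?R = "{F\<in>Pow (edges A). A \<in> comps A F} \<times> Pow (edges (V - A))"
  have disj: "edges A \<inter> edges (V - A) = {}" by (rule edges_disjoint) auto
  have comps: "comps V (F1 \<union> F2) = insert A (comps (V - A) F2)"
    if "F1 \<subseteq> edges A" "A \<in> comps A F1" "F2 \<subseteq> edges (V - A)" for F1 F2
  proof -
    have "comps (A \<union> (V - A)) (F1 \<union> F2) = comps A F1 \<union> comps (V - A) F2"
      using that by (intro comps_Un) auto
    moreover have "A \<union> (V - A) = V" using V by blast
    ultimately show ?thesis using connected_iff that by auto
  qed
  have notin: "A \<notin> comps (V - A) F2" for F2 using comps_sub V by blast
  have "(\<Sum>F\<in>?L. weight p (edges V) F * q ^ card (comps V F)) =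
    (\<Sum>(F1, F2)\<in>?R. weight p (edges V) (F1 \<union> F2) * q ^ card (comps V (F1 \<union> F2)))"
  proof (rule sum.reindex_bij_witness[where i = "\<lambda>(F1, F2). F1 \<union> F2"
        and j = "\<lambda>F. (F \<inter> edges A, F \<inter> edges (V - A))"], goal_cases)
    case (1 F)
    then show ?case using component_split(1)[of A V F] by auto
  next
    case (2 F)
    then show ?case using component_split(2)[of A V F] by auto
  next
    case (3 x)
    then show ?case using disj by (cases x) auto
  next
    case (4 x)
    have "edges A \<subseteq> edges V" "edges (V - A) \<subseteq> edges V" using V by (auto intro!: edges_mono)
    then show ?case using 4 comps by (cases x) auto
  next
    case (5 F)
    then show ?case using component_split(1)[of A V F] by auto
  qed
  also have "\<dots> = (\<Sum>(F1, F2)\<in>?R. weight p (edges A) F1 * (1 - p) ^ (card A * card (V - A)) * q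
      * (weight p (edges (V - A)) F2 * q ^ card (comps (V - A) F2)))"
  proof (rule sum.cong, goal_cases)
    case (2 x)
    obtain F1 F2 where x: "x = (F1, F2)" by (cases x)
    have "card (comps V (F1 \<union> F2)) = Suc (card (comps (V - A) F2))"
      using comps[of F1 F2] notin 2 x V by auto
    then show ?case using weight_split[of V A F1 F2 p] 2 x V by (auto simp: algebra_simps)
  qed simp
  also have "\<dots> = conn_weight p A * (1 - p) ^ (card A * card (V - A)) * q * part_fun p q (V - A)"
    by (simp add: conn_weight_def part_fun_def sum_distrib_right sum_distrib_left
        sum.cartesian_product algebra_simps)
  finally show ?thesis .
qed

text \<open>
  Every configuration is classified by the component of the vertex \<open>v\<close>.
\<close>
lemma part_fun_rec:
  assumes V: "finite V" "v \<in> V"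
  shows "part_fun p q V = (\<Sum>A\<in>{A. A \<subseteq> V \<and> v \<in> A}.
     conn_weight p A * (1 - p) ^ (card A * card (V - A)) * q * part_fun p q (V - A))"
proof -
  let ?f = "\<lambda>F. weight p (edges V) F * q ^ card (comps V F)"
  have "part_fun p q V = sum ?f (Pow (edges V))" by (simp add: part_fun_def)
  also have "\<dots> = (\<Sum>A\<in>{A. A \<subseteq> V \<and> v \<in> A}. sum ?f {F \<in> Pow (edges V). comp_of V F v = A})"
    using V by (intro sum.group[symmetric]) (auto simp: comp_of_def)
  also have "\<dots> = (\<Sum>A\<in>{A. A \<subseteq> V \<and> v \<in> A}. sum ?f {F \<in> Pow (edges V). A \<in> comps V F})"
  proof (rule sum.cong, goal_cases)
    case (2 A)
    have "comp_of V F v = A \<longleftrightarrow> A \<in> comps V F" for F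
      using 2 V comps_eq_comp_of[of A V F v] comp_of_in_comps[of v V F] by auto
    then show ?case by simp
  qed simp
  also have "\<dots> = (\<Sum>A\<in>{A. A \<subseteq> V \<and> v \<in> A}.
     conn_weight p A * (1 - p) ^ (card A * card (V - A)) * q * part_fun p q (V - A))"
    using V by (intro sum.cong sum_component) auto
  finally show ?thesis .
qed

lemma sum_weight: "finite E \<Longrightarrow> (\<Sum>F\<in>Pow E. weight p E F) = 1"
proof -
  assume E: "finite E"
  have "(\<Sum>F\<in>Pow E. weight p E F) = (\<Sum>F\<in>Pow E. (\<Prod>e\<in>F. p) * (\<Prod>e\<in>E - F. 1 - p))"
    using E by (intro sum.cong) (auto simp: weight_def card_Diff_subset finite_subset)
  also have "\<dots> = (\<Prod>e\<in>E. p + (1 - p))" using E by (rule prod_add[symmetric])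
  finally show ?thesis by simp
qed

lemma part_fun_one: "finite V \<Longrightarrow> part_fun p 1 V = 1"
  by (simp add: part_fun_def sum_weight)

lemma part_fun_empty [simp]: "part_fun p q {} = 1"
proof -
  have "edges {} = {}" by (auto simp: edges_def)
  then show ?thesis by (simp add: part_fun_def weight_def comps_def)
qed

lemma sum_subsets_by_card:
  fixes f :: "nat \<Rightarrow> real"
  assumes "finite V"
  shows "(\<Sum>A\<in>Pow V. f (card A)) = (\<Sum>j\<le>card V. real (card V choose j) * f j)"
proof -
  have "(\<Sum>A\<in>Pow V. f (card A)) = (\<Sum>j\<le>card V. \<Sum>A\<in>{A \<in> Pow V. card A = j}. f (card A))"
    using assms by (intro sum.group[symmetric]) (auto intro: card_mono)
  also have "\<dots> = (\<Sum>j\<le>card V. real (card V choose j) * f j)"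
    using assms by (intro sum.cong) (auto simp: n_subsets)
  finally show ?thesis .
qed

lemma sum_subsets_containing:
  fixes f :: "nat \<Rightarrow> real"
  assumes "finite V" "v \<in> V"
  shows "(\<Sum>A\<in>{A. A \<subseteq> V \<and> v \<in> A}. f (card A))
     = (\<Sum>j=1..card V. real ((card V - 1) choose (j - 1)) * f j)"
proof -
  have "(\<Sum>A\<in>{A. A \<subseteq> V \<and> v \<in> A}. f (card A)) = (\<Sum>B\<in>Pow (V - {v}). f (Suc (card B)))"
  proof (rule sum.reindex_bij_witness[where i = "insert v" and j = "\<lambda>A. A - {v}"], goal_cases)
    case (5 A)
    then show ?case using assms
      by (metis (mono_tags, lifting) card_Suc_Diff1 finite_subset mem_Collect_eq)
  qed (use assms in auto)
  also have "\<dots> = (\<Sum>j\<le>card V - 1. real ((card V - 1) choose j) * f (Suc j))"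
    using assms sum_subsets_by_card[of "V - {v}" "\<lambda>j. f (Suc j)"] by simp
  also have "\<dots> = (\<Sum>j=1..card V. real ((card V - 1) choose (j - 1)) * f j)"
  proof (rule sum.reindex_bij_witness[where i = "\<lambda>j. j - 1" and j = Suc], goal_cases)
    case (2 j)
    then show ?case using assms by (auto simp: card_gt_0_iff Suc_le_eq)
      (metis card_gt_0_iff Suc_pred le_imp_less_Suc empty_iff)
  qed auto
  finally show ?thesis .
qed

definition conn_prob :: "real \<Rightarrow> nat \<Rightarrow> real" where
  "conn_prob p j = conn_weight p {1..j}"

definition rc_Z :: "real \<Rightarrow> real \<Rightarrow> nat \<Rightarrow> real" where
  "rc_Z p q N = part_fun p q {1..N}"

text \<open>
  The probability that the component of a given vertex of \<open>G(N, p)\<close> has \<open>j\<close> vertices.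
\<close>
definition size_prob :: "real \<Rightarrow> nat \<Rightarrow> nat \<Rightarrow> real" where
  "size_prob p N j = real ((N - 1) choose (j - 1)) * conn_prob p j * (1 - p) ^ (j * (N - j))"

text \<open>
  For \<open>q = 1\<close> the recursion has left-hand side 1 and can be solved for the term \<open>A = V\<close>.  It therefore
  determines the connection probabilities, and shows without any relabelling of vertices
  that they depend only on the number of vertices.
\<close>
lemma conn_weight_rec:
  assumes V: "finite V" "v \<in> V"
  shows "conn_weight p V = 1 - (\<Sum>A\<in>{A. A \<subseteq> V \<and> v \<in> A} - {V}.
     conn_weight p A * (1 - p) ^ (card A * (card V - card A)))"
proof -
  have "1 = (\<Sum>A\<in>{A. A \<subseteq> V \<and> v \<in> A}.
     conn_weight p A * (1 - p) ^ (card A * card (V - A)) * 1 * part_fun p 1 (V - A))"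
    using part_fun_rec[OF V, of p 1] part_fun_one[OF V(1)] by simp
  also have "\<dots> = (\<Sum>A\<in>{A. A \<subseteq> V \<and> v \<in> A}. conn_weight p A * (1 - p) ^ (card A * (card V - card A)))"
    using V by (intro sum.cong) (auto simp: part_fun_one card_Diff_subset finite_subset)
  also have "\<dots> = conn_weight p V + (\<Sum>A\<in>{A. A \<subseteq> V \<and> v \<in> A} - {V}.
     conn_weight p A * (1 - p) ^ (card A * (card V - card A)))"
    using V by (subst sum.remove[of _ V]) auto
  finally show ?thesis by simp
qed

lemma conn_weight_card:
  "finite A \<Longrightarrow> conn_weight p A = conn_prob p (card A)"
proof (induction "card A" arbitrary: A rule: less_induct)
  case less
  show ?case
  proof (cases "A = {}")
    case True then show ?thesis by (simp add: conn_prob_def)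
  next
    case False
    have rec: "conn_weight p V = 1 - (\<Sum>j=1..card V - 1. real ((card V - 1) choose (j - 1))
        * (conn_prob p j * (1 - p) ^ (j * (card V - j))))"
      if V: "finite V" "card V = card A" for V
    proof -
      let ?g = "\<lambda>j. if j = card V then 0 else conn_prob p j * (1 - p) ^ (j * (card V - j))"
      obtain v where v: "v \<in> V" using False less.prems V by force
      have "conn_weight p V = 1 - (\<Sum>B\<in>{B. B \<subseteq> V \<and> v \<in> B} - {V}.
         conn_weight p B * (1 - p) ^ (card B * (card V - card B)))"
        by (rule conn_weight_rec[OF V(1) v])
      also have "(\<Sum>B\<in>{B. B \<subseteq> V \<and> v \<in> B} - {V}.
         conn_weight p B * (1 - p) ^ (card B * (card V - card B)))
         = (\<Sum>B\<in>{B. B \<subseteq> V \<and> v \<in> B} - {V}. ?g (card B))"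
      proof (rule sum.cong, goal_cases)
        case (2 B)
        then have "B \<subset> V" "finite B" using V finite_subset by auto
        then have "card B < card V" using V psubset_card_mono by blast
        then show ?case using less.hyps[of B] V \<open>finite B\<close> by simp
      qed simp
      also have "\<dots> = (\<Sum>B\<in>{B. B \<subseteq> V \<and> v \<in> B}. ?g (card B))"
        using V v by (subst sum.remove[of _ V]) auto
      also have "\<dots> = (\<Sum>j=1..card V. real ((card V - 1) choose (j - 1)) * ?g j)"
        by (rule sum_subsets_containing[OF V(1) v])
      also have "\<dots> = (\<Sum>j=1..card V - 1. real ((card V - 1) choose (j - 1)) * ?g j)"
        by (rule sum.mono_neutral_right) auto
      also have "\<dots> = (\<Sum>j=1..card V - 1. real ((card V - 1) choose (j - 1))
         * (conn_prob p j * (1 - p) ^ (j * (card V - j))))"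
        by (intro sum.cong) auto
      finally show ?thesis .
    qed
    show ?thesis using rec[of A] rec[of "{1..card A}"] less.prems by (simp add: conn_prob_def)
  qed
qed

lemma part_fun_card: "finite V \<Longrightarrow> part_fun p q V = rc_Z p q (card V)"
proof (induction "card V" arbitrary: V rule: less_induct)
  case less
  show ?case
  proof (cases "V = {}")
    case True then show ?thesis by (simp add: rc_Z_def)
  next
    case False
    have rec: "part_fun p q U = (\<Sum>j=1..card U. real ((card U - 1) choose (j - 1)) *
        (conn_prob p j * (1 - p) ^ (j * (card U - j)) * q * rc_Z p q (card U - j)))"
      if U: "finite U" "card U = card V" for U
    proof -
      obtain v where v: "v \<in> U" using False less.prems U by force
      have "part_fun p q U = (\<Sum>A\<in>{A. A \<subseteq> U \<and> v \<in> A}.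
         conn_prob p (card A) * (1 - p) ^ (card A * (card U - card A)) * q * rc_Z p q (card U - card A))"
        unfolding part_fun_rec[OF U(1) v]
      proof (rule sum.cong, goal_cases)
        case (2 A)
        then have A: "finite A" "A \<subseteq> U" "v \<in> A" using U finite_subset by auto
        have "card (U - A) < card U" using A U by (intro psubset_card_mono) auto
        then have "part_fun p q (U - A) = rc_Z p q (card (U - A))"
          using less.hyps[of "U - A"] U by simp
        then show ?case using A by (simp add: conn_weight_card card_Diff_subset)
      qed simp
      then show ?thesis using sum_subsets_containing[OF U(1) v, of
        "\<lambda>j. conn_prob p j * (1 - p) ^ (j * (card U - j)) * q * rc_Z p q (card U - j)"] by simp
    qed
    show ?thesis using rec[of V] rec[of "{1..card V}"] less.prems by (simp add: rc_Z_def)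
  qed
qed

lemma rc_Z_0 [simp]: "rc_Z p q 0 = 1"
  by (simp add: rc_Z_def)

lemma rc_Z_one [simp]: "rc_Z p 1 N = 1"
  by (simp add: rc_Z_def part_fun_one)

lemma rc_Z_rec:
  assumes "N \<ge> 1"
  shows "rc_Z p q N = q * (\<Sum>j=1..N. size_prob p N j * rc_Z p q (N - j))"
proof -
  have "rc_Z p q N = (\<Sum>A\<in>{A. A \<subseteq> {1..N} \<and> 1 \<in> A}.
     conn_prob p (card A) * (1 - p) ^ (card A * (N - card A)) * q * rc_Z p q (N - card A))"
    unfolding rc_Z_def[of p q N]
    using part_fun_rec[of "{1..N}" 1 p q] assms
    by (auto intro!: sum.cong simp: conn_weight_card part_fun_card card_Diff_subset finite_subset)
  also have "\<dots> = (\<Sum>j=1..N. real ((N - 1) choose (j - 1)) *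
      (conn_prob p j * (1 - p) ^ (j * (N - j)) * q * rc_Z p q (N - j)))"
    using sum_subsets_containing[of "{1..N}" 1 "\<lambda>j. conn_prob p j * (1 - p) ^ (j * (N - j)) * q * rc_Z p q (N - j)"] assms
    by simp
  finally show ?thesis by (simp add: size_prob_def sum_distrib_left algebra_simps)
qed

text \<open>
  The identity behind all later estimates.  It holds for all volumes \<open>N\<close> with the same \<open>p\<close> and hence
  with the same connection probabilities.
\<close>
lemma size_prob_sum: "N \<ge> 1 \<Longrightarrow> (\<Sum>j=1..N. size_prob p N j) = 1"
  using rc_Z_rec[of N p 1] by simp

text \<open>
  The expected number of components of \<open>G(N, p)\<close>, as \<open>sum_num_comps\<close> shows.
\<close>
definition mean_comps :: "real \<Rightarrow> nat \<Rightarrow> real" where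
  "mean_comps p N = (\<Sum>j=1..N. real (N choose j) * conn_prob p j * (1 - p) ^ (j * (N - j)))"

text \<open>
  The number of components is the number of vertex sets that are components, so its mean is a sum of the
  probabilities given by \<open>sum_component\<close> at \<open>q = 1\<close>.
\<close>
lemma sum_num_comps:
  "(\<Sum>F\<in>Pow (edges {1..N}). weight p (edges {1..N}) F * real (card (comps {1..N} F))) = mean_comps p N"
proof -
  let ?V = "{1..N}" let ?w = "weight p (edges ?V)"
  have "(\<Sum>F\<in>Pow (edges ?V). ?w F * real (card (comps ?V F)))
      = (\<Sum>F\<in>Pow (edges ?V). \<Sum>A\<in>Pow ?V - {{}}. if A \<in> comps ?V F then ?w F else 0)"
  proof (rule sum.cong, goal_cases)
    case (2 F)
    have "{A\<in>Pow ?V - {{}}. A \<in> comps ?V F} = comps ?V F" using comps_sub by blast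
    moreover have "(\<Sum>A\<in>Pow ?V - {{}}. if A \<in> comps ?V F then ?w F else 0)
       = (\<Sum>A\<in>{A\<in>Pow ?V - {{}}. A \<in> comps ?V F}. ?w F)"
      by (rule sum.inter_filter[symmetric]) simp
    ultimately show ?case by simp
  qed simp
  also have "\<dots> = (\<Sum>A\<in>Pow ?V - {{}}. \<Sum>F\<in>Pow (edges ?V). if A \<in> comps ?V F then ?w F else 0)"
    by (rule sum.swap)
  also have "\<dots> = (\<Sum>A\<in>Pow ?V - {{}}. conn_prob p (card A) * (1 - p) ^ (card A * (N - card A)))"
  proof (rule sum.cong, goal_cases)
    case (2 A)
    have "(\<Sum>F\<in>Pow (edges ?V). if A \<in> comps ?V F then ?w F else 0)
       = (\<Sum>F\<in>{F\<in>Pow (edges ?V). A \<in> comps ?V F}. ?w F * 1 ^ card (comps ?V F))"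
      unfolding power_one mult_1_right by (rule sum.inter_filter[symmetric]) simp
    also have "\<dots> = conn_weight p A * (1 - p) ^ (card A * card (?V - A)) * 1 * part_fun p 1 (?V - A)"
      using 2 by (intro sum_component) auto
    finally show ?case using 2
      by (auto simp: part_fun_one conn_weight_card card_Diff_subset finite_subset)
  qed simp
  also have "\<dots> = (\<Sum>A\<in>Pow ?V. (\<lambda>j. if j = 0 then 0 else conn_prob p j * (1 - p) ^ (j * (N - j))) (card A))"
    by (rule sum.mono_neutral_cong_left) (auto simp: finite_subset)
  also have "\<dots> = (\<Sum>j\<le>N. real (N choose j) * (if j = 0 then 0 else conn_prob p j * (1 - p) ^ (j * (N - j))))"
    using sum_subsets_by_card[of ?V "\<lambda>j. if j = 0 then 0 else conn_prob p j * (1 - p) ^ (j * (N - j))"]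
    by simp
  also have "\<dots> = mean_comps p N"
    unfolding mean_comps_def by (rule sum.mono_neutral_cong_right) auto
  finally show ?thesis .
qed

lemma sum_num_edges:
  assumes "finite E"
  shows "(\<Sum>F\<in>Pow E. weight p E F * real (card F)) = p * real (card E)"
  using assms
proof (induction E rule: finite_induct)
  case empty
  then show ?case by simp
next
  case (insert e E)
  have w1: "weight p (insert e E) F = (1 - p) * weight p E F" if "F \<in> Pow E" for F
  proof -
    have "card F \<le> card E" using that insert by (auto intro: card_mono)
    then show ?thesis using insert by (simp add: weight_def Suc_diff_le)
  qed
  have w2: "weight p (insert e E) (insert e F) = p * weight p E F"
      "card (insert e F) = Suc (card F)" if "F \<in> Pow E" for F
  proof -
    have F: "finite F" "e \<notin> F" using that insert finite_subset by auto
    then show "card (insert e F) = Suc (card F)" by simp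
    then show "weight p (insert e E) (insert e F) = p * weight p E F"
      using insert F by (simp add: weight_def)
  qed
  have "(\<Sum>F\<in>Pow (insert e E). weight p (insert e E) F * real (card F))
     = (\<Sum>F\<in>Pow E. weight p (insert e E) F * real (card F))
     + (\<Sum>F\<in>insert e ` Pow E. weight p (insert e E) F * real (card F))"
    unfolding Pow_insert using insert by (intro sum.union_disjoint) auto
  also have "(\<Sum>F\<in>insert e ` Pow E. weight p (insert e E) F * real (card F))
     = (\<Sum>F\<in>Pow E. weight p (insert e E) (insert e F) * real (card (insert e F)))"
    using insert(2) by (subst sum.reindex) (auto simp: inj_on_def)
  also have "(\<Sum>F\<in>Pow E. weight p (insert e E) F * real (card F)) + \<dots>
     = (\<Sum>F\<in>Pow E. weight p E F * real (card F)) + p * (\<Sum>F\<in>Pow E. weight p E F)"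
    unfolding sum_distrib_left sum.distrib[symmetric]
    by (intro sum.cong) (auto simp: w1 w2 algebra_simps)
  finally show ?case using insert by (simp add: sum_weight algebra_simps)
qed

lemma conn_prob_nonneg: "0 \<le> p \<Longrightarrow> p \<le> 1 \<Longrightarrow> conn_prob p j \<ge> 0"
  by (auto simp: conn_prob_def conn_weight_def weight_def intro!: sum_nonneg)

lemma size_prob_nonneg: "0 \<le> p \<Longrightarrow> p \<le> 1 \<Longrightarrow> size_prob p N j \<ge> 0"
  by (simp add: size_prob_def conn_prob_nonneg)

lemma rc_Z_nonneg: "0 \<le> p \<Longrightarrow> p \<le> 1 \<Longrightarrow> 0 \<le> q \<Longrightarrow> rc_Z p q N \<ge> 0"
  by (auto simp: rc_Z_def part_fun_def weight_def intro!: sum_nonneg)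

lemma rc_partition_eq: "rc_partition n l q = rc_Z (l / real n) q n"
proof -
  let ?E = "K_edges n" let ?p = "l / real n" let ?V = "{1..n}"
  have E: "?E = edges ?V"
    unfolding K_edges_def K_verts_def edges_def card_2_iff by blast
  have fin: "finite ?E" unfolding E by simp
  have comps: "rc_components n \<omega> = comps ?V {e\<in>?E. \<omega> e = 1}" for \<omega>
  proof -
    have adj: "open_adj n \<omega> = adj {e\<in>?E. \<omega> e = 1}" by (auto simp: open_adj_def adj_def)
    have "((adj F)\<^sup>* \<inter> ?V \<times> ?V) `` {x} = comp_of ?V F x" if "x \<in> ?V" for x F
      using that by (auto simp: comp_of_def)
    then show ?thesis unfolding rc_components_def adj K_verts_def quotient_def comps_def by auto
  qed
  have w: "(\<Prod>e\<in>?E. ?p ^ \<omega> e * (1 - ?p) ^ (1 - \<omega> e)) = weight ?p ?E {e\<in>?E. \<omega> e = 1}"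
    if "\<omega> \<in> rc_configs n" for \<omega>
  proof -
    have "(\<Prod>e\<in>?E. ?p ^ \<omega> e * (1 - ?p) ^ (1 - \<omega> e)) = (\<Prod>e\<in>?E. if \<omega> e = 1 then ?p else 1 - ?p)"
      using that by (intro prod.cong) (auto simp: rc_configs_def PiE_def Pi_def)
    also have "\<dots> = ?p ^ card {e\<in>?E. \<omega> e = 1} * (1 - ?p) ^ card {e\<in>?E. \<omega> e \<noteq> 1}"
      using fin by (simp add: prod.If_cases Int_def)
    also have "{e\<in>?E. \<omega> e \<noteq> 1} = ?E - {e\<in>?E. \<omega> e = 1}" by auto
    also have "card \<dots> = card ?E - card {e\<in>?E. \<omega> e = 1}"
      using fin by (intro card_Diff_subset) auto
    finally show ?thesis by (simp add: weight_def)
  qed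
  have "rc_partition n l q = (\<Sum>\<omega>\<in>rc_configs n. weight ?p ?E {e\<in>?E. \<omega> e = 1}
       * q ^ card (comps ?V {e\<in>?E. \<omega> e = 1}))"
    unfolding rc_partition_def Let_def num_components_def comps using w by (intro sum.cong) auto
  also have "\<dots> = (\<Sum>F\<in>Pow ?E. weight ?p ?E F * q ^ card (comps ?V F))"
  proof (rule sum.reindex_bij_witness[where j = "\<lambda>\<omega>. {e\<in>?E. \<omega> e = 1}"
        and i = "\<lambda>F. \<lambda>e. if e \<in> ?E then (if e \<in> F then 1 else 0) else undefined"], goal_cases)
    case (1 \<omega>)
    then show ?case by (auto simp: rc_configs_def PiE_def Pi_def extensional_def fun_eq_iff)
  next
    case (4 F)
    then show ?case by (auto simp: rc_configs_def split: if_splits)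
  qed (auto simp: rc_configs_def)
  finally show ?thesis unfolding E by (simp add: rc_Z_def part_fun_def)
qed

section \<open>The mean number of components and a lower bound on the partition function\<close>

text \<open>
  Enlarging the volume by one vertex multiplies the probability of a component size by an explicit
  factor, because the connection probability cancels.
\<close>
lemma size_prob_Suc:
  assumes "1 \<le> j" "j \<le> N"
  shows "size_prob p (Suc N) j * (real N + 1 - real j) = size_prob p N j * real N * (1 - p) ^ j"
proof -
  have "(N - (j - 1)) * (N choose (j - 1)) = N * ((N - 1) choose (j - 1))"
    by (rule binomial_absorb_comp)
  then have "real (N - (j - 1)) * real (N choose (j - 1)) = real N * real ((N - 1) choose (j - 1))"
    by (metis of_nat_mult)
  moreover have r: "real (N - (j - 1)) = real N + 1 - real j" using assms by auto
  ultimately have c: "(real N + 1 - real j) * real (N choose (j - 1)) = real N * real ((N - 1) choose (j - 1))"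
    by (simp only:)
  have e: "j * (Suc N - j) = j * (N - j) + j" using assms by (simp add: Suc_diff_le)
  have "size_prob p (Suc N) j * (real N + 1 - real j)
     = ((real N + 1 - real j) * real (N choose (j - 1))) * (conn_prob p j * (1 - p) ^ (j * (N - j)) * (1 - p) ^ j)"
    unfolding size_prob_def e power_add by (simp only: diff_Suc_1 mult_ac)
  then show ?thesis unfolding c size_prob_def by (simp only: mult_ac)
qed

lemma size_prob_Suc_eq:
  assumes "1 \<le> j" "j \<le> N"
  shows "size_prob p (Suc N) j = size_prob p N j * (real N / (real N + 1 - real j) * (1 - p) ^ j)"
  using size_prob_Suc[OF assms, of p] assms by (simp add: field_simps)

text \<open>
  For \<open>- ln (1 - p) * N < 1\<close> this is the usual bound \<open>1 / (1 - a)\<close> on the mean component size in a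
  subcritical random graph.  It follows by comparing the volumes \<open>N\<close> and \<open>N + 1\<close>: the probabilities
  in both volumes have sum 1, and their ratio at \<open>j\<close> is at least
  \<open>exp ((j - 1) / N + ln (1 - p) * j)\<close>, hence at least the linear function of \<open>j\<close> in the exponent plus 1.
\<close>
lemma mean_size_le:
  assumes p: "0 < p" "p < 1" and N: "N \<ge> 1"
  shows "(1 + ln (1 - p) * real N) * (\<Sum>j=1..N. size_prob p N j * real j) \<le> 1"
proof -
  let ?P = "size_prob p N" and ?c = "- ln (1 - p)"
  have nn: "size_prob p M j \<ge> 0" for M j using p by (intro size_prob_nonneg) auto
  have "(\<Sum>j=1..N. size_prob p (Suc N) j) \<le> (\<Sum>j=1..Suc N. size_prob p (Suc N) j)"
    using nn by (intro sum_mono2) auto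
  then have le1: "(\<Sum>j=1..N. size_prob p (Suc N) j) \<le> 1"
    using size_prob_sum[of "Suc N" p] by simp
  have ge: "?P j * (1 + ((real j - 1) / real N - ?c * real j)) \<le> size_prob p (Suc N) j"
    if j: "j \<in> {1..N}" for j
  proof -
    let ?y = "(real j - 1) / real N"
    have y: "1 - ?y > 0" using j N by (auto simp: field_simps)
    have e: "real N / (real N + 1 - real j) = 1 / (1 - ?y)" using j N by (simp add: field_simps)
    have "1 - ?y \<le> exp (- ?y)" using exp_ge_add_one_self[of "- ?y"] by simp
    then have "exp ?y \<le> 1 / (1 - ?y)" using y by (simp add: exp_minus field_simps)
    moreover have "(1 - p) ^ j = exp (- ?c * real j)"
      using p by (simp add: exp_of_nat_mult mult.commute)
    moreover have "exp (?y - ?c * real j) = exp ?y * exp (- ?c * real j)"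
      by (simp flip: exp_add)
    ultimately have "exp (?y - ?c * real j) \<le> 1 / (1 - ?y) * (1 - p) ^ j"
      by (metis exp_ge_zero mult_right_mono)
    then have "1 + (?y - ?c * real j) \<le> 1 / (1 - ?y) * (1 - p) ^ j"
      using exp_ge_add_one_self[of "?y - ?c * real j"] by linarith
    then have "?P j * (1 + (?y - ?c * real j)) \<le> ?P j * (real N / (real N + 1 - real j) * (1 - p) ^ j)"
      unfolding e using nn by (intro mult_left_mono) auto
    then show ?thesis using size_prob_Suc_eq[of j N p] j by simp
  qed
  have "(\<Sum>j=1..N. ?P j * (1 + ((real j - 1) / real N - ?c * real j))) \<le> (\<Sum>j=1..N. size_prob p (Suc N) j)"
    by (rule sum_mono) (rule ge)
  moreover have "(\<Sum>j=1..N. ?P j * (1 + ((real j - 1) / real N - ?c * real j)))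
     \<comment> \<open>the affine function of \<open>j\<close>, sorted so that \<open>size_prob_sum\<close> and the mean size appear\<close>
     = (\<Sum>j=1..N. ?P j * (1 - 1 / real N) + (1 / real N - ?c) * (?P j * real j))"
    using N by (intro sum.cong) (auto simp: field_simps)
  moreover have "\<dots> = (1 - 1 / real N) + (1 / real N - ?c) * (\<Sum>j=1..N. ?P j * real j)"
    unfolding sum.distrib sum_distrib_right[symmetric] sum_distrib_left[symmetric]
    using size_prob_sum[OF N, of p] by simp
  ultimately have "(1 / real N - ?c) * (\<Sum>j=1..N. ?P j * real j) \<le> 1 / real N"
    using le1 by linarith
  then have "real N * ((1 / real N - ?c) * (\<Sum>j=1..N. ?P j * real j)) \<le> real N * (1 / real N)"
    by (rule mult_left_mono) simp
  then show ?thesis using N by (simp add: algebra_simps)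
qed

lemma choose_conn_eq:
  assumes "1 \<le> j" "j \<le> N"
  shows "real (N choose j) * conn_prob p j * (1 - p) ^ (j * (N - j)) = real N / real j * size_prob p N j"
proof -
  have "j * (N choose j) = N * ((N - 1) choose (j - 1))"
    using assms by (intro times_binomial_minus1_eq) auto
  then have "real j * real (N choose j) = real N * real ((N - 1) choose (j - 1))"
    by (metis of_nat_mult)
  then have "real (N choose j) = real N / real j * real ((N - 1) choose (j - 1))"
    using assms by (simp add: field_simps)
  then show ?thesis by (simp add: size_prob_def)
qed

text \<open>
  A new vertex adds one component and merges the old components to which it is joined.
  Formally this is Pascal's rule together with \<open>size_prob_sum\<close> in the larger volume.
\<close>
lemma mean_comps_Suc:
  "mean_comps p (Suc N) = mean_comps p N + 1
     - (\<Sum>j=1..N. real N / real j * size_prob p N j * (1 - (1 - p) ^ j))"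
proof -
  have "mean_comps p (Suc N) = (\<Sum>j=1..Suc N. size_prob p (Suc N) j
     + real (N choose j) * conn_prob p j * (1 - p) ^ (j * (Suc N - j)))"
    unfolding mean_comps_def size_prob_def
  proof (rule sum.cong, goal_cases)
    case (2 j)
    then have "Suc N choose j = (N choose (j - 1)) + (N choose j)"
      by (cases j) auto
    then show ?case by (simp add: algebra_simps)
  qed simp
  also have "\<dots> = 1 + (\<Sum>j=1..Suc N. real (N choose j) * conn_prob p j * (1 - p) ^ (j * (Suc N - j)))"
    unfolding sum.distrib using size_prob_sum[of "Suc N" p] by simp
  also have "(\<Sum>j=1..Suc N. real (N choose j) * conn_prob p j * (1 - p) ^ (j * (Suc N - j)))
    = (\<Sum>j=1..N. real N / real j * size_prob p N j * (1 - p) ^ j)"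
  proof (rule sum.mono_neutral_cong_right, goal_cases)
    case (4 j)
    then have "j * (Suc N - j) = j * (N - j) + j" by (simp add: Suc_diff_le)
    then have "real (N choose j) * conn_prob p j * (1 - p) ^ (j * (Suc N - j))
       = (real (N choose j) * conn_prob p j * (1 - p) ^ (j * (N - j))) * (1 - p) ^ j"
      by (simp only: power_add mult.assoc)
    then show ?case using choose_conn_eq[of j N p] 4 by (simp only: atLeastAtMost_iff)
  qed (auto simp: not_le le_Suc_eq)
  also have "\<dots> = (\<Sum>j=1..N. real N / real j * size_prob p N j)
      - (\<Sum>j=1..N. real N / real j * size_prob p N j * (1 - (1 - p) ^ j))"
    unfolding sum_subtractf[symmetric] by (intro sum.cong) (auto simp: right_diff_distrib)
  also have "(\<Sum>j=1..N. real N / real j * size_prob p N j) = mean_comps p N"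
    unfolding mean_comps_def by (intro sum.cong) (use choose_conn_eq in auto)
  finally show ?thesis by simp
qed

text \<open>
  The expected number of independent cycles (edges plus components minus vertices) of \<open>G(N, p)\<close>.
\<close>
definition mean_excess :: "real \<Rightarrow> nat \<Rightarrow> real" where
  "mean_excess p N = p * real (N choose 2) + mean_comps p N - real N"

lemma one_minus_power_le: "0 \<le> p \<Longrightarrow> p \<le> 1 \<Longrightarrow> 1 - (1 - p) ^ j \<le> p * real j" for p :: real
  using Bernoulli_inequality[of "- p" j] by (simp add: mult.commute)

text \<open>
  The second Bonferroni inequality for \<open>j\<close> independent events of probability \<open>p\<close>.
\<close>
lemma one_minus_power_ge:
  fixes p :: real
  assumes "0 \<le> p" "p \<le> 1"
  shows "p * real j - p\<^sup>2 * (real j)\<^sup>2 / 2 \<le> 1 - (1 - p) ^ j"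
proof (induction j)
  case (Suc j)
  have "(1 - p) ^ Suc j \<le> (1 - p) * (1 - p * real j + p\<^sup>2 * (real j)\<^sup>2 / 2)"
    using Suc assms by (simp add: mult_left_mono)
  also have "\<dots> = 1 - p * (real j + 1) + p\<^sup>2 * (real j)\<^sup>2 / 2 + p\<^sup>2 * real j - p ^ 3 * (real j)\<^sup>2 / 2"
    by (simp add: field_simps power2_eq_square power3_eq_cube)
  also have "\<dots> \<le> 1 - p * (real j + 1) + p\<^sup>2 * (real j + 1)\<^sup>2 / 2"
  proof -
    have "p\<^sup>2 * (real j + 1)\<^sup>2 / 2 = p\<^sup>2 * (real j)\<^sup>2 / 2 + p\<^sup>2 * real j + p\<^sup>2 / 2"
      by (simp add: field_simps power2_eq_square)
    moreover have "0 \<le> p\<^sup>2" "0 \<le> p ^ 3 * (real j)\<^sup>2" using assms by simp_all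
    ultimately show ?thesis by linarith
  qed
  finally show ?case by (simp add: algebra_simps)
qed simp

text \<open>
  The new vertex has \<open>p * N\<close> open edges on average and merges \<open>1 - (1 - p) ^ j\<close> components on average
  for each component of size \<open>j\<close>; the difference, created by components that are hit at least twice,
  is controlled by the mean component size.
\<close>
lemma mean_excess_Suc:
  assumes p: "0 \<le> p" "p \<le> 1"
  shows "mean_excess p N \<le> mean_excess p (Suc N)"
    "mean_excess p (Suc N) \<le> mean_excess p N + p\<^sup>2 * real N / 2 * (\<Sum>j=1..N. size_prob p N j * real j)"
proof -
  let ?S = "\<Sum>j=1..N. real N / real j * size_prob p N j * (1 - (1 - p) ^ j)"
  have nn: "size_prob p M j \<ge> 0" for M j using p by (intro size_prob_nonneg) auto
  have eq: "mean_excess p (Suc N) = mean_excess p N + p * real N - ?S"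
    unfolding mean_excess_def mean_comps_Suc by (simp add: numeral_2_eq_2 algebra_simps)
  have pN: "(\<Sum>j=1..N. p * real N * size_prob p N j) = p * real N"
    unfolding sum_distrib_left[symmetric] using size_prob_sum[of N p] by (cases N) auto
  have "?S \<le> (\<Sum>j=1..N. p * real N * size_prob p N j)"
  proof (rule sum_mono)
    fix j assume j: "j \<in> {1..N}"
    have "real N / real j * size_prob p N j * (1 - (1 - p) ^ j)
       \<le> real N / real j * size_prob p N j * (p * real j)"
      using one_minus_power_le[OF p] nn by (intro mult_left_mono) auto
    then show "real N / real j * size_prob p N j * (1 - (1 - p) ^ j) \<le> p * real N * size_prob p N j"
      using j by (simp add: mult_ac)
  qed
  then show "mean_excess p N \<le> mean_excess p (Suc N)" using eq pN by linarith
  have "(\<Sum>j=1..N. p * real N * size_prob p N j - p\<^sup>2 * real N / 2 * (size_prob p N j * real j)) \<le> ?S"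
  proof (rule sum_mono)
    fix j assume j: "j \<in> {1..N}"
    have "real N / real j * size_prob p N j * (p * real j - p\<^sup>2 * (real j)\<^sup>2 / 2)
       \<le> real N / real j * size_prob p N j * (1 - (1 - p) ^ j)"
      using one_minus_power_ge[OF p] nn by (intro mult_left_mono) auto
    moreover have "real N / real j * size_prob p N j * (p * real j - p\<^sup>2 * (real j)\<^sup>2 / 2)
       = p * real N * size_prob p N j - p\<^sup>2 * real N / 2 * (size_prob p N j * real j)"
      using j by (simp add: field_simps power2_eq_square)
    ultimately show "p * real N * size_prob p N j - p\<^sup>2 * real N / 2 * (size_prob p N j * real j)
       \<le> real N / real j * size_prob p N j * (1 - (1 - p) ^ j)" by linarith
  qed
  then show "mean_excess p (Suc N) \<le> mean_excess p N + p\<^sup>2 * real N / 2 * (\<Sum>j=1..N. size_prob p N j * real j)"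
    unfolding sum_subtractf pN sum_distrib_left using eq by linarith
qed

lemma mean_excess_nonneg:
  assumes "0 \<le> p" "p \<le> 1"
  shows "mean_excess p N \<ge> 0"
proof (induction N)
  case 0 show ?case by (simp add: mean_excess_def mean_comps_def numeral_2_eq_2)
next
  case (Suc N) then show ?case using mean_excess_Suc(1)[OF assms, of N] by linarith
qed

text \<open>
  Below criticality the mean component size is bounded, so each of the \<open>N\<close> steps adds only \<open>O(p)\<close>
  independent cycles.
\<close>
lemma mean_excess_le:
  assumes p: "0 < p" "p < 1" and b: "b < 1" and Np: "- ln (1 - p) * real N \<le> b"
  shows "mean_excess p N \<le> 1 / (1 - b)"
proof -
  have lnp: "p \<le> - ln (1 - p)" using ln_add_one_self_le_self2[of "- p"] p by simp
  then have pN: "p * real N \<le> b" using Np mult_right_mono[OF lnp, of "real N"] by simp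
  have b0: "0 \<le> b" using pN p by (smt (verit) mult_nonneg_nonneg of_nat_0_le_iff)
  have "mean_excess p M \<le> p\<^sup>2 * (real M)\<^sup>2 / (1 - b)" if "M \<le> N" for M
    using that
  proof (induction M)
    case 0 show ?case by (simp add: mean_excess_def mean_comps_def numeral_2_eq_2)
  next
    case (Suc M)
    let ?E = "\<Sum>j=1..M. size_prob p M j * real j"
    have E: "p\<^sup>2 * real M / 2 * ?E \<le> p\<^sup>2 * real M / 2 * (1 / (1 - b))"
    proof (cases "M = 0")
      case False
      have E0: "?E \<ge> 0" using p by (intro sum_nonneg mult_nonneg_nonneg size_prob_nonneg) auto
      have "- ln (1 - p) * real M \<le> - ln (1 - p) * real N"
        using Suc.prems p by (intro mult_left_mono) auto
      then have "1 - b \<le> 1 + ln (1 - p) * real M" using Np by simp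
      then have "(1 - b) * ?E \<le> (1 + ln (1 - p) * real M) * ?E" using E0 by (rule mult_right_mono)
      also have "\<dots> \<le> 1" using False by (intro mean_size_le p) auto
      finally have "?E \<le> 1 / (1 - b)" using b by (simp add: field_simps)
      then show ?thesis by (intro mult_left_mono) auto
    qed simp
    have "mean_excess p (Suc M) \<le> p\<^sup>2 * (real M)\<^sup>2 / (1 - b) + p\<^sup>2 * real M / 2 * (1 / (1 - b))"
      using mean_excess_Suc(2)[OF less_imp_le[OF p(1)] less_imp_le[OF p(2)], of M]
        Suc.IH[OF Suc_leD[OF Suc.prems]] E by linarith
    also have "\<dots> = p\<^sup>2 * ((real M)\<^sup>2 + real M / 2) / (1 - b)"
      by (simp add: add_divide_distrib distrib_left)
    also have "\<dots> \<le> p\<^sup>2 * (real (Suc M))\<^sup>2 / (1 - b)"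
      using b by (intro divide_right_mono mult_left_mono) (auto simp: power2_eq_square algebra_simps)
    finally show ?case .
  qed
  from this[of N] have "mean_excess p N \<le> (p * real N)\<^sup>2 / (1 - b)"
    by (simp add: power_mult_distrib)
  also have "\<dots> \<le> 1 / (1 - b)"
    using pN p b b0 by (intro divide_right_mono power_le_one) auto
  finally show ?thesis .
qed

text \<open>
  With \<open>p'\<close> chosen so that \<open>p' / (1 - p') = (p / q) / (1 - p)\<close>, the weight of a configuration is its
  weight at \<open>p'\<close> times \<open>\<sigma> ^ (N choose 2)\<close> times \<open>q\<close> to the power edges plus components.  Jensen's
  inequality, in the form of a tangent to the exponential function, moves the expectation into
  the exponent.
\<close>
lemma rc_Z_ge_jensen:
  assumes p: "0 < p" "p < 1" and q: "q > 0"
  defines "\<sigma> \<equiv> 1 - p + p / q"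
  defines "p' \<equiv> p / q / \<sigma>"
  shows "rc_Z p q N \<ge> q ^ N * \<sigma> ^ (N choose 2) * q powr mean_excess p' N"
proof -
  let ?E = "edges {1..N}" and ?k = "\<lambda>F. card (comps {1..N} F)"
  let ?M = "p' * real (N choose 2) + mean_comps p' N"
  have s: "\<sigma> > 0" unfolding \<sigma>_def using p q by (intro add_pos_pos) auto
  have sp': "\<sigma> * p' = p / q" unfolding p'_def using s by simp
  then have pe: "p = q * \<sigma> * p'" "1 - p = \<sigma> * (1 - p')"
    using q by (simp_all add: right_diff_distrib mult.assoc) (simp add: \<sigma>_def)
  have p'0: "p' > 0" unfolding p'_def using p q s by simp
  have p'1: "p' < 1" using pe(2) p s by (smt (verit) zero_less_mult_iff)
  have cE: "card ?E = N choose 2" by (simp add: card_edges)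
  have summand: "weight p ?E F * q ^ ?k F = \<sigma> ^ (N choose 2) * (weight p' ?E F * q powr (real (card F) + real (?k F)))"
    if "F \<in> Pow ?E" for F
  proof -
    have "card F \<le> N choose 2" using that cE card_mono[of ?E F] by auto
    then have "\<sigma> ^ (N choose 2) = \<sigma> ^ card F * \<sigma> ^ ((N choose 2) - card F)"
      by (simp flip: power_add)
    moreover have "q powr (real (card F) + real (?k F)) = q ^ card F * q ^ ?k F"
      using q by (simp add: powr_add powr_realpow)
    moreover have "p ^ card F = q ^ card F * \<sigma> ^ card F * p' ^ card F"
      by (subst pe(1)) (simp add: power_mult_distrib)
    moreover have "(1 - p) ^ ((N choose 2) - card F)
       = \<sigma> ^ ((N choose 2) - card F) * (1 - p') ^ ((N choose 2) - card F)"
      by (subst pe(2)) (simp add: power_mult_distrib)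
    ultimately show ?thesis unfolding weight_def cE by (simp add: mult_ac)
  qed
  \<comment> \<open>tangent to \<open>x \<mapsto> q powr x\<close> at the mean \<open>?M\<close> of edges plus components\<close>
  have tangent: "q powr ?M * (1 + (x - ?M) * ln q) \<le> q powr x" for x
  proof -
    have "1 + (x - ?M) * ln q \<le> exp ((x - ?M) * ln q)" by (rule exp_ge_add_one_self)
    also have "\<dots> = q powr (x - ?M)" using q by (simp add: powr_def)
    finally have "q powr ?M * (1 + (x - ?M) * ln q) \<le> q powr ?M * q powr (x - ?M)"
      by (rule mult_left_mono) simp
    then show ?thesis by (simp flip: powr_add)
  qed
  have wnn: "weight p' ?E F \<ge> 0" for F using p'0 p'1 by (simp add: weight_def)
  have "q powr ?M = q powr ?M * (\<Sum>F\<in>Pow ?E. weight p' ?E F * (1 + (real (card F) + real (?k F) - ?M) * ln q))"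
  proof -
    have "(\<Sum>F\<in>Pow ?E. weight p' ?E F * (1 + (real (card F) + real (?k F) - ?M) * ln q))
      = (\<Sum>F\<in>Pow ?E. weight p' ?E F * (1 - ?M * ln q) + ln q * (weight p' ?E F * real (card F))
        + ln q * (weight p' ?E F * real (?k F)))"
      by (intro sum.cong) (auto simp: algebra_simps)
    also have "\<dots> = 1 - ?M * ln q + ln q * (p' * real (N choose 2)) + ln q * mean_comps p' N"
      unfolding sum.distrib sum_distrib_left[symmetric] sum_distrib_right[symmetric] sum_num_comps
      by (simp add: sum_weight sum_num_edges cE del: One_nat_def)
    also have "\<dots> = 1" by (simp add: algebra_simps)
    finally show ?thesis by simp
  qed
  also have "\<dots> = (\<Sum>F\<in>Pow ?E. weight p' ?E F * (q powr ?M * (1 + (real (card F) + real (?k F) - ?M) * ln q)))"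
    by (simp add: sum_distrib_left mult_ac)
  also have "\<dots> \<le> (\<Sum>F\<in>Pow ?E. weight p' ?E F * q powr (real (card F) + real (?k F)))"
    by (intro sum_mono mult_left_mono tangent wnn)
  finally have "\<sigma> ^ (N choose 2) * q powr ?M
      \<le> \<sigma> ^ (N choose 2) * (\<Sum>F\<in>Pow ?E. weight p' ?E F * q powr (real (card F) + real (?k F)))"
    using s by (intro mult_left_mono) auto
  also have "\<dots> = rc_Z p q N"
    unfolding rc_Z_def part_fun_def sum_distrib_left by (intro sum.cong) (use summand in auto)
  finally have "\<sigma> ^ (N choose 2) * q powr ?M \<le> rc_Z p q N" .
  moreover have "q powr ?M = q ^ N * q powr mean_excess p' N"
    using q by (simp add: mean_excess_def powr_diff powr_realpow)
  ultimately show ?thesis by (simp add: mult_ac)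
qed

text \<open>
  For \<open>q \<ge> 1\<close> it is enough that the mean number of independent cycles is nonnegative, whereas for \<open>q < 1\<close> it
  has to be bounded above, which requires the graph at \<open>p'\<close> to be subcritical.
\<close>
lemma rc_Z_ge:
  assumes p: "0 < p" "p < 1" and q: "q > 0"
  defines "\<sigma> \<equiv> 1 - p + p / q"
  assumes b: "b < 1" "q \<ge> 1 \<or> - ln (1 - p / q / \<sigma>) * real N \<le> b"
  shows "rc_Z p q N \<ge> min 1 (q powr (1 / (1 - b))) * (q ^ N * \<sigma> ^ (N choose 2))"
proof -
  let ?p' = "p / q / \<sigma>"
  have s: "\<sigma> > 0" "\<sigma> > p / q" unfolding \<sigma>_def using p q by (auto intro: add_pos_pos)
  have p': "0 < ?p'" "?p' < 1" using s p q by (auto simp: field_simps)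
  have "min 1 (q powr (1 / (1 - b))) \<le> q powr mean_excess ?p' N"
  proof (cases "q \<ge> 1")
    case True
    then have "1 \<le> q powr mean_excess ?p' N"
      using p' by (intro ge_one_powr_ge_zero mean_excess_nonneg) auto
    then show ?thesis by simp
  next
    case False
    then have "mean_excess ?p' N \<le> 1 / (1 - b)" using b p' by (intro mean_excess_le) auto
    then have "q powr (1 / (1 - b)) \<le> q powr mean_excess ?p' N"
      using False q by (intro powr_mono') auto
    then show ?thesis by simp
  qed
  then have "min 1 (q powr (1 / (1 - b))) * (q ^ N * \<sigma> ^ (N choose 2))
      \<le> q powr mean_excess ?p' N * (q ^ N * \<sigma> ^ (N choose 2))"
    using q s by (intro mult_right_mono) auto
  then show ?thesis using rc_Z_ge_jensen[OF p q, of N] by (simp add: \<sigma>_def mult_ac)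
qed

lemma rc_Z_pos:
  assumes "0 < p" "p < 1" "q > 0"
  shows "rc_Z p q N > 0"
proof -
  have "1 - p + p / q > 0" using assms by (intro add_pos_pos) auto
  then have "0 < q ^ N * (1 - p + p / q) ^ (N choose 2) * q powr mean_excess (p / q / (1 - p + p / q)) N"
    using assms by simp
  then show ?thesis using rc_Z_ge_jensen[OF assms, of N] by linarith
qed

lemma rc_Z_ge_size_term:
  assumes p: "0 \<le> p" "p \<le> 1" and q: "q > 0" and j: "1 \<le> j" "j \<le> N"
  shows "rc_Z p q N \<ge> q * size_prob p N j * rc_Z p q (N - j)"
proof -
  have "size_prob p N j * rc_Z p q (N - j) \<le> (\<Sum>j=1..N. size_prob p N j * rc_Z p q (N - j))"
    using p q j by (intro member_le_sum) (auto intro!: mult_nonneg_nonneg size_prob_nonneg rc_Z_nonneg)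
  then show ?thesis using rc_Z_rec[of N p q] j q by (simp add: mult_left_mono)
qed

section \<open>The giant component has its typical size with positive probability\<close>

lemma size_prob_le_pow:
  assumes p: "0 \<le> p" "p \<le> 1" and j: "1 \<le> j" "j \<le> M" and M: "M \<le> N"
    and c: "\<And>K. M \<le> K \<Longrightarrow> K < N \<Longrightarrow> real K / (real K + 1 - real j) * (1 - p) ^ j \<le> c"
  shows "size_prob p N j \<le> c ^ (N - M) * size_prob p M j"
  using M c
proof (induction N rule: dec_induct)
  case base show ?case by simp
next
  case (step N)
  have nn: "size_prob p N j \<ge> 0" using p by (rule size_prob_nonneg)
  have c0: "c \<ge> 0"
  proof -
    have "0 \<le> real N / (real N + 1 - real j) * (1 - p) ^ j" using p j step by auto
    then show ?thesis using step.prems[of N] step.hyps by linarith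
  qed
  have "size_prob p (Suc N) j = size_prob p N j * (real N / (real N + 1 - real j) * (1 - p) ^ j)"
    using j step by (intro size_prob_Suc_eq) auto
  also have "\<dots> \<le> size_prob p N j * c" using nn step by (intro mult_left_mono) auto
  also have "\<dots> \<le> (c ^ (N - M) * size_prob p M j) * c" using step c0 by (intro mult_right_mono) auto
  also have "\<dots> = c ^ (Suc N - M) * size_prob p M j" using step by (simp add: Suc_diff_le mult_ac)
  finally show ?case .
qed

lemma size_prob_ge_pow:
  assumes p: "0 \<le> p" "p \<le> 1" and j: "1 \<le> j" "j \<le> N" and M: "N \<le> M" and c0: "c \<ge> 0"
    and c: "\<And>K. N \<le> K \<Longrightarrow> K < M \<Longrightarrow> c \<le> real K / (real K + 1 - real j) * (1 - p) ^ j"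
  shows "c ^ (M - N) * size_prob p N j \<le> size_prob p M j"
  using M c
proof (induction M rule: dec_induct)
  case base show ?case by simp
next
  case (step M)
  have nn: "size_prob p M j \<ge> 0" using p by (rule size_prob_nonneg)
  have "c ^ (Suc M - N) * size_prob p N j = (c ^ (M - N) * size_prob p N j) * c"
    using step by (simp add: Suc_diff_le mult_ac)
  also have "\<dots> \<le> size_prob p M j * c" using step c0 by (intro mult_right_mono) auto
  also have "\<dots> \<le> size_prob p M j * (real M / (real M + 1 - real j) * (1 - p) ^ j)"
    using nn step by (intro mult_left_mono) auto
  also have "\<dots> = size_prob p (Suc M) j"
    using j step by (intro size_prob_Suc_eq[symmetric]) auto
  finally show ?case .
qed

lemma exp_gt_add_one_self:
  fixes x :: real
  assumes "x \<noteq> 0"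
  shows "1 + x < exp x"
proof (cases "1 + x / 2 \<ge> 0")
  case True
  have "0 < x\<^sup>2" using assms by simp
  then have "1 + x < (1 + x / 2)\<^sup>2" by (simp add: power2_eq_square field_simps)
  also have "\<dots> \<le> (exp (x / 2))\<^sup>2" using True exp_ge_add_one_self[of "x / 2"] by (intro power_mono)
  also have "\<dots> = exp x" by (simp flip: exp_double)
  finally show ?thesis .
next
  case False
  then have "1 + x < 0" by simp
  then show ?thesis using exp_gt_zero[of x] by linarith
qed

text \<open>
  Both endpoint values lie above the tangent to the exponential function at \<open>- (t * y)\<close>.
\<close>
lemma exp_convex_strict:
  fixes y t :: real
  assumes "y > 0" "0 < t" "t < 1"
  shows "exp (- (t * y)) < 1 - t + t * exp (- y)"
proof -
  let ?w = "exp (- (t * y))"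
  have "?w * (1 + t * y) < ?w * exp (t * y)"
    using exp_gt_add_one_self[of "t * y"] assms by (intro mult_strict_left_mono) auto
  then have 1: "?w * (1 + t * y) < 1" by (simp flip: exp_add)
  have "?w * (1 + - ((1 - t) * y)) < ?w * exp (- ((1 - t) * y))"
    using exp_gt_add_one_self[of "- ((1 - t) * y)"] assms by (intro mult_strict_left_mono) auto
  also have "?w * exp (- ((1 - t) * y)) = exp (- y)" by (simp flip: exp_add add: algebra_simps)
  finally have 2: "?w * (1 - (1 - t) * y) < exp (- y)" by simp
  have "?w = (1 - t) * (?w * (1 + t * y)) + t * (?w * (1 - (1 - t) * y))"
    by (simp add: algebra_simps)
  also have "\<dots> < (1 - t) * 1 + t * exp (- y)"
    using mult_strict_left_mono[OF 1, of "1 - t"] mult_strict_left_mono[OF 2, of t] assms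
    by linarith
  finally show ?thesis by simp
qed

lemma exp_convex:
  fixes y t :: real
  assumes "y \<ge> 0" "0 \<le> t" "t \<le> 1"
  shows "exp (- (t * y)) \<le> 1 - t + t * exp (- y)"
proof (cases "y = 0 \<or> t = 0 \<or> t = 1")
  case False
  then show ?thesis using exp_convex_strict[of y t] assms by simp
qed auto

lemma eventually_ge_real: "\<forall>\<^sub>F n in sequentially. real n \<ge> C"
  using filterlim_real_sequentially by (simp add: filterlim_at_top)

lemma tendsto_n_ln: "(\<lambda>n. real n * ln (1 + a / real n)) \<longlonglongrightarrow> a"
proof -
  have "(\<lambda>n. ln ((1 + a / real n) ^ n)) \<longlonglongrightarrow> ln (exp a)"
    by (intro tendsto_ln tendsto_exp_limit_sequentially) simp
  moreover have "\<forall>\<^sub>F n in sequentially. ln ((1 + a / real n) ^ n) = real n * ln (1 + a / real n)"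
    using eventually_ge_real[of "\<bar>a\<bar> + 1"]
  proof eventually_elim
    case (elim n)
    then have "1 + a / real n > 0" by (simp add: field_simps)
    then show ?case by (simp add: ln_realpow)
  qed
  ultimately show ?thesis by (simp add: tendsto_cong)
qed

text \<open>
  The number \<open>\<nu> = \<theta> / pi1 (l * \<theta>)\<close> is the relative volume in which \<open>\<theta>\<close> is the relative size of the
  giant component: the chord \<open>1 - x / \<nu>\<close> meets \<open>exp (- (l * x))\<close> exactly at \<open>x = 0\<close> and \<open>x = \<theta>\<close>.
\<close>
lemma giant_ratio:
  assumes "l > 0" "\<theta> > 0"
  shows "\<theta> < \<theta> / pi1 (l * \<theta>)" "exp (- (l * \<theta>)) = 1 - \<theta> / (\<theta> / pi1 (l * \<theta>))"
    "0 < \<theta> / pi1 (l * \<theta>)"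
proof -
  have pi: "0 < pi1 (l * \<theta>)" "pi1 (l * \<theta>) < 1" using assms by (auto simp: pi1_def)
  then have "\<theta> * pi1 (l * \<theta>) < \<theta> * 1" using assms by (intro mult_strict_left_mono) auto
  then show "\<theta> < \<theta> / pi1 (l * \<theta>)" using pi by (simp add: field_simps)
  show "exp (- (l * \<theta>)) = 1 - \<theta> / (\<theta> / pi1 (l * \<theta>))" using assms by (simp add: pi1_def)
  show "0 < \<theta> / pi1 (l * \<theta>)" using assms pi by simp
qed

text \<open>
  Let \<open>\<mu> < \<nu>\<close> be the relative volume whose giant component has relative size \<open>x1\<close>.  As long as the volume
  is at least \<open>\<mu> * n\<close> and \<open>j \<le> x1 * n\<close>, each additional vertex multiplies the probability of size \<open>j\<close> by
  at most \<open>1 - p\<close>, since \<open>exp (- (l * x))\<close> lies below the chord \<open>1 - x / \<mu>\<close> up to \<open>x1\<close>.  Passing from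
  \<open>\<mu> * n\<close> to \<open>\<nu> * n\<close> vertices thus shrinks the total probability of these sizes, which is at most 1,
  by a constant factor below 1.
\<close>
lemma giant_lower_tail:
  assumes l: "l > 0" and x1: "0 < x1" "x1 < \<theta>" and nu: "\<nu> = \<theta> / pi1 (l * \<theta>)"
  shows "\<exists>\<kappa>>0. \<forall>\<^sub>F n in sequentially.
    (\<Sum>j\<in>{j\<in>{1..nat \<lfloor>\<nu> * real n\<rfloor>}. real j \<le> x1 * real n}.
       size_prob (l / real n) (nat \<lfloor>\<nu> * real n\<rfloor>) j) \<le> exp (- \<kappa>)"
proof -
  \<comment> \<open>the relative volume with giant component of relative size \<open>x1\<close>\<close>
  define \<mu> where "\<mu> = x1 / pi1 (l * x1)"
  have mu: "exp (- (l * x1)) = 1 - x1 / \<mu>" "x1 < \<mu>"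
    using giant_ratio[of l x1] l x1 unfolding \<mu>_def by blast+
  have nu0: "\<nu> > 0" "exp (- (l * \<theta>)) = 1 - \<theta> / \<nu>"
    using giant_ratio[of l \<theta>] l x1 unfolding nu by auto
  have "exp (- (x1 / \<theta> * (l * \<theta>))) < 1 - x1 / \<theta> + x1 / \<theta> * exp (- (l * \<theta>))"
    using x1 l by (intro exp_convex_strict) auto
  also have "\<dots> = 1 - x1 / \<nu>" using x1 nu0 by (simp add: right_diff_distrib)
  finally have "exp (- (l * x1)) < 1 - x1 / \<nu>" using x1 by (simp add: mult.commute)
  then have "x1 / \<nu> < x1 / \<mu>" using mu by simp
  then have lt: "\<mu> < \<nu>" using x1 nu0 mu by (simp add: field_simps)
  define \<kappa> where "\<kappa> = l * (\<nu> - \<mu>) / 2"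
  have "\<forall>\<^sub>F n in sequentially.
    (\<Sum>j\<in>{j\<in>{1..nat \<lfloor>\<nu> * real n\<rfloor>}. real j \<le> x1 * real n}.
       size_prob (l / real n) (nat \<lfloor>\<nu> * real n\<rfloor>) j) \<le> exp (- \<kappa>)"
    using eventually_ge_real[of "l + 1"] eventually_ge_real[of "4 / (\<nu> - \<mu>)"]
  proof eventually_elim
    case (elim n)
    define N M p where "N = nat \<lfloor>\<nu> * real n\<rfloor>" and "M = nat \<lceil>\<mu> * real n\<rceil>" and "p = l / real n"
    have n0: "real n > 0" using elim l by linarith
    have p: "0 < p" "p < 1" using elim l n0 by (auto simp: p_def field_simps)
    have n4: "(\<nu> - \<mu>) * real n \<ge> 4" using elim(2) lt by (simp add: field_simps)
    have N: "real N > \<nu> * real n - 1" using nu0 n0 by (simp add: N_def)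
    have M: "real M < \<mu> * real n + 1" "real M \<ge> \<mu> * real n"
      using mu x1 n0 by (simp_all add: M_def) linarith+
    \<comment> \<open>rounding \<open>M\<close> and \<open>N\<close> costs at most 2, at most half of the gap between the two volumes\<close>
    have half: "D / 2 \<le> x" if "x > D - 2" "D \<ge> 4" for D x :: real using that by linarith
    have "real N - real M > (\<nu> - \<mu>) * real n - 2" using N M unfolding left_diff_distrib by linarith
    then have NM: "real N - real M \<ge> (\<nu> - \<mu>) * real n / 2" using n4 by (rule half)
    then have MN: "M \<le> N" using n4 by linarith
    have bound: "size_prob p N j \<le> (1 - p) ^ (N - M) * size_prob p M j"
      and jM: "j \<le> M" if j: "1 \<le> j" "real j \<le> x1 * real n" for j
    proof -
      have "x1 * real n \<le> \<mu> * real n" using mu n0 by simp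
      then show jM: "j \<le> M" using M(2) j by linarith
      show "size_prob p N j \<le> (1 - p) ^ (N - M) * size_prob p M j"
      proof (rule size_prob_le_pow)
        fix K assume K: "M \<le> K" "K < N"
        let ?i = "real (j - 1)"
        have iK: "?i < real K" using jM K j by linarith
        define t where "t = ?i / (x1 * real n)"
        have t: "0 \<le> t" "t \<le> 1" using j x1 n0 by (auto simp: t_def field_simps)
        have "(1 - p) ^ (j - 1) \<le> exp (- p) ^ (j - 1)"
          using p exp_ge_add_one_self[of "- p"] by (intro power_mono) auto
        also have "\<dots> = exp (- (t * (l * x1)))"
          using n0 x1 by (simp add: t_def p_def flip: exp_of_nat_mult)
        also have "\<dots> \<le> 1 - t + t * exp (- (l * x1))" using t l x1 by (intro exp_convex) auto
        also have "\<dots> = 1 - ?i / (\<mu> * real n)"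
          unfolding mu(1) using x1 n0 by (simp add: t_def right_diff_distrib)
        also have "\<dots> \<le> 1 - ?i / real K"
          using M(2) K mu x1 n0 iK by (intro diff_left_mono divide_left_mono mult_pos_pos) auto
        finally have le: "(1 - p) ^ (j - 1) \<le> 1 - ?i / real K" .
        have "real K / (real K + 1 - real j) = 1 / (1 - ?i / real K)"
          using iK j by (auto simp: field_simps of_nat_diff)
        moreover have "(1 - p) ^ j = (1 - p) * (1 - p) ^ (j - 1)" using j by (cases j) auto
        moreover have "1 / (1 - ?i / real K) * (1 - p) ^ (j - 1) \<le> 1"
          using le iK by (simp add: field_simps)
        ultimately show "real K / (real K + 1 - real j) * (1 - p) ^ j \<le> 1 - p"
          using mult_left_mono[of "1 / (1 - ?i / real K) * (1 - p) ^ (j - 1)" 1 "1 - p"] p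
          by (simp add: mult_ac)
      qed (use p j jM MN in auto)
    qed
    have "(\<Sum>j\<in>{j\<in>{1..N}. real j \<le> x1 * real n}. size_prob p N j)
       \<le> (\<Sum>j\<in>{j\<in>{1..N}. real j \<le> x1 * real n}. (1 - p) ^ (N - M) * size_prob p M j)"
      using bound by (intro sum_mono) auto
    also have "\<dots> \<le> (\<Sum>j=1..M. (1 - p) ^ (N - M) * size_prob p M j)"
      using jM p by (intro sum_mono2) (auto intro!: mult_nonneg_nonneg size_prob_nonneg)
    also have "\<dots> \<le> (1 - p) ^ (N - M)"
      unfolding sum_distrib_left[symmetric] using size_prob_sum[of M p] p by (cases M) auto
    also have "\<dots> \<le> exp (- p) ^ (N - M)"
      using p exp_ge_add_one_self[of "- p"] by (intro power_mono) auto
    also have "\<dots> = exp (- (p * (real N - real M)))"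
      using MN by (simp add: of_nat_diff mult.commute flip: exp_of_nat_mult)
    also have "\<dots> \<le> exp (- \<kappa>)"
    proof -
      have "\<kappa> = p * ((\<nu> - \<mu>) * real n / 2)" using n0 by (simp add: \<kappa>_def p_def)
      also have "\<dots> \<le> p * (real N - real M)" using NM p by (intro mult_left_mono) auto
      finally show ?thesis by simp
    qed
    finally show ?case by (simp add: N_def p_def)
  qed
  moreover have "\<kappa> > 0" using l lt by (simp add: \<kappa>_def)
  ultimately show ?thesis by blast
qed

text \<open>
  Beyond \<open>x2 > \<theta>\<close> the exponential function lies strictly above the chord of \<open>\<nu>\<close>, and still above that of
  a slightly larger volume \<open>\<nu> + h\<close>.  Each of the \<open>h * n\<close> additional vertices multiplies the
  probability of such a size by at least \<open>c > 1\<close>, and the result is at most 1.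
\<close>
lemma giant_upper_tail:
  assumes l: "l > 0" and x2: "0 < \<theta>" "\<theta> < x2" and nu: "\<nu> = \<theta> / pi1 (l * \<theta>)" and eps: "\<epsilon> > 0"
  shows "\<forall>\<^sub>F n in sequentially.
    (\<Sum>j\<in>{j\<in>{1..nat \<lfloor>\<nu> * real n\<rfloor>}. real j \<ge> x2 * real n + 1}.
       size_prob (l / real n) (nat \<lfloor>\<nu> * real n\<rfloor>) j) \<le> \<epsilon>"
proof -
  have nu0: "\<nu> > 0" "exp (- (l * \<theta>)) = 1 - \<theta> / \<nu>"
    using giant_ratio[of l \<theta>] l x2 unfolding nu by auto
  have "exp (- (\<theta> / x2 * (l * x2))) < 1 - \<theta> / x2 + \<theta> / x2 * exp (- (l * x2))"
    using x2 l by (intro exp_convex_strict) auto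
  then have "1 - \<theta> / \<nu> < 1 - \<theta> / x2 + \<theta> / x2 * exp (- (l * x2))"
    using nu0 x2 by (simp add: mult.commute)
  moreover have "\<theta> / \<nu> = \<theta> / x2 * (x2 / \<nu>)" using x2 by simp
  ultimately have "\<theta> / x2 * (1 - exp (- (l * x2))) < \<theta> / x2 * (x2 / \<nu>)"
    by (simp add: right_diff_distrib)
  moreover have "\<theta> / x2 > 0" using x2 by simp
  ultimately have strict: "1 - x2 / \<nu> < exp (- (l * x2))"
    by (simp only: mult_less_cancel_left_pos)
  have "((\<lambda>h. (1 + h) * (1 - x2 / (\<nu> + h))) \<longlongrightarrow> (1 + 0) * (1 - x2 / (\<nu> + 0))) (at_right 0)"
    using nu0 by (intro tendsto_intros) auto
  then have "\<forall>\<^sub>F h in at_right 0. (1 + h) * (1 - x2 / (\<nu> + h)) < exp (- (l * x2))"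
    using strict by (intro order_tendstoD) auto
  then have "\<forall>\<^sub>F h in at_right 0. (1 + h) * (1 - x2 / (\<nu> + h)) < exp (- (l * x2)) \<and> h > 0"
    by (intro eventually_conj eventually_at_right_less)
  then obtain h where h: "h > 0" "(1 + h) * (1 - x2 / (\<nu> + h)) < exp (- (l * x2))"
    using eventually_happens[of _ "at_right (0::real)"] by (auto simp: trivial_limit_at_right_real)
  \<comment> \<open>the exact exponential rate of \<open>(1 - p) ^ i\<close> per unit of \<open>i / n\<close>; it tends to \<open>l\<close>\<close>
  define ln' where "ln' = (\<lambda>n. - (real n * ln (1 + (- l) / real n)))"
  have "ln' \<longlonglongrightarrow> - (- l)" unfolding ln'_def by (intro tendsto_minus tendsto_n_ln)
  then have "(\<lambda>n. exp (- (ln' n * x2))) \<longlonglongrightarrow> exp (- (l * x2))" by (intro tendsto_intros) auto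
  then have ev1: "\<forall>\<^sub>F n in sequentially. (1 + h) * (1 - x2 / (\<nu> + h)) < exp (- (ln' n * x2))"
    using h by (intro order_tendstoD) auto
  define c where "c = 1 + h / 2"
  have "(\<lambda>n. (1 - l / real n) * (1 + h)) \<longlonglongrightarrow> (1 - 0) * (1 + h)"
    by (intro tendsto_intros lim_const_over_n)
  then have ev2: "\<forall>\<^sub>F n in sequentially. c < (1 - l / real n) * (1 + h)"
    using h by (intro order_tendstoD) (auto simp: c_def)
  show ?thesis
    using ev1 ev2 eventually_ge_real[of "l + 1"] eventually_ge_real[of "(2 / (\<epsilon> * h) + 1) / h"]
  proof eventually_elim
    case (elim n)
    define N M p where "N = nat \<lfloor>\<nu> * real n\<rfloor>" and "M = nat \<lfloor>(\<nu> + h) * real n\<rfloor>" and "p = l / real n"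
    have n0: "real n > 0" using elim l by linarith
    have p: "0 < p" "p < 1" using elim l n0 by (auto simp: p_def field_simps)
    have N: "real N \<le> \<nu> * real n" using nu0 n0 by (simp add: N_def)
    have M: "real M \<le> (\<nu> + h) * real n" "real M > (\<nu> + h) * real n - 1"
      using nu0 h n0 by (simp_all add: M_def)
    have NM: "real M - real N \<ge> h * real n - 1" using N M by (simp add: algebra_simps)
    have "h * real n \<ge> 2 / (\<epsilon> * h) + 1" using elim(4) h by (simp add: field_simps)
    then have NM2: "real M - real N \<ge> 2 / (\<epsilon> * h)" using NM by linarith
    moreover have "2 / (\<epsilon> * h) > 0" using eps h by simp
    ultimately have MN: "N \<le> M" by linarith
    have c0: "c > 0" using h by (simp add: c_def)
    have spow: "(1 - p) ^ i = exp (- (ln' n * (real i / real n)))" for i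
    proof -
      have "(1 - p) ^ i = exp (real i * ln (1 - p))" using p by (simp add: exp_of_nat_mult)
      then show ?thesis using n0 by (simp add: ln'_def p_def)
    qed
    have ln'0: "ln' n \<ge> 0"
    proof -
      have "ln (1 - p) \<le> 0" using p by simp
      then show ?thesis using n0 by (simp add: ln'_def p_def mult_nonneg_nonpos)
    qed
    have bound: "c ^ (M - N) * size_prob p N j \<le> size_prob p M j"
      if j: "1 \<le> j" "j \<le> N" "real j \<ge> x2 * real n + 1" for j
    proof (rule size_prob_ge_pow)
      fix K assume K: "N \<le> K" "K < M"
      let ?i = "real (j - 1)"
      have iK: "?i < real K" using K j by linarith
      define x where "x = ?i / real n"
      have xx2: "x2 \<le> x" using j n0 by (simp add: x_def field_simps of_nat_diff)
      define t where "t = x2 / x"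
      have x0: "x > 0" using xx2 x2 by linarith
      have t: "0 < t" "t \<le> 1" "t * x = x2" using xx2 x2 x0 by (auto simp: t_def)
      have "exp (- (t * (ln' n * x))) \<le> 1 - t + t * exp (- (ln' n * x))"
        using t x0 ln'0 by (intro exp_convex) auto
      also have "t * (ln' n * x) = ln' n * x2" using t by (simp add: mult_ac)
      finally have "(1 + h) * (1 - x2 / (\<nu> + h)) \<le> 1 - t + t * exp (- (ln' n * x))"
        using elim(1) by linarith
      moreover have "(1 + h) * (1 - x2 / (\<nu> + h)) = (1 + h) * (1 - t) + t * ((1 + h) * (1 - x / (\<nu> + h)))"
        unfolding t(3)[symmetric] by (simp add: algebra_simps)
      moreover have "1 - t \<le> (1 + h) * (1 - t)" using t h mult_right_mono[of 1 "1 + h" "1 - t"] by simp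
      moreover have "C \<le> E" if "A \<le> 1 - t + E" "A = B + C" "1 - t \<le> B" for A B C E :: real
        using that by simp
      ultimately have "t * ((1 + h) * (1 - x / (\<nu> + h))) \<le> t * exp (- (ln' n * x))" by blast
      then have key: "(1 + h) * (1 - x / (\<nu> + h)) \<le> (1 - p) ^ (j - 1)"
        using t by (simp add: spow x_def)
      have "real K \<le> (\<nu> + h) * real n" using M K by linarith
      then have "x / (\<nu> + h) \<le> ?i / real K"
        using n0 iK h nu0 by (auto simp: x_def mult.commute intro!: divide_left_mono mult_pos_pos)
      then have "(1 + h) * (1 - ?i / real K) \<le> (1 + h) * (1 - x / (\<nu> + h))"
        using h by (intro mult_left_mono) auto
      then have "(1 + h) * (1 - ?i / real K) \<le> (1 - p) ^ (j - 1)" using key by linarith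
      moreover have pos: "1 - ?i / real K > 0" using iK by (simp add: field_simps)
      ultimately have r: "1 + h \<le> 1 / (1 - ?i / real K) * (1 - p) ^ (j - 1)"
        by (simp add: pos_le_divide_eq)
      have e1: "real K / (real K + 1 - real j) = 1 / (1 - ?i / real K)"
        using iK j by (auto simp: field_simps of_nat_diff)
      have e2: "(1 - p) ^ j = (1 - p) * (1 - p) ^ (j - 1)" using j by (cases j) auto
      have "c \<le> (1 - p) * (1 + h)" using elim(2) by (simp add: p_def)
      also have "\<dots> \<le> (1 - p) * (1 / (1 - ?i / real K) * (1 - p) ^ (j - 1))"
        using r p by (intro mult_left_mono) auto
      finally show "c \<le> real K / (real K + 1 - real j) * (1 - p) ^ j"
        unfolding e1 e2 by (simp add: mult_ac)
    qed (use p j MN c0 in auto)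
    let ?T = "{j\<in>{1..N}. real j \<ge> x2 * real n + 1}"
    have "c ^ (M - N) * (\<Sum>j\<in>?T. size_prob p N j) \<le> (\<Sum>j\<in>?T. size_prob p M j)"
      unfolding sum_distrib_left using bound by (intro sum_mono) auto
    also have "\<dots> \<le> (\<Sum>j=1..M. size_prob p M j)"
      using MN p by (intro sum_mono2) (auto intro!: size_prob_nonneg)
    also have "\<dots> \<le> 1" using size_prob_sum[of M p] by (cases M) auto
    finally have le1: "c ^ (M - N) * (\<Sum>j\<in>?T. size_prob p N j) \<le> 1" .
    have "1 / \<epsilon> = 2 / (\<epsilon> * h) * (h / 2)" using h by simp
    also have "\<dots> \<le> (real M - real N) * (h / 2)" using NM2 h by (intro mult_right_mono) auto
    also have "\<dots> \<le> 1 + real (M - N) * (h / 2)" using MN by (simp add: of_nat_diff)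
    also have "\<dots> \<le> c ^ (M - N)"
      unfolding c_def using Bernoulli_inequality[of "h / 2" "M - N"] h by simp
    finally have "1 / \<epsilon> \<le> c ^ (M - N)" .
    moreover have "(\<Sum>j\<in>?T. size_prob p N j) \<ge> 0" using p by (intro sum_nonneg size_prob_nonneg) auto
    ultimately have "1 / \<epsilon> * (\<Sum>j\<in>?T. size_prob p N j) \<le> 1"
      using le1 mult_right_mono order_trans by blast
    then show ?case using eps by (simp add: N_def p_def field_simps)
  qed
qed

text \<open>
  The sizes near \<open>\<theta> * n\<close> carry probability at least \<open>2 * c\<close> minus the upper tail, where \<open>c\<close> comes from the
  lower tail, and there are at most \<open>\<nu> * n\<close> of them.
\<close>
lemma exists_giant_size:
  assumes l: "l > 0" and \<theta>: "\<theta> > 0" and nu: "\<nu> = \<theta> / pi1 (l * \<theta>)" and \<delta>: "\<delta> > 0"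
  shows "\<exists>c>0. \<forall>\<^sub>F n in sequentially. \<exists>j\<in>{1..nat \<lfloor>\<nu> * real n\<rfloor>}.
     \<bar>real j / real n - \<theta>\<bar> \<le> \<delta> \<and> c \<le> size_prob (l / real n) (nat \<lfloor>\<nu> * real n\<rfloor>) j * (\<nu> * real n)"
proof -
  define x1 where "x1 = max (\<theta> - \<delta>) (\<theta> / 2)"
  define x2 where "x2 = \<theta> + \<delta> / 2"
  have x: "0 < x1" "x1 < \<theta>" "\<theta> < x2" "\<theta> - \<delta> \<le> x1" using \<theta> \<delta> by (auto simp: x1_def x2_def)
  obtain \<kappa> where k: "\<kappa> > 0" and ev1: "\<forall>\<^sub>F n in sequentially.
    (\<Sum>j\<in>{j\<in>{1..nat \<lfloor>\<nu> * real n\<rfloor>}. real j \<le> x1 * real n}.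
       size_prob (l / real n) (nat \<lfloor>\<nu> * real n\<rfloor>) j) \<le> exp (- \<kappa>)"
    using giant_lower_tail[OF l x(1,2) nu] by blast
  define c where "c = (1 - exp (- \<kappa>)) / 2"
  have c: "c > 0" using k by (simp add: c_def)
  have ev2: "\<forall>\<^sub>F n in sequentially.
    (\<Sum>j\<in>{j\<in>{1..nat \<lfloor>\<nu> * real n\<rfloor>}. real j \<ge> x2 * real n + 1}.
       size_prob (l / real n) (nat \<lfloor>\<nu> * real n\<rfloor>) j) \<le> c"
    by (rule giant_upper_tail[OF l \<theta> x(3) nu c])
  have nu0: "\<nu> > 0" using giant_ratio[of l \<theta>] l \<theta> unfolding nu by auto
  have "\<forall>\<^sub>F n in sequentially. \<exists>j\<in>{1..nat \<lfloor>\<nu> * real n\<rfloor>}.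
     \<bar>real j / real n - \<theta>\<bar> \<le> \<delta> \<and> c \<le> size_prob (l / real n) (nat \<lfloor>\<nu> * real n\<rfloor>) j * (\<nu> * real n)"
    using ev1 ev2 eventually_ge_real[of "l + 1"] eventually_ge_real[of "2 / \<delta>"]
      eventually_ge_real[of "1 / \<nu>"]
  proof eventually_elim
    case (elim n)
    define N p where "N = nat \<lfloor>\<nu> * real n\<rfloor>" and "p = l / real n"
    let ?W = "{j\<in>{1..N}. x1 * real n < real j \<and> real j < x2 * real n + 1}"
    have n0: "real n > 0" using elim l by linarith
    have "\<nu> * real n \<ge> 1" using elim(5) nu0 by (simp add: field_simps)
    then have N: "N \<ge> 1" "real N \<le> \<nu> * real n" by (auto simp: N_def le_nat_iff le_floor_iff)
    have p: "0 \<le> p" "p \<le> 1" using elim l n0 by (auto simp: p_def field_simps)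
    have nn: "size_prob p N j \<ge> 0" for j using p by (rule size_prob_nonneg)
    have "1 = (\<Sum>j=1..N. size_prob p N j)" using size_prob_sum[OF N(1), of p] by simp
    also have "\<dots> \<le> (\<Sum>j\<in>{j\<in>{1..N}. real j \<le> x1 * real n} \<union> {j\<in>{1..N}. real j \<ge> x2 * real n + 1} \<union> ?W.
        size_prob p N j)"
      using nn by (intro sum_mono2) auto
    also have "\<dots> \<le> (\<Sum>j\<in>{j\<in>{1..N}. real j \<le> x1 * real n}. size_prob p N j)
      + (\<Sum>j\<in>{j\<in>{1..N}. real j \<ge> x2 * real n + 1}. size_prob p N j) + (\<Sum>j\<in>?W. size_prob p N j)"
    proof -
      have un: "sum (size_prob p N) (A \<union> B) \<le> sum (size_prob p N) A + sum (size_prob p N) B"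
        if "finite A" "finite B" for A B
        using sum_Un[OF that, of "size_prob p N"] sum_nonneg[of "A \<inter> B" "size_prob p N"] nn by simp
      show ?thesis by (intro order_trans[OF un] add_right_mono un) auto
    qed
    finally have sumW: "c \<le> (\<Sum>j\<in>?W. size_prob p N j)"
      using elim(1,2) by (simp add: N_def p_def c_def field_simps)
    have "\<exists>j\<in>?W. c / (\<nu> * real n) \<le> size_prob p N j"
    proof (rule ccontr)
      assume neg: "\<not> ?thesis"
      have "?W \<noteq> {}"
      proof
        assume "?W = {}"
        then have "(\<Sum>j\<in>?W. size_prob p N j) = 0" by (simp only: sum.empty)
        then show False using sumW c by linarith
      qed
      have "(\<Sum>j\<in>?W. size_prob p N j) < (\<Sum>j\<in>?W. c / (\<nu> * real n))"
        using neg \<open>?W \<noteq> {}\<close> by (intro sum_strict_mono) auto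
      also have "\<dots> = real (card ?W) * (c / (\<nu> * real n))" by simp
      also have "card ?W \<le> card {1..N}" by (rule card_mono) auto
      then have "real (card ?W) * (c / (\<nu> * real n)) \<le> real N * (c / (\<nu> * real n))"
        using c nu0 n0 by (intro mult_right_mono) auto
      also have "\<dots> \<le> \<nu> * real n * (c / (\<nu> * real n))"
        using N c nu0 n0 by (intro mult_right_mono) auto
      also have "\<dots> = c" using nu0 n0 by simp
      finally show False using sumW by simp
    qed
    then obtain j where j: "j \<in> ?W" "c / (\<nu> * real n) \<le> size_prob p N j" by blast
    have d: "\<delta> * real n \<ge> 2" using elim(4) \<delta> by (simp add: field_simps)
    have "real j \<le> (\<theta> + \<delta>) * real n"
    proof -
      have "real j < (\<theta> + \<delta> / 2) * real n + 1" using j by (simp add: x2_def)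
      then show ?thesis using d by (simp add: algebra_simps)
    qed
    moreover have "(\<theta> - \<delta>) * real n \<le> real j"
      using j x(4) mult_right_mono[of "\<theta> - \<delta>" x1 "real n"] by simp
    ultimately have "\<bar>real j / real n - \<theta>\<bar> \<le> \<delta>" using n0 by (auto simp: abs_le_iff field_simps)
    moreover have "c \<le> size_prob p N j * (\<nu> * real n)" using j(2) nu0 n0 by (simp add: field_simps)
    ultimately show ?case using j(1) by (auto simp: N_def p_def)
  qed
  then show ?thesis using c by blast
qed

section \<open>Factorials, binomial coefficients and the rate function\<close>

definition xlnx :: "real \<Rightarrow> real" where
  "xlnx x = x * ln x"

lemma xlnx_0 [simp]: "xlnx 0 = 0"
  by (simp add: xlnx_def)

lemma isCont_xlnx: "x > 0 \<Longrightarrow> isCont xlnx x"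
  unfolding xlnx_def by (intro continuous_intros) auto

lemma tendsto_xlnx [tendsto_intros]: "(f \<longlongrightarrow> x) F \<Longrightarrow> x > 0 \<Longrightarrow> ((\<lambda>t. xlnx (f t)) \<longlongrightarrow> xlnx x) F"
  using isCont_xlnx isCont_tendsto_compose by blast

lemma xlnx_scale: "x \<ge> 0 \<Longrightarrow> c > 0 \<Longrightarrow> xlnx (x * c) = c * xlnx x + x * c * ln c"
  by (cases "x = 0") (auto simp: xlnx_def ln_mult algebra_simps)

text \<open>
  Apply \<open>ln y \<le> y - 1\<close> at \<open>y = 1 / sqrt x\<close>.
\<close>
lemma xlnx_bound:
  assumes "0 \<le> x" "x \<le> 1"
  shows "\<bar>xlnx x\<bar> \<le> 2 * sqrt x"
proof (cases "x = 0")
  case False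
  then have x: "x > 0" using assms by simp
  have "ln (1 / sqrt x) \<le> 1 / sqrt x - 1" using x by (intro ln_le_minus_one) simp
  then have "- ln x \<le> 2 / sqrt x" using x by (simp add: ln_div ln_sqrt)
  then have "x * (- ln x) \<le> x * (2 / sqrt x)" using x by (intro mult_left_mono) auto
  also have "\<dots> = 2 * sqrt x" using x by (simp add: field_simps)
  finally have "- xlnx x \<le> 2 * sqrt x" by (simp add: xlnx_def)
  moreover have "xlnx x \<le> 0" using x assms by (simp add: xlnx_def mult_nonneg_nonpos)
  ultimately show ?thesis by simp
qed simp

lemma continuous_on_xlnx: "continuous_on {0..} xlnx"
proof -
  have "continuous (at x within {0..}) xlnx" if "x \<in> {0..}" for x
  proof (cases "x = 0")
    case True
    have "((\<lambda>x. 2 * sqrt x) \<longlongrightarrow> 2 * sqrt 0) (at 0 within {0..})" by (intro tendsto_intros)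
    then have "((\<lambda>x. 2 * sqrt x) \<longlongrightarrow> 0) (at 0 within {0..})" by simp
    moreover have "\<forall>\<^sub>F x in at 0 within {0..}. norm (xlnx x) \<le> 2 * sqrt x"
      unfolding eventually_at using xlnx_bound by (intro exI[of _ 1]) auto
    ultimately have "(xlnx \<longlongrightarrow> 0) (at 0 within {0..})" by (rule Lim_null_comparison[rotated])
    then show ?thesis using True by (simp add: continuous_within)
  next
    case False
    then have "x > 0" using that by simp
    then show ?thesis by (rule continuous_at_imp_continuous_within[OF isCont_xlnx])
  qed
  then show "continuous_on {0..} xlnx" by (simp add: continuous_on_eq_continuous_within)
qed

lemma ln_one_plus_inverse:
  assumes "m \<ge> 1"
  shows "ln (real m + 1) - ln (real m) \<le> 1 / real m" "1 / (real m + 1) \<le> ln (real m + 1) - ln (real m)"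
proof -
  have m: "real m > 0" using assms by simp
  have "ln ((real m + 1) / real m) \<le> (real m + 1) / real m - 1" using m by (intro ln_le_minus_one) auto
  also have "\<dots> = 1 / real m" using m by (simp add: field_simps)
  finally show "ln (real m + 1) - ln (real m) \<le> 1 / real m" using m by (simp add: ln_div)
  have "ln (real m / (real m + 1)) \<le> real m / (real m + 1) - 1" using m by (intro ln_le_minus_one) auto
  also have "\<dots> = - 1 / (real m + 1)" using m by (simp add: field_simps)
  finally show "1 / (real m + 1) \<le> ln (real m + 1) - ln (real m)" using m by (simp add: ln_div)
qed

lemma ln_fact_bounds:
  "xlnx (real m) - real m \<le> ln (fact m)" "ln (fact m) \<le> xlnx (real m) - real m + 1 + ln (real m)"
proof (induction m)
  case (Suc m)
  have f: "ln (fact (Suc m)) = ln (real m + 1) + ln (fact m :: real)"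
    by (simp add: ln_mult add.commute)
  {
    case 1
    show ?case
    proof (cases "m = 0")
      case False
      have "real m * (ln (real m + 1) - ln (real m)) \<le> real m * (1 / real m)"
        using ln_one_plus_inverse[of m] False by (intro mult_left_mono) auto
      also have "\<dots> = 1" using False by simp
      finally show ?thesis using Suc(1) unfolding f by (simp add: xlnx_def algebra_simps)
    qed (simp add: xlnx_def)
  next
    case 2
    show ?case
    proof (cases "m = 0")
      case False
      have "1 = (real m + 1) * (1 / (real m + 1))" by simp
      also have "\<dots> \<le> (real m + 1) * (ln (real m + 1) - ln (real m))"
        using ln_one_plus_inverse[of m] False by (intro mult_left_mono) auto
      finally show ?thesis using Suc(2) unfolding f by (simp add: xlnx_def algebra_simps)
    qed (simp add: xlnx_def)
  }
qed (simp_all add: xlnx_def)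

lemma ln_nat_mono: "k \<le> n \<Longrightarrow> ln (real k) \<le> ln (real n)"
  by (cases "k = 0"; cases "n = 0") auto

lemma ln_binomial_bounds:
  assumes k: "k \<le> n"
  shows "ln (real (n choose k)) \<le> xlnx (real n) - xlnx (real k) - xlnx (real n - real k) + 1 + ln (real n)"
    "xlnx (real n) - xlnx (real k) - xlnx (real n - real k) - 2 - 2 * ln (real n) \<le> ln (real (n choose k))"
proof -
  have "real (n choose k) = fact n / (fact k * fact (n - k))" using k by (rule binomial_fact)
  then have e: "ln (real (n choose k)) = ln (fact n) - ln (fact k) - ln (fact (n - k))"
    by (simp add: ln_div ln_mult)
  have r: "real (n - k) = real n - real k" using k by simp
  show "ln (real (n choose k)) \<le> xlnx (real n) - xlnx (real k) - xlnx (real n - real k) + 1 + ln (real n)"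
    unfolding e using ln_fact_bounds(2)[of n] ln_fact_bounds(1)[of k] ln_fact_bounds(1)[of "n - k"] r
    by simp
  show "xlnx (real n) - xlnx (real k) - xlnx (real n - real k) - 2 - 2 * ln (real n) \<le> ln (real (n choose k))"
    unfolding e using ln_fact_bounds(1)[of n] ln_fact_bounds(2)[of k] ln_fact_bounds(2)[of "n - k"] r
      ln_nat_mono[OF k] ln_nat_mono[of "n - k" n] by simp
qed

lemma ln_pred_binomial:
  assumes "1 \<le> j" "j \<le> n"
  shows "ln (real ((n - 1) choose (j - 1))) = ln (real (n choose j)) + ln (real j) - ln (real n)"
proof -
  have "j * (n choose j) = n * ((n - 1) choose (j - 1))"
    using assms by (intro times_binomial_minus1_eq) auto
  then have "real j * real (n choose j) = real n * real ((n - 1) choose (j - 1))"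
    by (metis of_nat_mult)
  then have "ln (real j * real (n choose j)) = ln (real n * real ((n - 1) choose (j - 1)))"
    by (rule arg_cong)
  moreover have "real j > 0" "real n > 0" "real (n choose j) > 0" "real ((n - 1) choose (j - 1)) > 0"
    using assms by auto
  ultimately show ?thesis by (simp only: ln_mult_pos)
qed

text \<open>
  \<open>Phi\<close> without its \<open>Psi\<close> term, the cost of suppressing large components in the rest.
\<close>
definition Phi_forest :: "real \<Rightarrow> real \<Rightarrow> real \<Rightarrow> real" where
  "Phi_forest \<theta> l q = - xlnx (1 - \<theta>) + (\<theta> * ln (pi1 (l * \<theta>)) - xlnx \<theta>) - l * \<theta> * (1 - \<theta>)
     + (1 - \<theta>) * (- ((q - 1) / (2 * q)) * l * (1 - \<theta>) + ln q)"

lemma Phi_eq_Phi_forest: "Phi \<theta> l q = Phi_forest \<theta> l q + (1 - \<theta>) * Psi (l * (1 - \<theta>) / q)"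
  by (simp add: Phi_def Phi_forest_def entropy_S_def xlnx_def pi1_def algebra_simps)

text \<open>
  Since \<open>sinh (ln x) = (x - 1 / x) / 2\<close>, this inequality decides which argument of the minimum in \<open>Psi\<close> is
  taken.
\<close>
lemma sinh_ge_self:
  fixes y :: real
  assumes "y \<ge> 0"
  shows "y \<le> sinh y"
proof -
  have "(\<lambda>y. sinh y - y) 0 \<le> (\<lambda>y. sinh y - y) y"
    using assms
    by (rule DERIV_nonneg_imp_nondecreasing)
       (auto intro!: exI derivative_eq_intros simp: cosh_real_ge_1)
  then show ?thesis by simp
qed

lemma sinh_le_mult_cosh:
  fixes y :: real
  assumes "y \<ge> 0"
  shows "sinh y \<le> y * cosh y"
proof -
  have "(\<lambda>y. y * cosh y - sinh y) 0 \<le> (\<lambda>y. y * cosh y - sinh y) y"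
    using assms
    by (rule DERIV_nonneg_imp_nondecreasing)
       (auto intro!: exI derivative_eq_intros)
  then show ?thesis by simp
qed

lemma sinh_over_mono:
  fixes a b :: real
  assumes "0 < a" "a \<le> b"
  shows "sinh a / a \<le> sinh b / b"
proof -
  have "(\<lambda>y. sinh y / y) a \<le> (\<lambda>y. sinh y / y) b"
    using assms(2)
  proof (rule DERIV_nonneg_imp_nondecreasing)
    fix x assume x: "a \<le> x" "x \<le> b"
    have "((\<lambda>y. sinh y / y) has_real_derivative (cosh x * x - sinh x * 1) / (x * x)) (at x)"
      using x assms by (intro DERIV_divide) (auto intro!: derivative_eq_intros)
    moreover have "0 \<le> (cosh x * x - sinh x * 1) / (x * x)"
      using sinh_le_mult_cosh[of x] x assms by (simp add: mult.commute)
    ultimately show "\<exists>d. ((\<lambda>y. sinh y / y) has_real_derivative d) (at x) \<and> 0 \<le> d" by blast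
  qed
  then show ?thesis .
qed

lemma Psi_le_1: "0 \<le> x \<Longrightarrow> x \<le> 1 \<Longrightarrow> Psi x = 0"
proof -
  assume x: "0 \<le> x" "x \<le> 1"
  show ?thesis
  proof (cases "x = 0")
    case False
    then have x0: "x > 0" using x by simp
    then have "- ln x \<le> sinh (- ln x)" using x by (intro sinh_ge_self) auto
    then have "sinh (ln x) \<le> ln x" by simp
    then show ?thesis using x0 by (simp add: Psi_def sinh_ln_real inverse_eq_divide)
  qed (simp add: Psi_def)
qed

lemma Psi_ge_1: "1 \<le> x \<Longrightarrow> Psi x = ln x - (x - 1 / x) / 2"
proof -
  assume x: "1 \<le> x"
  have "ln x \<le> sinh (ln x)" using x by (intro sinh_ge_self) auto
  then show ?thesis using x by (simp add: Psi_def sinh_ln_real inverse_eq_divide)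
qed

lemma ln_pi1_sinh:
  assumes "x > 0"
  shows "ln (pi1 x) = ln x - x / 2 + ln (sinh (x / 2) / (x / 2))"
proof -
  have "exp (- x) = exp (- (x / 2)) * exp (- (x / 2))" by (simp flip: exp_add)
  moreover have "exp (- (x / 2)) * exp (x / 2) = 1" by (simp flip: exp_add)
  ultimately have "pi1 x = exp (- (x / 2)) * (2 * sinh (x / 2))"
    by (simp add: pi1_def sinh_field_def right_diff_distrib)
  also have "\<dots> = x * exp (- (x / 2)) * (sinh (x / 2) / (x / 2))" using assms by simp
  finally show ?thesis using assms by (simp add: ln_mult ln_div)
qed

text \<open>
  Where the rest is supercritical, the terms containing \<open>ln (1 - \<theta>)\<close> and \<open>ln q\<close> cancel, and writing \<open>pi1\<close> as a
  hyperbolic sine leaves a single term depending on \<open>\<theta>\<close>.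
\<close>
lemma Phi_supercritical:
  assumes l: "l > 0" and q: "q > 0" and t: "0 \<le> \<theta>" "\<theta> < 1" "q \<le> l * (1 - \<theta>)"
  shows "Phi \<theta> l q = ln l - l / 2 + q / (2 * l) + \<theta> * ln (sinh (l * \<theta> / 2) / (l * \<theta> / 2))"
proof -
  let ?x = "l * (1 - \<theta>) / q"
  have x: "?x \<ge> 1" using q t by simp
  have P: "Psi ?x = ln l + ln (1 - \<theta>) - ln q - (?x - 1 / ?x) / 2"
    using Psi_ge_1[OF x] l q t by (simp add: ln_div ln_mult)
  have P2: "(1 - \<theta>) * Psi ?x = (1 - \<theta>) * (ln l + ln (1 - \<theta>) - ln q) - l * (1 - \<theta>)\<^sup>2 / (2 * q) + q / (2 * l)"
    unfolding P using l q t by (simp add: field_simps power2_eq_square)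
  have th: "\<theta> * ln (pi1 (l * \<theta>)) - xlnx \<theta> = \<theta> * ln l - l * \<theta>\<^sup>2 / 2 + \<theta> * ln (sinh (l * \<theta> / 2) / (l * \<theta> / 2))"
  proof (cases "\<theta> = 0")
    case False
    then have "\<theta> > 0" using t by simp
    then have e: "ln (pi1 (l * \<theta>)) = ln l + ln \<theta> - l * \<theta> / 2 + ln (sinh (l * \<theta> / 2) / (l * \<theta> / 2))"
      using ln_pi1_sinh[of "l * \<theta>"] l by (simp add: ln_mult_pos)
    show ?thesis unfolding xlnx_def e by (simp add: power2_eq_square algebra_simps)
  qed simp
  have coeff: "(q - 1) / (2 * q) = 1 / 2 - 1 / (2 * q)" using q by (simp add: field_simps)
  have lin: "(1 - \<theta>) * (- ((q - 1) / (2 * q)) * l * (1 - \<theta>) + ln q)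
     = - l * (1 - \<theta>)\<^sup>2 / 2 + l * (1 - \<theta>)\<^sup>2 / (2 * q) + (1 - \<theta>) * ln q"
    unfolding coeff by (simp add: algebra_simps add_divide_distrib diff_divide_distrib power2_eq_square)
  have "- l * \<theta>\<^sup>2 / 2 - l * \<theta> * (1 - \<theta>) - l * (1 - \<theta>)\<^sup>2 / 2 = - l / 2"
    by (simp add: field_simps power2_eq_square)
  then show ?thesis
    unfolding Phi_eq_Phi_forest Phi_forest_def th P2 lin
    by (simp add: xlnx_def left_diff_distrib right_diff_distrib distrib_left)
qed

lemma Phi_mono_supercritical:
  assumes l: "l > 0" and q: "q > 0" and t: "0 \<le> a" "a \<le> b" "b < 1" "q \<le> l * (1 - b)"
  shows "Phi a l q \<le> Phi b l q"
proof -
  let ?g = "\<lambda>\<theta>. ln (sinh (l * \<theta> / 2) / (l * \<theta> / 2))"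
  have "l * (1 - b) \<le> l * (1 - a)" using l t by (intro mult_left_mono) auto
  then have qa: "q \<le> l * (1 - a)" using t by linarith
  have "a * ?g a \<le> b * ?g b"
  proof (cases "b = 0")
    case False
    then have b: "b > 0" using t by simp
    have gb: "?g b \<ge> 0" using sinh_ge_self[of "l * b / 2"] l b by simp
    show ?thesis
    proof (cases "a = 0")
      case False
      then have a: "a > 0" using t by simp
      have "sinh (l * a / 2) / (l * a / 2) \<le> sinh (l * b / 2) / (l * b / 2)"
        using a l t by (intro sinh_over_mono) auto
      then have "?g a \<le> ?g b" using a b l by (subst ln_le_cancel_iff) (auto intro!: divide_pos_pos)
      moreover have "?g a \<ge> 0" using sinh_ge_self[of "l * a / 2"] l a by simp
      ultimately show ?thesis using a t by (intro mult_mono) auto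
    qed (use b gb in simp)
  qed (use t in simp)
  then show ?thesis using Phi_supercritical[OF l q, of a] Phi_supercritical[OF l q, of b] t qa by simp
qed

lemma continuous_on_Phi_forest:
  assumes l: "l > 0"
  shows "continuous_on {0..1} (\<lambda>\<theta>. Phi_forest \<theta> l q)"
proof -
  have "continuous (at x within {0..1}) (\<lambda>\<theta>. \<theta> * ln (pi1 (l * \<theta>)) - xlnx \<theta>)" if "x \<in> {0..1}" for x
  proof (cases "x = 0")
    case True
    have low: "\<theta> * ln l - l * \<theta>\<^sup>2 \<le> \<theta> * ln (pi1 (l * \<theta>)) - xlnx \<theta>"
      and up: "\<theta> * ln (pi1 (l * \<theta>)) - xlnx \<theta> \<le> \<theta> * ln l" if "\<theta> \<ge> 0" for \<theta>
    proof -
      have "\<theta> * ln l - l * \<theta>\<^sup>2 \<le> \<theta> * ln (pi1 (l * \<theta>)) - xlnx \<theta> \<and>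
        \<theta> * ln (pi1 (l * \<theta>)) - xlnx \<theta> \<le> \<theta> * ln l"
      proof (cases "\<theta> = 0")
        case False
        then have t: "\<theta> > 0" using that by simp
        have lt: "l * \<theta> > 0" using l t by simp
        have "1 - l * \<theta> \<le> exp (- (l * \<theta>))" using exp_ge_add_one_self[of "- (l * \<theta>)"] by simp
        then have "pi1 (l * \<theta>) \<le> l * \<theta>" by (simp add: pi1_def)
        moreover have pos: "pi1 (l * \<theta>) > 0" using lt by (simp add: pi1_def)
        ultimately have "ln (pi1 (l * \<theta>)) \<le> ln (l * \<theta>)"
          using lt by (subst ln_le_cancel_iff)
        then have u: "ln (pi1 (l * \<theta>)) \<le> ln l + ln \<theta>"
          using l t by (simp only: ln_mult_pos)
        have "exp (- (l * \<theta>)) * (1 + l * \<theta>) \<le> exp (- (l * \<theta>)) * exp (l * \<theta>)"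
          by (intro mult_left_mono exp_ge_add_one_self) auto
        also have "\<dots> = 1" by (simp flip: exp_add)
        finally have "l * \<theta> * exp (- (l * \<theta>)) \<le> pi1 (l * \<theta>)" by (simp add: pi1_def algebra_simps)
        then have "ln (l * \<theta> * exp (- (l * \<theta>))) \<le> ln (pi1 (l * \<theta>))"
          using lt pos by (subst ln_le_cancel_iff) auto
        then have d: "ln l + ln \<theta> - l * \<theta> \<le> ln (pi1 (l * \<theta>))" using l t by (simp add: ln_mult)
        show ?thesis
          using mult_left_mono[OF u, of \<theta>] mult_left_mono[OF d, of \<theta>] t
          by (simp add: xlnx_def algebra_simps power2_eq_square)
      qed simp
      then show "\<theta> * ln l - l * \<theta>\<^sup>2 \<le> \<theta> * ln (pi1 (l * \<theta>)) - xlnx \<theta>"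
        "\<theta> * ln (pi1 (l * \<theta>)) - xlnx \<theta> \<le> \<theta> * ln l" by auto
    qed
    have "((\<lambda>\<theta>. \<theta> * ln (pi1 (l * \<theta>)) - xlnx \<theta>) \<longlongrightarrow> 0) (at 0 within {0..1})"
    proof (rule tendsto_sandwich[of "\<lambda>\<theta>. \<theta> * ln l - l * \<theta>\<^sup>2" _ _ "\<lambda>\<theta>. \<theta> * ln l"])
      show "\<forall>\<^sub>F \<theta> in at 0 within {0..1}. \<theta> * ln l - l * \<theta>\<^sup>2 \<le> \<theta> * ln (pi1 (l * \<theta>)) - xlnx \<theta>"
        "\<forall>\<^sub>F \<theta> in at 0 within {0..1}. \<theta> * ln (pi1 (l * \<theta>)) - xlnx \<theta> \<le> \<theta> * ln l"
        unfolding eventually_at using low up by (auto intro!: exI[of _ 1])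
      have "((\<lambda>\<theta>. \<theta> * ln l - l * \<theta>\<^sup>2) \<longlongrightarrow> 0 * ln l - l * 0\<^sup>2) (at 0 within {0..1})"
        by (intro tendsto_intros)
      then show "((\<lambda>\<theta>. \<theta> * ln l - l * \<theta>\<^sup>2) \<longlongrightarrow> 0) (at 0 within {0..1})" by simp
      have "((\<lambda>\<theta>. \<theta> * ln l) \<longlongrightarrow> 0 * ln l) (at 0 within {0..1})"
        by (intro tendsto_intros)
      then show "((\<lambda>\<theta>. \<theta> * ln l) \<longlongrightarrow> 0) (at 0 within {0..1})" by simp
    qed
    then show ?thesis using True by (simp add: continuous_within)
  next
    case False
    then have x: "x > 0" using that by simp
    then have "pi1 (l * x) > 0" using l by (simp add: pi1_def)
    then have "isCont (\<lambda>\<theta>. \<theta> * ln (pi1 (l * \<theta>)) - xlnx \<theta>) x"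
      using isCont_xlnx[OF x] unfolding pi1_def by (intro continuous_intros) auto
    then show ?thesis by (rule continuous_at_imp_continuous_within)
  qed
  then have 1: "continuous_on {0..1} (\<lambda>\<theta>. \<theta> * ln (pi1 (l * \<theta>)) - xlnx \<theta>)"
    by (simp add: continuous_on_eq_continuous_within)
  have "continuous_on {0..1} (\<lambda>\<theta>::real. 1 - \<theta>)" by (intro continuous_intros)
  then have 2: "continuous_on {0..1} (\<lambda>\<theta>. xlnx (1 - \<theta>))"
    by (rule continuous_on_compose2[OF continuous_on_xlnx]) auto
  define f g where "f = (\<lambda>\<theta>. \<theta> * ln (pi1 (l * \<theta>)) - xlnx \<theta>)" and "g = (\<lambda>\<theta>. xlnx (1 - \<theta>))"
  have fg: "continuous_on {0..1} f" "continuous_on {0..1} g" using 1 2 by (simp_all add: f_def g_def)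
  have "continuous_on {0..1} (\<lambda>\<theta>. - g \<theta> + f \<theta> - l * \<theta> * (1 - \<theta>)
     + (1 - \<theta>) * (- ((q - 1) / (2 * q)) * l * (1 - \<theta>) + ln q))"
    by (intro continuous_intros fg)
  then show ?thesis by (simp only: Phi_forest_def f_def g_def)
qed

text \<open>
  By monotonicity on the supercritical interval and continuity at the end points, only \<open>\<theta>\<close> strictly
  inside the subcritical range matter for the supremum.
\<close>
lemma Phi_sup_subcritical:
  assumes l: "l > 0" and q: "q > 0" and t: "0 \<le> t" "t \<le> 1" and eps: "\<epsilon> > 0"
  shows "\<exists>\<theta>. 0 < \<theta> \<and> \<theta> < 1 \<and> l * (1 - \<theta>) < q \<and> Phi t l q - \<epsilon> \<le> Phi_forest \<theta> l q"
proof -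
  \<comment> \<open>from \<open>\<theta>0\<close> on, the rest is not supercritical and \<open>Psi\<close> vanishes\<close>
  define \<theta>0 where "\<theta>0 = max 0 (1 - q / l)"
  have t0: "0 \<le> \<theta>0" "\<theta>0 < 1" using l q by (auto simp: \<theta>0_def)
  have sub: "Phi \<theta> l q = Phi_forest \<theta> l q" if "\<theta>0 \<le> \<theta>" "\<theta> \<le> 1" for \<theta>
  proof -
    have "1 - q / l \<le> \<theta>" using that by (simp add: \<theta>0_def)
    then have "l * (1 - \<theta>) / q \<le> 1" using l q by (simp add: field_simps)
    then have "Psi (l * (1 - \<theta>) / q) = 0" using l q that by (intro Psi_le_1) auto
    then show ?thesis by (simp add: Phi_eq_Phi_forest)
  qed
  define t1 where "t1 = max t \<theta>0"
  have t1: "\<theta>0 \<le> t1" "t1 \<le> 1" using t t0 by (auto simp: t1_def)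
  have "Phi t l q \<le> Phi t1 l q"
  proof (cases "t < \<theta>0")
    case True
    then have "\<theta>0 = 1 - q / l" using t by (auto simp: \<theta>0_def max_def split: if_splits)
    then have "q \<le> l * (1 - \<theta>0)" using l by simp
    then show ?thesis using True t t0 unfolding t1_def
      by (simp add: Phi_mono_supercritical[OF l q])
  qed (simp add: t1_def)
  then have le: "Phi t l q \<le> Phi_forest t1 l q" using sub t1 by simp
  have "continuous (at t1 within {0..1}) (\<lambda>\<theta>. Phi_forest \<theta> l q)"
    using continuous_on_Phi_forest[OF l] t1 t0 by (auto simp: continuous_on_eq_continuous_within)
  then have "((\<lambda>\<theta>. Phi_forest \<theta> l q) \<longlongrightarrow> Phi_forest t1 l q) (at t1 within {\<theta>0<..<1})"
    unfolding continuous_within by (rule tendsto_within_subset) (use t0 in auto)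
  then have ev: "\<forall>\<^sub>F \<theta> in at t1 within {\<theta>0<..<1}. Phi_forest t1 l q - \<epsilon> < Phi_forest \<theta> l q"
    using eps by (intro order_tendstoD) auto
  have "t1 islimpt {\<theta>0<..<1}"
  proof (cases "t1 = 1")
    case True
    then show ?thesis using t0 by (simp add: islimpt_greaterThanLessThan2)
  next
    case False
    then have "t1 islimpt {t1<..<1}" using t1 by (intro islimpt_greaterThanLessThan1) auto
    then show ?thesis by (rule islimpt_subset) (use t1 in auto)
  qed
  then have "at t1 within {\<theta>0<..<1} \<noteq> bot" by (simp add: trivial_limit_within)
  moreover have "\<forall>\<^sub>F \<theta> in at t1 within {\<theta>0<..<1}. \<theta> \<in> {\<theta>0<..<1}"
    by (auto simp: eventually_at intro!: exI[of _ 1])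
  ultimately obtain \<theta> where \<theta>: "\<theta> \<in> {\<theta>0<..<1}" "Phi_forest t1 l q - \<epsilon> < Phi_forest \<theta> l q"
    using eventually_happens'[OF _ eventually_conj[OF ev]] by blast
  have "1 - q / l < \<theta>" using \<theta> by (simp add: \<theta>0_def)
  then have "l * (1 - \<theta>) < q" using l by (simp add: field_simps)
  then show ?thesis using \<theta> t0 le by (intro exI[of _ \<theta>]) auto
qed

section \<open>Lower bound on the free energy\<close>

lemma ln_size_prob:
  assumes "0 < p" "p < 1" "1 \<le> j" "j \<le> N" "conn_prob p j > 0"
  shows "ln (size_prob p N j) = ln (real ((N - 1) choose (j - 1))) + ln (conn_prob p j)
    + real j * (real N - real j) * ln (1 - p)"
proof -
  have "j - 1 \<le> N - 1" using assms by simp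
  then have C: "real ((N - 1) choose (j - 1)) > 0" using zero_less_binomial by simp
  have "ln ((1 - p) ^ (j * (N - j))) = real j * (real N - real j) * ln (1 - p)"
    using assms by (simp add: ln_realpow)
  then show ?thesis using assms C unfolding size_prob_def by (simp add: ln_mult_pos)
qed

lemma choose_two_real: "real (m choose 2) = real m * (real m - 1) / 2"
proof (induction m)
  case (Suc m)
  have "Suc m choose 2 = m + (m choose 2)" by (simp add: numeral_2_eq_2)
  then show ?case using Suc by (simp add: field_simps)
qed simp

text \<open>
  The connection probability and the factorials of \<open>j\<close> cancel in the ratio of the probabilities of size \<open>j\<close>
  in the volumes \<open>n\<close> and \<open>N\<close>; the remaining factorials are estimated by Stirling's bounds.
\<close>
lemma size_prob_change_volume:
  assumes p: "0 < p" "p < 1" and j: "1 \<le> j" "j \<le> N" "j \<le> n" and P: "size_prob p N j > 0"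
    and x: "x = real j / real n" and y: "y = real N / real n"
  shows "real n * (xlnx (y - x) - xlnx y - xlnx (1 - x)) - 3 - 3 * ln (real n)
     + real n * x * (1 - y) * (real n * ln (1 - p)) + ln (size_prob p N j) \<le> ln (size_prob p n j)"
proof -
  have n0: "real n > 0" using j by simp
  have C: "conn_prob p j > 0"
  proof (rule ccontr)
    assume "\<not> ?thesis"
    then have "conn_prob p j = 0" using conn_prob_nonneg[of p j] p by simp
    then show False using P by (simp add: size_prob_def)
  qed
  have xy: "real j = x * real n" "real N = y * real n" "real n - real j = (1 - x) * real n"
    "real N - real j = (y - x) * real n" using n0 by (auto simp: x y field_simps)
  have nn: "x \<ge> 0" "y \<ge> 0" "1 - x \<ge> 0" "y - x \<ge> 0" using j n0 by (auto simp: x y field_simps)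
  have s: "xlnx (real n - real j) = real n * xlnx (1 - x) + (1 - x) * real n * ln (real n)"
    "xlnx (real N - real j) = real n * xlnx (y - x) + (y - x) * real n * ln (real n)"
    "xlnx (real N) = real n * xlnx y + y * real n * ln (real n)"
    using xlnx_scale[of _ "real n"] nn n0 xy by simp_all
  have "ln (size_prob p n j) - ln (size_prob p N j)
     = ln (real (n choose j)) - ln (real (N choose j)) - ln (real n) + ln (real N)
     + real j * (real n - real N) * ln (1 - p)"
    using ln_size_prob[OF p j(1,2) C] ln_size_prob[OF p j(1,3) C] ln_pred_binomial[OF j(1,2)]
      ln_pred_binomial[OF j(1,3)] by (simp add: algebra_simps)
  also have "\<dots> \<ge> xlnx (real n) - xlnx (real n - real j) - xlnx (real N) + xlnx (real N - real j)
     - 3 - 3 * ln (real n) + real j * (real n - real N) * ln (1 - p)"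
    using ln_binomial_bounds(2)[OF j(3)] ln_binomial_bounds(1)[OF j(2)] by simp
  also have "xlnx (real n) - xlnx (real n - real j) - xlnx (real N) + xlnx (real N - real j)
     = real n * (xlnx (y - x) - xlnx y - xlnx (1 - x))"
    unfolding s by (simp add: xlnx_def algebra_simps)
  also have "real j * (real n - real N) = real n * x * (1 - y) * real n"
    unfolding xy by (simp add: algebra_simps)
  finally show ?thesis by (simp add: mult.assoc)
qed

text \<open>
  The exponent obtained by passing from the relative volume \<open>\<nu>\<close> to the relative volume 1 is the rate function,
  because \<open>ln (\<nu> - \<theta>) = ln \<nu> - l * \<theta>\<close>.
\<close>
lemma Phi_forest_giant:
  assumes l: "l > 0" and t: "\<theta> > 0" and q: "q > 0" and nu: "\<nu> = \<theta> / pi1 (l * \<theta>)"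
  shows "xlnx (\<nu> - \<theta>) - xlnx \<nu> - xlnx (1 - \<theta>) + \<theta> * (1 - \<nu>) * (- l)
    + (1 - \<theta>) * ln q + (1 - \<theta>) * (1 - \<theta>) / 2 * (l / q - l) = Phi_forest \<theta> l q"
proof -
  have g: "exp (- (l * \<theta>)) = 1 - \<theta> / \<nu>" "\<nu> > 0" using giant_ratio[OF l t] by (auto simp: nu)
  have pi: "pi1 (l * \<theta>) > 0" using l t by (simp add: pi1_def)
  have ln\<nu>: "ln \<nu> = ln \<theta> - ln (pi1 (l * \<theta>))" unfolding nu using t pi by (simp add: ln_div)
  have "\<nu> - \<theta> = \<nu> * exp (- (l * \<theta>))" using g by (simp add: right_diff_distrib)
  then have ln\<nu>\<theta>: "ln (\<nu> - \<theta>) = ln \<nu> - l * \<theta>" using g(2) by (simp add: ln_mult_pos)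
  have "xlnx (\<nu> - \<theta>) - xlnx \<nu> = - \<theta> * ln \<nu> - l * \<theta> * (\<nu> - \<theta>)"
    unfolding xlnx_def ln\<nu>\<theta> by (simp add: algebra_simps)
  then have 1: "xlnx (\<nu> - \<theta>) - xlnx \<nu> + \<theta> * (1 - \<nu>) * (- l)
     = (\<theta> * ln (pi1 (l * \<theta>)) - xlnx \<theta>) - l * \<theta> * (1 - \<theta>)"
    unfolding ln\<nu> by (simp add: xlnx_def algebra_simps)
  have coeff: "(q - 1) / (2 * q) = 1 / 2 - 1 / (2 * q)" using q by (simp add: field_simps)
  have 2: "- ((q - 1) / (2 * q)) * l * (1 - \<theta>) = (1 - \<theta>) / 2 * (l / q - l)"
    unfolding coeff by (simp add: algebra_simps add_divide_distrib diff_divide_distrib)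
  have "(1 - \<theta>) * (- ((q - 1) / (2 * q)) * l * (1 - \<theta>) + ln q)
     = (1 - \<theta>) * ln q + (1 - \<theta>) * (1 - \<theta>) / 2 * (l / q - l)"
    unfolding 2 by (simp add: distrib_left)
  then show ?thesis unfolding Phi_forest_def using 1 by linarith
qed

text \<open>
  A diagonal argument: \<open>J n\<close> minimises the larger of the distance to \<open>\<theta>\<close> and the exponential cost, and
  \<open>exists_giant_size\<close> makes this minimum arbitrarily small.
\<close>
lemma giant_sequence:
  assumes l: "l > 0" and t: "\<theta> > 0" and nu: "\<nu> = \<theta> / pi1 (l * \<theta>)"
  defines "N \<equiv> \<lambda>n. nat \<lfloor>\<nu> * real n\<rfloor>"
  shows "\<exists>J. (\<forall>\<^sub>F n in sequentially. J n \<in> {1..N n} \<and> size_prob (l / real n) (N n) (J n) > 0) \<and>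
    (\<lambda>n. real (J n) / real n) \<longlonglongrightarrow> \<theta> \<and>
    (\<forall>\<delta>>0. \<forall>\<^sub>F n in sequentially. - \<delta> \<le> ln (size_prob (l / real n) (N n) (J n)) / real n)"
proof -
  define P where "P = (\<lambda>n j. size_prob (l / real n) (N n) j)"
  \<comment> \<open>the value 1 marks sizes of probability 0, for which the logarithm is meaningless\<close>
  define d where "d = (\<lambda>n j. if P n j > 0 then max \<bar>real j / real n - \<theta>\<bar> (- (ln (P n j) / real n)) else 1)"
  define J where "J = (\<lambda>n. arg_min_on (d n) {1..N n})"
  have nu0: "\<nu> > 0" using giant_ratio[OF l t] nu by simp
  have small: "\<forall>\<^sub>F n in sequentially. J n \<in> {1..N n} \<and> d n (J n) \<le> \<delta>" if \<delta>: "\<delta> > 0" for \<delta>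
  proof -
    obtain c where c: "c > 0" and ev: "\<forall>\<^sub>F n in sequentially. \<exists>j\<in>{1..N n}.
       \<bar>real j / real n - \<theta>\<bar> \<le> \<delta> \<and> c \<le> P n j * (\<nu> * real n)"
      using exists_giant_size[OF l t nu \<delta>] unfolding N_def P_def by blast
    have "(\<lambda>n. (ln c - ln \<nu>) / real n - ln (real n) / real n) \<longlonglongrightarrow> 0 - 0"
      by (intro tendsto_diff lim_const_over_n lim_ln_over_n)
    then have ev2: "\<forall>\<^sub>F n in sequentially. - \<delta> < (ln c - ln \<nu>) / real n - ln (real n) / real n"
      using \<delta> by (intro order_tendstoD) auto
    show ?thesis using ev ev2 eventually_ge_real[of 1]
    proof eventually_elim
      case (elim n)
      then obtain j where j: "j \<in> {1..N n}" "\<bar>real j / real n - \<theta>\<bar> \<le> \<delta>" "c \<le> P n j * (\<nu> * real n)"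
        by blast
      have n0: "real n > 0" using elim by simp
      have vn: "\<nu> * real n > 0" using nu0 n0 by simp
      have P: "c / (\<nu> * real n) \<le> P n j" using j(3) vn by (simp add: pos_divide_le_eq)
      moreover have cv: "c / (\<nu> * real n) > 0" using c vn by simp
      ultimately have P0: "P n j > 0" by linarith
      have "ln (c / (\<nu> * real n)) \<le> ln (P n j)" using P cv P0 by (subst ln_le_cancel_iff)
      then have "ln c - ln \<nu> - ln (real n) \<le> ln (P n j)"
        using c nu0 n0 by (simp add: ln_div ln_mult_pos)
      then have "(ln c - ln \<nu> - ln (real n)) / real n \<le> ln (P n j) / real n"
        using n0 by (intro divide_right_mono) auto
      then have "- (ln (P n j) / real n) \<le> \<delta>" using elim(2) by (simp add: diff_divide_distrib)
      then have "d n j \<le> \<delta>" using j(2) P0 by (simp add: d_def)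
      moreover have "d n (J n) \<le> d n j" unfolding J_def using j(1) by (intro arg_min_least) auto
      moreover have "J n \<in> {1..N n}" unfolding J_def using j(1) by (intro arg_min_if_finite) auto
      ultimately show ?case by simp
    qed
  qed
  have 1: "\<forall>\<^sub>F n in sequentially. J n \<in> {1..N n} \<and> P n (J n) > 0"
  proof -
    have "\<forall>\<^sub>F n in sequentially. J n \<in> {1..N n} \<and> d n (J n) \<le> 1 / 2" by (intro small) simp
    then show ?thesis by (rule eventually_mono) (auto simp: d_def split: if_splits)
  qed
  have 2: "(\<lambda>n. real (J n) / real n) \<longlonglongrightarrow> \<theta>"
  proof (rule tendstoI)
    fix e :: real assume "e > 0"
    then have "\<forall>\<^sub>F n in sequentially. J n \<in> {1..N n} \<and> d n (J n) \<le> min (e / 2) (1 / 2)" by (intro small) auto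
    then show "\<forall>\<^sub>F n in sequentially. dist (real (J n) / real n) \<theta> < e"
    proof (rule eventually_mono)
      fix n assume *: "J n \<in> {1..N n} \<and> d n (J n) \<le> min (e / 2) (1 / 2)"
      then have "P n (J n) > 0" by (auto simp: d_def split: if_splits)
      then have "\<bar>real (J n) / real n - \<theta>\<bar> \<le> d n (J n)" by (simp add: d_def)
      also have "\<dots> \<le> e / 2" using * by simp
      finally show "dist (real (J n) / real n) \<theta> < e" using \<open>e > 0\<close> by (simp add: dist_real_def)
    qed
  qed
  have 3: "\<forall>\<^sub>F n in sequentially. - \<delta> \<le> ln (P n (J n)) / real n" if "\<delta> > 0" for \<delta>
  proof -
    have "\<forall>\<^sub>F n in sequentially. J n \<in> {1..N n} \<and> d n (J n) \<le> min \<delta> (1 / 2)" using that by (intro small) auto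
    then show ?thesis by (rule eventually_mono) (auto simp: d_def split: if_splits)
  qed
  show ?thesis using 1 2 3 unfolding P_def by blast
qed

text \<open>
  In the recursion for the partition function only the term in which the component of the first vertex
  has \<open>J n\<close> vertices is kept.
\<close>
lemma free_energy_ge_Phi_forest:
  assumes l: "l > 0" and q: "q > 0" and t: "0 < \<theta>" "\<theta> < 1" "l * (1 - \<theta>) < q" and eta: "\<eta> > 0"
  shows "\<forall>\<^sub>F n in sequentially. Phi_forest \<theta> l q - \<eta> \<le> (1 / real n) * ln (rc_Z (l / real n) q n)"
proof -
  define \<nu> where "\<nu> = \<theta> / pi1 (l * \<theta>)"
  define N where "N = (\<lambda>n. nat \<lfloor>\<nu> * real n\<rfloor>)"
  have nu: "\<theta> < \<nu>" "\<nu> > 0" using giant_ratio[OF l t(1)] by (auto simp: \<nu>_def)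
  obtain J where J1: "\<forall>\<^sub>F n in sequentially. J n \<in> {1..N n} \<and> size_prob (l / real n) (N n) (J n) > 0"
    and J2: "(\<lambda>n. real (J n) / real n) \<longlonglongrightarrow> \<theta>"
    and J3: "\<And>\<delta>. \<delta> > 0 \<Longrightarrow> \<forall>\<^sub>F n in sequentially. - \<delta> \<le> ln (size_prob (l / real n) (N n) (J n)) / real n"
    using giant_sequence[OF l t(1) \<nu>_def] unfolding N_def by blast
  define x where "x = (\<lambda>n. real (J n) / real n)"
  define y where "y = (\<lambda>n. real (N n) / real n)"
  have x: "x \<longlonglongrightarrow> \<theta>" using J2 by (simp add: x_def)
  have y: "y \<longlonglongrightarrow> \<nu>"
  proof (rule real_tendsto_sandwich[of "\<lambda>n. \<nu> - 1 / real n" _ _ "\<lambda>n. \<nu>"])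
    show "\<forall>\<^sub>F n in sequentially. \<nu> - 1 / real n \<le> y n"
      using eventually_ge_real[of 1]
    proof eventually_elim
      case (elim n)
      then have "\<nu> * real n - 1 \<le> real (N n)" using nu by (simp add: N_def)
      then have "(\<nu> * real n - 1) / real n \<le> real (N n) / real n" by (intro divide_right_mono) auto
      then show ?case using elim by (simp add: y_def diff_divide_distrib)
    qed
    show "\<forall>\<^sub>F n in sequentially. y n \<le> \<nu>"
      using eventually_ge_real[of 1]
    proof eventually_elim
      case (elim n)
      then have "real (N n) \<le> \<nu> * real n" using nu by (simp add: N_def)
      then show ?case using elim by (simp add: y_def field_simps)
    qed
    have "(\<lambda>n. \<nu> - 1 / real n) \<longlonglongrightarrow> \<nu> - 0" by (intro tendsto_diff tendsto_const lim_const_over_n)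
    then show "(\<lambda>n. \<nu> - 1 / real n) \<longlonglongrightarrow> \<nu>" by simp
  qed auto
  define s where "s = (\<lambda>n. real n * ln (1 + (- l) / real n))"
  define \<sigma> where "\<sigma> = (\<lambda>n. real n * ln (1 + (l / q - l) / real n))"
  have s: "s \<longlonglongrightarrow> - l" unfolding s_def by (rule tendsto_n_ln)
  have \<sigma>: "\<sigma> \<longlonglongrightarrow> l / q - l" unfolding \<sigma>_def by (rule tendsto_n_ln)
  \<comment> \<open>any bound strictly between 1 and the limiting mean degree \<open>(1 - \<theta>) * l / q\<close> of the rest\<close>
  define b where "b = ((1 - \<theta>) * l / q + 1) / 2"
  have "(1 - \<theta>) * l / q < 1" using t q by (simp add: field_simps)
  moreover have "r < (r + 1) / 2 \<and> (r + 1) / 2 < 1" if "r < 1" for r :: real using that by simp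
  ultimately have b: "(1 - \<theta>) * l / q < b" "b < 1" unfolding b_def by blast+
  have "(\<lambda>n. (1 - x n) * (\<sigma> n - s n)) \<longlonglongrightarrow> (1 - \<theta>) * (l / q - l - (- l))"
    by (intro tendsto_intros x \<sigma> s)
  then have evb: "\<forall>\<^sub>F n in sequentially. (1 - x n) * (\<sigma> n - s n) < b"
    using b by (intro order_tendstoD) auto
  define c where "c = min 1 (q powr (1 / (1 - b)))"
  have c: "c > 0" using q by (simp add: c_def)
  \<comment> \<open>the lower bound per vertex, apart from the cost of a component of size \<open>J n\<close> in the volume \<open>N n\<close>\<close>
  define B where "B = (\<lambda>n. xlnx (y n - x n) - xlnx (y n) - xlnx (1 - x n) + x n * (1 - y n) * s n
    + (1 - x n) * ln q + (1 - x n) * (1 - x n - 1 / real n) / 2 * \<sigma> n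
    + (ln q + ln c - 3) / real n - 3 * (ln (real n) / real n))"
  have "B \<longlonglongrightarrow> xlnx (\<nu> - \<theta>) - xlnx \<nu> - xlnx (1 - \<theta>) + \<theta> * (1 - \<nu>) * (- l)
    + (1 - \<theta>) * ln q + (1 - \<theta>) * (1 - \<theta> - 0) / 2 * (l / q - l) + 0 - 3 * 0"
    unfolding B_def using nu t
    by (intro tendsto_intros x y s \<sigma> lim_const_over_n lim_ln_over_n) auto
  then have B: "B \<longlonglongrightarrow> Phi_forest \<theta> l q"
    using Phi_forest_giant[OF l t(1) q \<nu>_def] by simp
  have evB: "\<forall>\<^sub>F n in sequentially. Phi_forest \<theta> l q - \<eta> / 2 < B n"
    using eta by (intro order_tendstoD[OF B]) auto
  have evx: "\<forall>\<^sub>F n in sequentially. x n < 1" using t by (intro order_tendstoD[OF x]) auto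
  have eta2: "\<eta> / 2 > 0" using eta by simp
  show ?thesis
    using J1 J3[OF eta2] evb evB evx eventually_ge_real[of "l + 1"]
  proof eventually_elim
    case (elim n)
    define j p m where "j = J n" and "p = l / real n" and "m = n - J n"
    have n0: "real n > 0" using elim l by linarith
    have p: "0 < p" "p < 1" using elim l n0 by (auto simp: p_def field_simps)
    have jn: "j < n" using elim(5) n0 by (simp add: x_def j_def)
    have j: "1 \<le> j" "j \<le> N n" "j \<le> n" using elim(1) jn by (auto simp: j_def)
    have P: "size_prob p (N n) j > 0" using elim(1) by (simp add: p_def j_def)
    have lnp: "real n * ln (1 - p) = s n" by (simp add: s_def p_def)
    have se: "1 - p + p / q = 1 + (l / q - l) / real n"
      by (simp add: p_def diff_divide_distrib mult.commute)
    have lns: "real n * ln (1 - p + p / q) = \<sigma> n" unfolding se by (simp only: \<sigma>_def)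
    have sp: "1 - p + p / q > 0" using p q by (intro add_pos_pos) auto
    have m: "real m = (1 - x n) * real n" using jn n0 by (simp add: m_def x_def j_def field_simps)
    have "1 - p / q / (1 - p + p / q) = ((1 - p + p / q) - p / q) / (1 - p + p / q)"
      unfolding diff_divide_distrib[of "1 - p + p / q" "p / q" "1 - p + p / q"] using sp by simp
    then have "1 - p / q / (1 - p + p / q) = (1 - p) / (1 - p + p / q)" by simp
    then have "- ln (1 - p / q / (1 - p + p / q)) * real m = (ln (1 - p + p / q) - ln (1 - p)) * real m"
      using sp p by (simp add: ln_div)
    also have "\<dots> = (1 - x n) * (\<sigma> n - s n)" unfolding m lnp[symmetric] lns[symmetric] by (simp add: algebra_simps)
    finally have "rc_Z p q m \<ge> c * (q ^ m * (1 - p + p / q) ^ (m choose 2))"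
      unfolding c_def using elim(3) b p q by (intro rc_Z_ge) auto
    then have "ln (c * (q ^ m * (1 - p + p / q) ^ (m choose 2))) \<le> ln (rc_Z p q m)"
      using c q sp rc_Z_pos[OF p q] by (subst ln_le_cancel_iff) auto
    then have "ln c + real m * ln q + real (m choose 2) * ln (1 - p + p / q) \<le> ln (rc_Z p q m)"
      using c q sp by (simp add: ln_mult_pos ln_realpow)
    moreover have "real (m choose 2) * ln (1 - p + p / q) = real n * ((1 - x n) * (1 - x n - 1 / real n) / 2 * \<sigma> n)"
      unfolding choose_two_real m lns[symmetric] using n0 by (simp add: field_simps)
    ultimately have Zm: "ln c + real n * ((1 - x n) * ln q)
        + real n * ((1 - x n) * (1 - x n - 1 / real n) / 2 * \<sigma> n) \<le> ln (rc_Z p q m)"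
      unfolding m by (simp add: mult_ac)
    have S: "real n * (xlnx (y n - x n) - xlnx (y n) - xlnx (1 - x n)) - 3 - 3 * ln (real n)
     + real n * x n * (1 - y n) * s n + ln (size_prob p (N n) j) \<le> ln (size_prob p n j)"
      using size_prob_change_volume[OF p j P, of "x n" "y n"] unfolding lnp by (simp add: x_def y_def j_def)
    have Pn: "size_prob p n j > 0"
    proof -
      have "conn_prob p j > 0" using P conn_prob_nonneg[of p j] p by (cases "conn_prob p j = 0") (auto simp: size_prob_def)
      moreover have "j - 1 \<le> n - 1" using j by simp
      ultimately show ?thesis using p by (simp add: size_prob_def)
    qed
    have "ln (q * size_prob p n j * rc_Z p q m) \<le> ln (rc_Z p q n)"
      using rc_Z_ge_size_term[of p q j n] p q j Pn rc_Z_pos[OF p q]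
      by (subst ln_le_cancel_iff) (auto simp: m_def j_def)
    then have "ln q + ln (size_prob p n j) + ln (rc_Z p q m) \<le> ln (rc_Z p q n)"
      using q Pn rc_Z_pos[OF p q, of m] by (simp add: ln_mult_pos)
    then have "ln q + (real n * (xlnx (y n - x n) - xlnx (y n) - xlnx (1 - x n)) - 3 - 3 * ln (real n)
     + real n * x n * (1 - y n) * s n + ln (size_prob p (N n) j)) + (ln c + real n * ((1 - x n) * ln q)
        + real n * ((1 - x n) * (1 - x n - 1 / real n) / 2 * \<sigma> n)) \<le> ln (rc_Z p q n)"
      using S Zm by linarith
    also have "ln q + (real n * (xlnx (y n - x n) - xlnx (y n) - xlnx (1 - x n)) - 3 - 3 * ln (real n)
     + real n * x n * (1 - y n) * s n + ln (size_prob p (N n) j)) + (ln c + real n * ((1 - x n) * ln q)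
        + real n * ((1 - x n) * (1 - x n - 1 / real n) / 2 * \<sigma> n))
      = real n * (B n + ln (size_prob p (N n) j) / real n)"
      unfolding B_def using n0 by (simp add: distrib_left right_diff_distrib left_diff_distrib mult.assoc
          add_divide_distrib diff_divide_distrib)
    finally have "real n * (B n + ln (size_prob p (N n) j) / real n) \<le> ln (rc_Z p q n)" .
    then have "B n + ln (size_prob p (N n) j) / real n \<le> 1 / real n * ln (rc_Z p q n)"
      using n0 by (simp add: field_simps)
    moreover have "- (\<eta> / 2) \<le> ln (size_prob p (N n) j) / real n" using elim(2) by (simp add: p_def j_def)
    ultimately show ?case using elim(4) unfolding p_def by linarith
  qed
qed

lemma free_energy_ge_sup_Phi:
  assumes l: "l > 0" and q: "q > 0" and eta: "\<eta> > 0"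
  shows "\<forall>\<^sub>F n in sequentially.
    (SUP \<theta>\<in>{0..1}. Phi \<theta> l q) - \<eta> \<le> (1 / real n) * ln (rc_Z (l / real n) q n)"
proof -
  have "\<exists>\<theta>\<in>{0..1}. (SUP \<theta>\<in>{0..1}. Phi \<theta> l q) - \<eta> / 3 < Phi \<theta> l q"
    using eta by (intro less_cSUP_iff[THEN iffD1]) (auto intro: bdd_above_Phi[OF q l])
  then obtain t where t: "0 \<le> t" "t \<le> 1" "(SUP \<theta>\<in>{0..1}. Phi \<theta> l q) - \<eta> / 3 < Phi t l q" by auto
  have "\<eta> / 3 > 0" using eta by simp
  from Phi_sup_subcritical[OF l q t(1,2) this] obtain \<theta> where
    \<theta>: "0 < \<theta>" "\<theta> < 1" "l * (1 - \<theta>) < q" "Phi t l q - \<eta> / 3 \<le> Phi_forest \<theta> l q" by blast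
  from free_energy_ge_Phi_forest[OF l q \<theta>(1-3) \<open>\<eta> / 3 > 0\<close>] show ?thesis
    by (rule eventually_mono) (use t \<theta> in linarith)
qed

section \<open>Sums over set partitions and the exponential formula\<close>

text \<open>
  The sum, over all set partitions of an \<open>N\<close>-element set, of the product of the weights \<open>w\<close> of the block sizes;
  \<open>j\<close> counts the elements that share the block of a given element.
\<close>
fun partition_sum :: "(nat \<Rightarrow> real) \<Rightarrow> nat \<Rightarrow> real" where
  "partition_sum w 0 = 1"
| "partition_sum w (Suc N) = (\<Sum>j\<le>N. real (N choose j) * w (Suc j) * partition_sum w (N - j))"

lemma partition_sum_nonneg: "(\<And>j. w j \<ge> 0) \<Longrightarrow> partition_sum w N \<ge> 0"
proof (induction N rule: less_induct)
  case (less N)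
  then show ?case by (cases N) (auto intro!: sum_nonneg mult_nonneg_nonneg)
qed

definition partition_fps :: "(nat \<Rightarrow> real) \<Rightarrow> real fps" where
  "partition_fps w = Abs_fps (\<lambda>N. partition_sum w N / fact N)"

definition weight_fps :: "(nat \<Rightarrow> real) \<Rightarrow> real fps" where
  "weight_fps w = Abs_fps (\<lambda>j. w (Suc j) / fact j)"

text \<open>
  The exponential formula in differential form.  Solutions of this linear equation are determined by
  their constant term, so products of solutions correspond to sums of weights.
\<close>
lemma deriv_partition_fps: "fps_deriv (partition_fps w) = weight_fps w * partition_fps w"
proof (rule fps_ext)
  fix N
  have "fps_nth (fps_deriv (partition_fps w)) N = partition_sum w (Suc N) / fact N"
    by (simp add: partition_fps_def del: partition_sum.simps of_nat_Suc)
  also have "\<dots> = (\<Sum>j\<le>N. w (Suc j) / fact j * (partition_sum w (N - j) / fact (N - j)))"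
    unfolding partition_sum.simps sum_divide_distrib
    by (intro sum.cong) (auto simp: binomial_fact)
  also have "\<dots> = fps_nth (weight_fps w * partition_fps w) N"
    by (simp add: fps_mult_nth weight_fps_def partition_fps_def atMost_atLeast0)
  finally show "fps_nth (fps_deriv (partition_fps w)) N = fps_nth (weight_fps w * partition_fps w) N" .
qed

lemma fps_linear_ode_unique:
  fixes A B W :: "real fps"
  assumes "fps_deriv A = W * A" "fps_deriv B = W * B" "fps_nth A 0 = fps_nth B 0"
  shows "A = B"
proof (rule fps_ext)
  fix n show "fps_nth A n = fps_nth B n"
  proof (induction n rule: less_induct)
    case (less n)
    show ?case
    proof (cases n)
      case (Suc m)
      have "real (Suc m) * fps_nth A (Suc m) = fps_nth (W * A) m" using assms(1)[symmetric] by simp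
      also have "\<dots> = fps_nth (W * B) m"
        unfolding fps_mult_nth using less Suc by (intro sum.cong) auto
      also have "\<dots> = real (Suc m) * fps_nth B (Suc m)" using assms(2)[symmetric] by simp
      finally show ?thesis using Suc by simp
    qed (use assms in simp)
  qed
qed

text \<open>
  Each block carries one of two colours; \<open>k\<close> is the number of elements in blocks of the first colour.
\<close>
lemma partition_sum_add:
  "partition_sum (\<lambda>j. u j + v j) N
     = (\<Sum>k\<le>N. real (N choose k) * partition_sum u k * partition_sum v (N - k))"
proof -
  have e: "weight_fps (\<lambda>j. u j + v j) = weight_fps u + weight_fps v"
    by (rule fps_ext) (simp add: weight_fps_def add_divide_distrib)
  have conv: "partition_fps (\<lambda>j. u j + v j) = partition_fps u * partition_fps v"
  proof (rule fps_linear_ode_unique)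
    show "fps_deriv (partition_fps (\<lambda>j. u j + v j))
       = (weight_fps u + weight_fps v) * partition_fps (\<lambda>j. u j + v j)"
      by (simp only: deriv_partition_fps e)
    show "fps_deriv (partition_fps u * partition_fps v)
       = (weight_fps u + weight_fps v) * (partition_fps u * partition_fps v)"
      by (simp only: fps_deriv_mult deriv_partition_fps) (simp add: algebra_simps)
  qed (simp add: partition_fps_def)
  have "partition_sum (\<lambda>j. u j + v j) N / fact N = fps_nth (partition_fps (\<lambda>j. u j + v j)) N"
    by (simp add: partition_fps_def)
  also have "\<dots> = fps_nth (partition_fps u * partition_fps v) N" by (simp only: conv)
  also have "\<dots> = (\<Sum>k\<le>N. partition_sum u k / fact k * (partition_sum v (N - k) / fact (N - k)))"
    by (simp add: fps_mult_nth partition_fps_def atMost_atLeast0)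
  finally have "partition_sum (\<lambda>j. u j + v j) N
     = fact N * (\<Sum>k\<le>N. partition_sum u k / fact k * (partition_sum v (N - k) / fact (N - k)))"
    by (simp add: field_simps)
  also have "\<dots> = (\<Sum>k\<le>N. real (N choose k) * partition_sum u k * partition_sum v (N - k))"
    unfolding sum_distrib_left by (intro sum.cong) (auto simp: binomial_fact)
  finally show ?thesis .
qed

text \<open>
  The product of the factors \<open>a ^ j\<close> over the blocks is \<open>a ^ N\<close>.
\<close>
lemma partition_sum_le_scale:
  assumes u: "\<And>j. 0 \<le> u j" and uw: "\<And>j. u j \<le> a ^ j * w j" and a: "a \<ge> 0" and w: "\<And>j. w j \<ge> 0"
  shows "partition_sum u N \<le> a ^ N * partition_sum w N"
proof (induction N rule: less_induct)
  case (less N)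
  show ?case
  proof (cases N)
    case (Suc M)
    have "partition_sum u N
       \<le> (\<Sum>j\<le>M. real (M choose j) * (a ^ Suc j * w (Suc j)) * (a ^ (M - j) * partition_sum w (M - j)))"
      unfolding Suc partition_sum.simps
      using less Suc u w a uw by (intro sum_mono mult_mono) (auto intro!: partition_sum_nonneg mult_nonneg_nonneg simp del: power_Suc)
    also have "\<dots> = a ^ Suc M * partition_sum w (Suc M)"
      unfolding partition_sum.simps sum_distrib_left
    proof (rule sum.cong, goal_cases)
      case (2 j)
      then have "a ^ Suc M = a ^ Suc j * a ^ (M - j)" by (simp flip: power_add)
      then show ?case by (simp only: mult_ac)
    qed simp
    finally show ?thesis unfolding Suc .
  qed simp
qed

text \<open>
  A coefficient of the exponential of a power series is at most the value of that exponential.  The partial sum \<open>P\<close>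
  of the exponential generating function satisfies \<open>P' \<le> W' * P\<close>, where \<open>W\<close> is the truncated
  generating function of the weights, so \<open>P * exp (- W)\<close> decreases from its value 1 at 0.
\<close>
lemma partition_sum_chernoff:
  assumes w: "\<And>j. w j \<ge> 0" and x: "x \<ge> 0"
  shows "partition_sum w N * x ^ N / fact N \<le> exp (\<Sum>j=1..N. w j * x ^ j / fact j)"
proof -
  define f where "f = (\<lambda>i. partition_sum w i / fact i)"
  define P where "P = (\<lambda>x. \<Sum>i\<le>N. f i * x ^ i)"
  define W where "W = (\<lambda>x. \<Sum>j=1..N. w j * x ^ j / fact j)"
  define P' where "P' = (\<lambda>x. \<Sum>i<N. real (Suc i) * f (Suc i) * x ^ i)"
  define W' where "W' = (\<lambda>x. \<Sum>j<N. w (Suc j) / fact j * x ^ j)"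
  have f: "f i \<ge> 0" for i using partition_sum_nonneg[of w i] w by (simp add: f_def)
  have dP: "(P has_real_derivative P' t) (at t)" for t
  proof -
    have "(P has_real_derivative (\<Sum>i\<le>N. f i * (real i * t ^ (i - 1)))) (at t)"
      unfolding P_def by (auto intro!: derivative_eq_intros sum.cong)
    also have "(\<Sum>i\<le>N. f i * (real i * t ^ (i - 1))) = P' t"
    proof (cases N)
      case (Suc M)
      show ?thesis unfolding P'_def Suc sum.atMost_Suc_shift
        by (simp add: lessThan_Suc_atMost mult_ac)
    qed (simp add: P'_def)
    finally show ?thesis .
  qed
  have dW: "(W has_real_derivative W' t) (at t)" for t
  proof -
    have "(W has_real_derivative (\<Sum>j=1..N. w j * (real j * t ^ (j - 1)) / fact j)) (at t)"
      unfolding W_def by (auto intro!: derivative_eq_intros sum.cong)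
    also have "(\<Sum>j=1..N. w j * (real j * t ^ (j - 1)) / fact j) = W' t"
      unfolding W'_def
    proof (rule sum.reindex_bij_witness[where i = Suc and j = "\<lambda>j. j - 1"], goal_cases)
      case (5 j)
      then obtain i where "j = Suc i" by (cases j) auto
      then show ?case by (simp del: of_nat_Suc)
    qed auto
    finally show ?thesis .
  qed
  have PW: "P' t \<le> W' t * P t" if t: "t \<ge> 0" for t
  proof -
    have rec: "real (Suc i) * f (Suc i) = (\<Sum>j\<le>i. w (Suc j) / fact j * f (i - j))" for i
    proof -
      have "fps_nth (fps_deriv (partition_fps w)) i = fps_nth (weight_fps w * partition_fps w) i"
        by (simp add: deriv_partition_fps)
      then show ?thesis
        by (simp add: fps_mult_nth partition_fps_def weight_fps_def f_def atMost_atLeast0 del: partition_sum.simps)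
    qed
    have "P' t = (\<Sum>i<N. (\<Sum>j\<le>i. w (Suc j) / fact j * f (i - j)) * t ^ i)"
      by (simp only: P'_def rec)
    also have "\<dots> = (\<Sum>i<N. \<Sum>j\<le>i. (w (Suc j) / fact j * t ^ j) * (f (i - j) * t ^ (i - j)))"
      unfolding sum_distrib_right
    proof (intro sum.cong refl, goal_cases)
      case (1 i j)
      then have "t ^ i = t ^ j * t ^ (i - j)" by (simp flip: power_add)
      then show ?case by simp
    qed
    also have "\<dots> = (\<Sum>(i, j)\<in>(SIGMA i:{..<N}. {..i}). (w (Suc j) / fact j * t ^ j) * (f (i - j) * t ^ (i - j)))"
      by (rule sum.Sigma) auto
    also have "\<dots> = (\<Sum>(j, k)\<in>(\<lambda>(i, j). (j, i - j)) ` (SIGMA i:{..<N}. {..i}).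
        (w (Suc j) / fact j * t ^ j) * (f k * t ^ k))"
      by (subst sum.reindex) (auto simp: inj_on_def split_def)
    also have "\<dots> \<le> (\<Sum>(j, k)\<in>{..<N} \<times> {..N}. (w (Suc j) / fact j * t ^ j) * (f k * t ^ k))"
      using w f t by (intro sum_mono2) auto
    also have "\<dots> = W' t * P t" by (simp add: W'_def P_def sum_product sum.cartesian_product)
    finally show ?thesis .
  qed
  have "(\<lambda>t. - (P t * exp (- W t))) 0 \<le> (\<lambda>t. - (P t * exp (- W t))) x"
    using x
  proof (rule DERIV_nonneg_imp_nondecreasing)
    fix t assume t: "0 \<le> t" "t \<le> x"
    have "((\<lambda>t. - (P t * exp (- W t))) has_real_derivative - (P' t * exp (- W t) + exp (- W t) * (- W' t) * P t)) (at t)"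
      by (rule derivative_eq_intros dP dW refl | simp)+
    moreover have "0 \<le> - (P' t * exp (- W t) + exp (- W t) * (- W' t) * P t)"
    proof -
      have "- (P' t * exp (- W t) + exp (- W t) * (- W' t) * P t) = exp (- W t) * (W' t * P t - P' t)"
        by (simp add: algebra_simps)
      then show ?thesis using PW[OF t(1)] by simp
    qed
    ultimately show "\<exists>y. ((\<lambda>t. - (P t * exp (- W t))) has_real_derivative y) (at t) \<and> 0 \<le> y" by blast
  qed
  moreover have "P 0 = 1" unfolding P_def by (simp add: f_def sum.atMost_shift)
  moreover have "W 0 = 0" unfolding W_def by (intro sum.neutral) auto
  ultimately have "P x * exp (- W x) \<le> 1" by simp
  then have "P x \<le> exp (W x)" by (simp add: exp_minus field_simps)
  moreover have "f N * x ^ N \<le> P x"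
    unfolding P_def using f x by (intro member_le_sum) auto
  ultimately show ?thesis by (simp add: f_def W_def)
qed

text \<open>
  The sum of \<open>(p / (1 - p))\<close> to the number of edges over all connected graphs with \<open>j\<close> vertices.  Dividing by the
  weight of the empty graph accounts for all closed edges, in particular for those between different components.
\<close>
definition conn_coeff :: "real \<Rightarrow> nat \<Rightarrow> real" where
  "conn_coeff p j = conn_prob p j / (1 - p) ^ (j choose 2)"

lemma conn_coeff_nonneg: "0 \<le> p \<Longrightarrow> p \<le> 1 \<Longrightarrow> conn_coeff p j \<ge> 0"
  by (simp add: conn_coeff_def conn_prob_nonneg)

lemma rc_Z_partition_sum:
  assumes p: "p < 1"
  shows "rc_Z p q N = (1 - p) ^ (N choose 2) * partition_sum (\<lambda>j. q * conn_coeff p j) N"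
proof (induction N rule: less_induct)
  case (less N)
  show ?case
  proof (cases N)
    case (Suc M)
    have "rc_Z p q (Suc M) = q * (\<Sum>j=1..Suc M. size_prob p (Suc M) j * rc_Z p q (Suc M - j))"
      by (rule rc_Z_rec) simp
    also have "(\<Sum>j=1..Suc M. size_prob p (Suc M) j * rc_Z p q (Suc M - j))
      = (\<Sum>j\<le>M. size_prob p (Suc M) (Suc j) * rc_Z p q (M - j))"
      by (rule sum.reindex_bij_witness[where i = Suc and j = "\<lambda>j. j - 1"]) auto
    also have "q * \<dots> = (\<Sum>j\<le>M. (1 - p) ^ (Suc M choose 2) *
        (real (M choose j) * (q * conn_coeff p (Suc j)) * partition_sum (\<lambda>j. q * conn_coeff p j) (M - j)))"
      unfolding sum_distrib_left
    proof (rule sum.cong, goal_cases)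
      case (2 j)
      have IH: "rc_Z p q (M - j) = (1 - p) ^ ((M - j) choose 2) * partition_sum (\<lambda>j. q * conn_coeff p j) (M - j)"
        using less Suc by simp
      have e: "Suc M choose 2 = (Suc j choose 2) + ((M - j) choose 2) + Suc j * (M - j)"
        using choose_two_add[of "Suc j" "M - j"] 2 by simp
      have c: "conn_prob p (Suc j) = conn_coeff p (Suc j) * (1 - p) ^ (Suc j choose 2)"
        using p by (simp add: conn_coeff_def)
      show ?case unfolding IH e size_prob_def c power_add diff_Suc_1 diff_Suc_Suc by (simp only: mult_ac)
    qed simp
    finally show ?thesis unfolding Suc by (simp only: partition_sum.simps sum_distrib_left)
  qed (simp add: numeral_2_eq_2)
qed

lemma partition_sum_conn:
  assumes p: "p < 1"
  shows "partition_sum (conn_coeff p) N = 1 / (1 - p) ^ (N choose 2)"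
  using rc_Z_partition_sum[OF p, of 1 N] p by (simp add: field_simps)

text \<open>
  The normalisation of the negative binomial distribution, from the binomial series with exponent
  \<open>- (k + 1)\<close>.
\<close>
lemma negative_binomial_sums:
  fixes z :: real
  assumes "0 \<le> z" "z < 1"
  shows "(\<lambda>i. real ((k + i) choose k) * z ^ i) sums (1 / (1 - z) ^ Suc k)"
proof -
  have "(\<lambda>i. ((- real (Suc k)) gchoose i) * (- z) ^ i) sums (1 + - z) powr (- real (Suc k))"
    using assms by (intro gen_binomial_real) simp
  moreover have "((- real (Suc k)) gchoose i) * (- z) ^ i = real ((k + i) choose k) * z ^ i" for i
  proof -
    have "(- real (Suc k)) gchoose i = (- 1) ^ i * (real (k + i) gchoose i)"
      by (subst gbinomial_negated_upper) (simp add: algebra_simps)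
    also have "real (k + i) gchoose i = real ((k + i) choose i)" by (simp add: binomial_gbinomial)
    also have "(k + i) choose i = (k + i) choose k" using binomial_symmetric[of i "k + i"] by simp
    finally have e: "(- real (Suc k)) gchoose i = (- 1) ^ i * real ((k + i) choose k)" .
    have sq: "(- 1) ^ i * (- 1) ^ i = (1 :: real)" by (simp flip: power_mult_distrib)
    have "((- real (Suc k)) gchoose i) * (- z) ^ i
       = ((- 1) ^ i * (- 1) ^ i) * (real ((k + i) choose k) * z ^ i)"
      unfolding e power_minus[of z] by (simp only: mult_ac)
    then show ?thesis unfolding sq by simp
  qed
  moreover have "(1 + - z) powr (- real (Suc k)) = 1 / (1 - z) ^ Suc k"
    using assms by (simp add: powr_minus powr_realpow field_simps del: of_nat_Suc power_Suc)
  ultimately show ?thesis by simp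
qed

section \<open>Large and small components\<close>

definition small_part :: "nat \<Rightarrow> (nat \<Rightarrow> real) \<Rightarrow> nat \<Rightarrow> real" where
  "small_part J w j = (if j \<le> J then w j else 0)"

definition large_part :: "nat \<Rightarrow> (nat \<Rightarrow> real) \<Rightarrow> nat \<Rightarrow> real" where
  "large_part J w j = (if j \<le> J then 0 else w j)"

text \<open>
  The left-hand side is the expected number of \<open>k\<close>-element vertex sets that are unions of components of
  \<open>G(N, p)\<close> with more than \<open>J\<close> vertices each.  A graph has at most \<open>N / J\<close> such components and so at most
  \<open>2 powr (N / J)\<close> such unions, which is expressed by doubling the weights of large components.
\<close>
lemma large_components_volume:
  assumes p: "0 < p" "p < 1" and J: "J \<ge> 1" and k: "k \<le> N"
  shows "real (N choose k) * (1 - p) ^ (k * (N - k))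
      * ((1 - p) ^ (k choose 2) * partition_sum (large_part J (conn_coeff p)) k)
     \<le> (2 powr (1 / real J)) ^ N"
proof -
  let ?c = "conn_coeff p" and ?b = "2 powr (1 / real J)"
  let ?L = "large_part J ?c"
  have c: "?c j \<ge> 0" for j using p by (intro conn_coeff_nonneg) auto
  then have L: "?L j \<ge> 0" for j by (simp add: large_part_def)
  have b1: "?b \<ge> 1" by (intro ge_one_powr_ge_zero) auto
  have "real (N choose k) * partition_sum ?L k * partition_sum ?c (N - k)
     \<le> (\<Sum>k\<le>N. real (N choose k) * partition_sum ?L k * partition_sum ?c (N - k))"
    using k c L by (intro member_le_sum) (auto intro!: mult_nonneg_nonneg partition_sum_nonneg)
  also have "\<dots> = partition_sum (\<lambda>j. ?L j + ?c j) N" by (rule partition_sum_add[symmetric])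
  also have "\<dots> \<le> ?b ^ N * partition_sum ?c N"
  proof (rule partition_sum_le_scale)
    fix j
    have "?L j \<le> (?b ^ j - 1) * ?c j"
    proof (cases "j \<le> J")
      case True
      then show ?thesis using b1 c by (simp add: large_part_def one_le_power)
    next
      case False
      have "2 = ?b ^ J" using J by (simp add: powr_realpow[symmetric] powr_powr)
      also have "\<dots> \<le> ?b ^ j" using False b1 by (intro power_increasing) auto
      finally have "1 * ?c j \<le> (?b ^ j - 1) * ?c j" using c by (intro mult_right_mono) auto
      then show ?thesis using False by (simp add: large_part_def)
    qed
    then show "?L j + ?c j \<le> ?b ^ j * ?c j" by (simp add: left_diff_distrib)
  qed (use c L b1 in \<open>auto intro: add_nonneg_nonneg\<close>)
  finally have main: "real (N choose k) * partition_sum ?L k * partition_sum ?c (N - k)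
     \<le> ?b ^ N * partition_sum ?c N" .
  have s: "1 - p > 0" using p by simp
  have e: "N choose 2 = (k choose 2) + ((N - k) choose 2) + k * (N - k)"
    using choose_two_add[of k "N - k"] k by simp
  have "real (N choose k) * (1 - p) ^ (k * (N - k)) * ((1 - p) ^ (k choose 2) * partition_sum ?L k)
     = (1 - p) ^ (N choose 2) * (real (N choose k) * partition_sum ?L k * partition_sum ?c (N - k))"
    unfolding partition_sum_conn[OF p(2)] e power_add using s by simp
  also have "\<dots> \<le> (1 - p) ^ (N choose 2) * (?b ^ N * partition_sum ?c N)"
    using main s by (intro mult_left_mono) auto
  also have "\<dots> = ?b ^ N" unfolding partition_sum_conn[OF p(2)] using s by simp
  finally show ?thesis .
qed

text \<open>
  The bound of \<open>large_components_volume\<close> holds for all \<open>N \<ge> k\<close>.  Instead of choosing the best \<open>N\<close>, all of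
  them are added up with weights \<open>\<gamma> ^ (N - k)\<close>, where \<open>\<gamma> = 4 powr (- (1 / J))\<close>, so that the right-hand
  sides form a convergent geometric series.  The left-hand sides form a negative binomial series
  with sum about \<open>1 / pi1 (p * k) ^ (k + 1)\<close>.  All other factors on the right are subexponential when
  \<open>J\<close> is of order \<open>n\<close>.
\<close>
lemma large_components_bound:
  assumes p: "0 < p" "p \<le> 1 / 2" and J: "J \<ge> 1" and k: "k \<ge> 1"
  shows "(1 - p) ^ (k choose 2) * partition_sum (large_part J (conn_coeff p)) k
     \<le> 2 * real J * 2 powr (real k / real J) * exp (4 / (real J * p)) * exp (2 * p * real k) * pi1 (p * real k) ^ k"
proof -
  let ?b = "2 powr (1 / real J)"
  define D where "D = (1 - p) ^ (k choose 2) * partition_sum (large_part J (conn_coeff p)) k"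
  have p1: "p < 1" using p by simp
  have D0: "D \<ge> 0" unfolding D_def using p p1
    by (intro mult_nonneg_nonneg partition_sum_nonneg) (auto simp: large_part_def intro: conn_coeff_nonneg)
  have J0: "real J > 0" using J by simp
  have b0: "?b > 0" by simp
  define s where "s = (1 - p) ^ k"
  have s: "0 < s" "s < 1" using p p1 k by (auto simp: s_def intro: power_Suc_less_one power_less_one_iff[THEN iffD2])
  \<comment> \<open>the argument \<open>\<gamma> * (1 - p) ^ k\<close> of the negative binomial series, with \<open>\<gamma> = 1 / ?b\<^sup>2\<close>\<close>
  define z where "z = s / ?b\<^sup>2"
  have ib: "1 / ?b = exp (- (1 / real J * ln 2))" by (simp add: powr_def exp_minus inverse_eq_divide)
  have b1: "1 / ?b < 1" unfolding ib using J0 by simp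
  have "exp (- (1 / real J * ln 2)) \<le> 1 - 1 / real J + 1 / real J * exp (- ln 2)"
    using J by (intro exp_convex) auto
  then have inv: "1 / ?b \<le> 1 - 1 / (2 * real J)" unfolding ib by (simp add: exp_minus)
  have "1 / ?b\<^sup>2 = exp (- (2 * (1 / real J * ln 2)))"
  proof -
    have "1 / ?b\<^sup>2 = (1 / ?b) * (1 / ?b)" by (simp add: power2_eq_square)
    then show ?thesis unfolding ib by (simp flip: exp_add)
  qed
  also have "\<dots> \<ge> 1 - 2 * (1 / real J * ln 2)"
    using exp_ge_add_one_self[of "- (2 * (1 / real J * ln 2))"] by simp
  also have "1 - 2 * (1 / real J * ln 2) \<ge> 1 - 2 / real J"
    using J0 ln_2_less_1 by (simp add: field_simps)
  finally have gam: "1 - 2 / real J \<le> 1 / ?b\<^sup>2" .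
  have "(1 / ?b) * (1 / ?b) \<le> 1 * 1" using b1 by (intro mult_mono) auto
  then have gam1: "1 / ?b\<^sup>2 \<le> 1" by (simp add: power2_eq_square)
  have z: "0 \<le> z" "z < 1"
    using s gam1 mult_left_mono[OF gam1, of s] by (auto simp: z_def)
  have each: "real ((k + i) choose k) * z ^ i * D \<le> ?b ^ k * (1 / ?b) ^ i" for i
  proof -
    have "real ((k + i) choose k) * (1 - p) ^ (k * i) * D \<le> ?b ^ (k + i)"
      using large_components_volume[of p J k "k + i"] p p1 J by (simp add: D_def)
    then have "real ((k + i) choose k) * (1 - p) ^ (k * i) * D / (?b\<^sup>2) ^ i \<le> ?b ^ (k + i) / (?b\<^sup>2) ^ i"
      by (intro divide_right_mono) auto
    also have "?b ^ (k + i) / (?b\<^sup>2) ^ i = ?b ^ k * (1 / ?b) ^ i"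
      using b0 by (simp add: power_add power2_eq_square power_mult_distrib power_one_over field_simps)
    also have "real ((k + i) choose k) * (1 - p) ^ (k * i) * D / (?b\<^sup>2) ^ i = real ((k + i) choose k) * z ^ i * D"
      by (simp add: z_def s_def power_divide power_mult)
    finally show ?thesis .
  qed
  have S1: "(\<lambda>i. real ((k + i) choose k) * z ^ i * D) sums (1 / (1 - z) ^ Suc k * D)"
    using negative_binomial_sums[OF z, of k] by (rule sums_mult2)
  have S2: "(\<lambda>i. ?b ^ k * (1 / ?b) ^ i) sums (?b ^ k * (1 / (1 - 1 / ?b)))"
    using b1 b0 by (intro sums_mult geometric_sums) simp
  have "1 / (1 - z) ^ Suc k * D \<le> ?b ^ k * (1 / (1 - 1 / ?b))"
    by (rule sums_le[OF each S1 S2])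
  then have "D \<le> ?b ^ k * (1 / (1 - 1 / ?b)) * (1 - z) ^ Suc k"
    using z by (simp add: field_simps)
  also have "\<dots> \<le> ?b ^ k * (2 * real J) * (exp (4 / (real J * p)) * (exp (2 * p * real k) * pi1 (p * real k) ^ k))"
  proof (intro mult_mono)
    have "1 / (2 * real J) \<le> 1 - 1 / ?b" using inv by simp
    then have "1 / (1 - 1 / ?b) \<le> 1 / (1 / (2 * real J))" using J0 b1 by (intro divide_left_mono) auto
    then show "1 / (1 - 1 / ?b) \<le> 2 * real J" by simp
    \<comment> \<open>convexity replaces \<open>(1 - p) ^ k\<close> by \<open>exp (- (p * k))\<close> at the cost of a bounded factor\<close>
    define t where "t = p / (- ln (1 - p))"
    have lnp: "p \<le> - ln (1 - p)" using ln_add_one_self_le_self2[of "- p"] p by simp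
    have c0: "- ln (1 - p) > 0" using lnp p by linarith
    have t: "0 < t" "t \<le> 1"
      unfolding t_def using p c0 by (simp_all only: divide_pos_pos pos_divide_le_eq[OF c0] mult_1 lnp)
    have kp: "p * real k > 0" using p k by simp
    have sk: "s = exp (- (- ln (1 - p) * real k))"
      using p1 exp_of_nat_mult[of k "ln (1 - p)"] by (simp add: s_def mult.commute)
    have "exp (- (t * (- ln (1 - p) * real k))) \<le> 1 - t + t * exp (- (- ln (1 - p) * real k))"
      using t c0 by (intro exp_convex mult_nonneg_nonneg) auto
    also have "t * (- ln (1 - p) * real k) = p * real k" unfolding t_def using c0 by simp
    finally have "t * (1 - s) \<le> pi1 (p * real k)" by (simp add: sk pi1_def right_diff_distrib)
    moreover have "1 - p \<le> t"
    proof -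
      have "ln (1 / (1 - p)) \<le> 1 / (1 - p) - 1" using p1 by (intro ln_le_minus_one) auto
      then have "- ln (1 - p) \<le> p / (1 - p)" using p1 by (simp add: ln_div field_simps)
      then have "- ln (1 - p) * (1 - p) \<le> p" using p1 by (simp add: field_simps)
      then show ?thesis unfolding t_def pos_le_divide_eq[OF c0] by (simp only: mult.commute)
    qed
    ultimately have "(1 - p) * (1 - s) \<le> pi1 (p * real k)"
      using s mult_right_mono[of "1 - p" t "1 - s"] by linarith
    then have "((1 - p) * (1 - s)) ^ k \<le> pi1 (p * real k) ^ k" using p1 s by (intro power_mono) auto
    then have A: "s * (1 - s) ^ k \<le> pi1 (p * real k) ^ k" by (simp add: power_mult_distrib s_def)
    have "1 / s \<le> exp (2 * p * real k)"
    proof -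
      have "1 \<le> (1 - p) * (1 + 2 * p)"
      proof -
        have "p * (2 * p) \<le> p * 1" using p by (intro mult_left_mono) auto
        then show ?thesis by (simp add: algebra_simps)
      qed
      also have "\<dots> \<le> (1 - p) * exp (2 * p)" using p1 exp_ge_add_one_self[of "2 * p"] by (intro mult_left_mono) auto
      finally have "1 ^ k \<le> ((1 - p) * exp (2 * p)) ^ k" by (intro power_mono) auto
      then have "1 \<le> s * exp (2 * p * real k)"
        by (simp add: power_mult_distrib s_def mult_ac flip: exp_of_nat_mult)
      then show ?thesis using s by (simp add: field_simps)
    qed
    then have B: "(1 - s) ^ k \<le> exp (2 * p * real k) * pi1 (p * real k) ^ k"
    proof -
      assume h: "1 / s \<le> exp (2 * p * real k)"
      have "(1 - s) ^ k = (1 / s) * (s * (1 - s) ^ k)" using s by simp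
      also have "\<dots> \<le> exp (2 * p * real k) * pi1 (p * real k) ^ k"
        using h A s by (intro mult_mono) auto
      finally show ?thesis .
    qed
    have "s * (1 + p * real k) \<le> 1"
    proof -
      have "s \<le> exp (- p) ^ k" unfolding s_def using p1 exp_ge_add_one_self[of "- p"] by (intro power_mono) auto
      then have "s \<le> exp (- (p * real k))" by (simp add: mult.commute flip: exp_of_nat_mult)
      then have "s * (1 + p * real k) \<le> exp (- (p * real k)) * exp (p * real k)"
        using kp s by (intro mult_mono exp_ge_add_one_self) auto
      then show ?thesis by (simp flip: exp_add)
    qed
    then have "s \<le> (1 - s) / (p * real k)" using kp by (simp add: pos_le_divide_eq algebra_simps)
    then have "(1 - 1 / ?b\<^sup>2) * s \<le> (2 / real J) * ((1 - s) / (p * real k))"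
      using gam gam1 s kp J0 by (intro mult_mono) auto
    then have "1 - z \<le> (1 - s) * (1 + 2 / (real J * p * real k))"
      by (simp add: z_def algebra_simps)
    then have "(1 - z) ^ Suc k \<le> ((1 - s) * (1 + 2 / (real J * p * real k))) ^ Suc k"
      using z by (intro power_mono) auto
    also have "\<dots> = (1 - s) ^ Suc k * (1 + 2 / (real J * p * real k)) ^ Suc k" by (rule power_mult_distrib)
    also have "\<dots> \<le> (1 - s) ^ k * exp (4 / (real J * p))"
    proof (rule mult_mono)
      show "(1 - s) ^ Suc k \<le> (1 - s) ^ k" using s by (intro power_decreasing) auto
      have "(1 + 2 / (real J * p * real k)) ^ Suc k \<le> exp (2 / (real J * p * real k)) ^ Suc k"
        using J0 p by (intro power_mono exp_ge_add_one_self) auto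
      also have "\<dots> = exp (real (Suc k) * (2 / (real J * p * real k)))" by (simp only: exp_of_nat_mult)
      also have "real (Suc k) * (2 / (real J * p * real k)) \<le> (2 * real k) * (2 / (real J * p * real k))"
        using k J0 p by (intro mult_right_mono) auto
      also have "(2 * real k) * (2 / (real J * p * real k)) = 4 / (real J * p)" using k by simp
      finally show "(1 + 2 / (real J * p * real k)) ^ Suc k \<le> exp (4 / (real J * p))" by simp
    qed (use s J0 p in auto)
    also have "\<dots> \<le> (exp (2 * p * real k) * pi1 (p * real k) ^ k) * exp (4 / (real J * p))"
      using B by (intro mult_right_mono) auto
    finally show "(1 - z) ^ Suc k \<le> exp (4 / (real J * p)) * (exp (2 * p * real k) * pi1 (p * real k) ^ k)"
      by (simp only: mult_ac)
  qed (use z b0 b1 in auto)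
  also have "?b ^ k = 2 powr (real k / real J)" by (simp add: powr_realpow[symmetric] powr_powr)
  finally show ?thesis by (simp add: D_def mult_ac)
qed

lemma fact_add_ge: "fact m * real m ^ k \<le> fact (m + k)"
proof (induction k)
  case (Suc k)
  have "fact m * real m ^ Suc k = (fact m * real m ^ k) * real m" by simp
  also have "\<dots> \<le> fact (m + k) * real (m + Suc k)" using Suc by (intro mult_mono) auto
  also have "\<dots> = fact (m + Suc k)" by simp
  finally show ?case .
qed simp

lemma binomial_ge: "k \<le> n \<Longrightarrow> (real n - real k) ^ k / fact k \<le> real (n choose k)"
proof -
  assume k: "k \<le> n"
  have "fact (n - k) * real (n - k) ^ k \<le> fact (n - k + k)" by (rule fact_add_ge)
  then have "fact (n - k) * (real n - real k) ^ k \<le> (fact n :: real)" using k by simp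
  then have "fact (n - k) * (real n - real k) ^ k / (fact k * fact (n - k)) \<le> fact n / (fact k * fact (n - k) :: real)"
    by (intro divide_right_mono) auto
  then show ?thesis using k by (simp add: binomial_fact)
qed

text \<open>
  For \<open>t = p * M\<close> this is approximately \<open>t * exp (- t) / p\<close>, the parametrisation of the tree function; the
  factor \<open>1 - \<epsilon>\<close> absorbs the error for components with up to \<open>\<epsilon> * M\<close> vertices.
\<close>
definition small_point :: "real \<Rightarrow> real \<Rightarrow> nat \<Rightarrow> real" where
  "small_point \<epsilon> p M = (1 - \<epsilon>) * real M * (1 - p) ^ M"

definition small_gf :: "real \<Rightarrow> nat \<Rightarrow> real \<Rightarrow> real" where
  "small_gf p J x = (\<Sum>j=1..J. conn_coeff p j * x ^ j / fact j)"

text \<open>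
  Up to the error absorbed by \<open>\<epsilon>\<close>, the left-hand side is \<open>M\<close> times the probability that the component of a vertex
  of \<open>G(M, p)\<close> has at most \<open>J\<close> vertices.
\<close>
lemma small_gf_deriv_le:
  assumes p: "0 < p" "p < 1" and e: "0 \<le> \<epsilon>" "\<epsilon> < 1" and M: "M \<ge> 1" "real J \<le> \<epsilon> * real M"
  shows "(\<Sum>j=1..J. conn_coeff p j * small_point \<epsilon> p M ^ j / fact (j - 1)) \<le> real M"
proof -
  let ?x = "small_point \<epsilon> p M" and ?A = "(1 - \<epsilon>) * real M"
  have A: "?A > 0" using e M by simp
  have "\<epsilon> * real M \<le> 1 * real M" using e by (intro mult_right_mono) auto
  then have JM: "J \<le> M" using M by linarith
  have nn: "size_prob p M j \<ge> 0" for j using p by (intro size_prob_nonneg) auto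
  have "(\<Sum>j=1..J. conn_coeff p j * ?x ^ j / fact (j - 1)) \<le> (\<Sum>j=1..J. ?A * size_prob p M j)"
  proof (rule sum_mono)
    fix j assume j: "j \<in> {1..J}"
    then have jM: "1 \<le> j" "j \<le> M" "real j \<le> \<epsilon> * real M" using JM M(2) by auto
    have "?A ^ (j - 1) \<le> (real (M - 1) - real (j - 1)) ^ (j - 1)"
    proof (rule power_mono)
      show "?A \<le> real (M - 1) - real (j - 1)" using jM by (simp add: of_nat_diff algebra_simps)
    qed (use A in simp)
    then have "?A ^ (j - 1) / fact (j - 1) \<le> (real (M - 1) - real (j - 1)) ^ (j - 1) / fact (j - 1)"
      by (intro divide_right_mono) auto
    also have "\<dots> \<le> real ((M - 1) choose (j - 1))" using jM by (intro binomial_ge) auto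
    finally have C: "?A ^ (j - 1) / fact (j - 1) \<le> real ((M - 1) choose (j - 1))" .
    have "j * (M - j) + (j choose 2) \<le> M * j"
    proof -
      have "j choose 2 = j * (j - 1) div 2" by (rule choose_two)
      also have "\<dots> \<le> j * (j - 1)" by (rule div_le_dividend)
      also have "\<dots> \<le> j * j" by simp
      finally have "j choose 2 \<le> j * j" .
      then have "j * (M - j) + (j choose 2) \<le> j * (M - j) + j * j" by simp
      also have "\<dots> = M * j" using jM by (simp add: mult.commute flip: add_mult_distrib2)
      finally show ?thesis .
    qed
    then have "(1 - p) ^ (M * j) \<le> (1 - p) ^ (j * (M - j) + (j choose 2))"
      using p by (intro power_decreasing) auto
    then have S: "((1 - p) ^ M) ^ j \<le> (1 - p) ^ (j * (M - j)) * (1 - p) ^ (j choose 2)"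
      by (simp only: power_add power_mult)
    have c: "conn_coeff p j \<ge> 0" using p by (intro conn_coeff_nonneg) auto
    have cp: "conn_prob p j = conn_coeff p j * (1 - p) ^ (j choose 2)" using p by (simp add: conn_coeff_def)
    have "?A ^ j = ?A * ?A ^ (j - 1)" using jM by (cases j) auto
    then have "conn_coeff p j * ?x ^ j / fact (j - 1)
       = ?A * (?A ^ (j - 1) / fact (j - 1) * (conn_coeff p j * ((1 - p) ^ M) ^ j))"
      by (simp add: small_point_def power_mult_distrib)
    also have "\<dots> \<le> ?A * (real ((M - 1) choose (j - 1)) *
        (conn_coeff p j * ((1 - p) ^ (j * (M - j)) * (1 - p) ^ (j choose 2))))"
      using C S c A p by (intro mult_left_mono mult_mono) (auto intro!: mult_nonneg_nonneg)
    also have "\<dots> = ?A * size_prob p M j" unfolding size_prob_def cp by (simp only: mult_ac)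
    finally show "conn_coeff p j * ?x ^ j / fact (j - 1) \<le> ?A * size_prob p M j" .
  qed
  also have "\<dots> \<le> (\<Sum>j=1..M. ?A * size_prob p M j)"
    using JM nn A by (intro sum_mono2) auto
  also have "\<dots> = ?A" unfolding sum_distrib_left[symmetric] size_prob_sum[OF M(1)] by simp
  also have "\<dots> \<le> real M" using e by (simp add: algebra_simps)
  finally show ?thesis .
qed

text \<open>
  The previous lemma bounds \<open>x\<close> times the derivative of the generating function at \<open>x = small_point \<epsilon> p (M + 1)\<close>, and
  Bernoulli's inequality bounds the increment by this derivative; the relative length of the step
  is \<open>1 - M / ((M + 1) * (1 - p))\<close>.
\<close>
lemma small_gf_step:
  assumes p: "0 < p" "p < 1" and e: "0 \<le> \<epsilon>" "\<epsilon> < 1" and M: "real J \<le> \<epsilon> * real (Suc M)" and pM: "p * real M \<le> 1"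
  shows "small_gf p J (small_point \<epsilon> p (Suc M)) \<le> small_gf p J (small_point \<epsilon> p M) + (1 - p * real M)"
proof -
  let ?a = "small_point \<epsilon> p M" and ?b = "small_point \<epsilon> p (Suc M)"
  have c: "conn_coeff p j \<ge> 0" for j using p by (intro conn_coeff_nonneg) auto
  have s: "1 - p > 0" using p by simp
  have ab: "?a \<ge> 0" "?b > 0" using e s by (auto simp: small_point_def)
  show ?thesis
  proof (cases "?b \<le> ?a")
    case True
    then have "small_gf p J ?b \<le> small_gf p J ?a"
      unfolding small_gf_def using c ab by (intro sum_mono divide_right_mono mult_left_mono power_mono) auto
    then show ?thesis using pM by linarith
  next
    case False
    \<comment> \<open>the relative length of the step\<close>
    define r where "r = (?b - ?a) / ?b"
    have r: "0 \<le> r" "r \<le> 1" using False ab by (auto simp: r_def)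
    have r2: "r * real (Suc M) \<le> 1 - p * real M"
    proof -
      have "?a / ?b = real M / (real (Suc M) * (1 - p))"
        using e s by (simp add: small_point_def)
      then have "r = 1 - real M / (real (Suc M) * (1 - p))" using ab by (simp add: r_def diff_divide_distrib)
      then have "r * real (Suc M) = real (Suc M) - real M / (1 - p)"
        using s by (simp add: left_diff_distrib del: of_nat_Suc)
      moreover have "real M * (1 + p) \<le> real M / (1 - p)"
      proof -
        have "1 + p \<le> 1 / (1 - p)" using s by (simp add: field_simps)
        then have "real M * (1 + p) \<le> real M * (1 / (1 - p))" by (intro mult_left_mono) auto
        then show ?thesis by simp
      qed
      ultimately show ?thesis by (simp add: algebra_simps)
    qed
    have "small_gf p J ?b - small_gf p J ?a = (\<Sum>j=1..J. conn_coeff p j * (?b ^ j - ?a ^ j) / fact j)"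
      unfolding small_gf_def sum_subtractf[symmetric] by (intro sum.cong) (auto simp: right_diff_distrib diff_divide_distrib)
    also have "\<dots> \<le> (\<Sum>j=1..J. r * (conn_coeff p j * ?b ^ j / fact (j - 1)))"
    proof (rule sum_mono)
      fix j assume j: "j \<in> {1..J}"
      have "1 + real j * (- r) \<le> (1 + (- r)) ^ j" using r by (intro Bernoulli_inequality) auto
      then have "?b ^ j * (1 - real j * r) \<le> ?b ^ j * (1 - r) ^ j" using ab by (intro mult_left_mono) auto
      also have "\<dots> = (?b * (1 - r)) ^ j" by (simp add: power_mult_distrib)
      also have "?b * (1 - r) = ?a" using ab by (simp add: r_def field_simps)
      finally have "?b ^ j - ?a ^ j \<le> real j * r * ?b ^ j" by (simp add: algebra_simps)
      then have "conn_coeff p j * (?b ^ j - ?a ^ j) / fact j \<le> conn_coeff p j * (real j * r * ?b ^ j) / fact j"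
        using c by (intro divide_right_mono mult_left_mono) auto
      also have "\<dots> = r * (conn_coeff p j * ?b ^ j / fact (j - 1))"
        using j by (simp add: fact_reduce[of j])
      finally show "conn_coeff p j * (?b ^ j - ?a ^ j) / fact j \<le> r * (conn_coeff p j * ?b ^ j / fact (j - 1))" .
    qed
    also have "\<dots> \<le> r * real (Suc M)"
      unfolding sum_distrib_left[symmetric] using r small_gf_deriv_le[OF p e _ M] by (intro mult_left_mono) auto
    finally show ?thesis using r2 by linarith
  qed
qed

text \<open>
  Summing the steps replaces integrating \<open>(1 - t) / p\<close> over \<open>t = p * M\<close>; the last summand is the cost of
  starting at \<open>M0\<close>.
\<close>
lemma small_gf_le:
  assumes p: "0 < p" "p < 1" and e: "0 \<le> \<epsilon>" "\<epsilon> < 1" and M0: "M0 \<ge> 1" "real J \<le> \<epsilon> * real M0"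
    and M: "M0 \<le> M" and pM: "p * (real M - 1) \<le> 1"
  shows "small_gf p J (small_point \<epsilon> p M)
     \<le> real M - p * real M * (real M - 1) / 2 + p * real M0 * (real M0 - 1) / 2"
  using M pM
proof (induction M rule: dec_induct)
  case base
  have c: "conn_coeff p j \<ge> 0" for j using p by (intro conn_coeff_nonneg) auto
  have x: "small_point \<epsilon> p M0 \<ge> 0" using e p by (simp add: small_point_def)
  have "small_gf p J (small_point \<epsilon> p M0)
     \<le> (\<Sum>j=1..J. conn_coeff p j * small_point \<epsilon> p M0 ^ j / fact (j - 1))"
    unfolding small_gf_def using c x
    by (intro sum_mono divide_left_mono fact_mono) auto
  also have "\<dots> \<le> real M0" by (rule small_gf_deriv_le[OF p e M0])
  finally show ?case by simp
next
  case (step M)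
  have "real J \<le> \<epsilon> * real (Suc M)"
    using M0(2) step e mult_left_mono[of "real M0" "real (Suc M)" \<epsilon>] by linarith
  moreover have pM: "p * real M \<le> 1" using step by simp
  ultimately have "small_gf p J (small_point \<epsilon> p (Suc M)) \<le> small_gf p J (small_point \<epsilon> p M) + (1 - p * real M)"
    by (intro small_gf_step p e)
  also have "p * (real M - 1) \<le> 1" using pM p by (simp add: algebra_simps)
  then have "small_gf p J (small_point \<epsilon> p M)
     \<le> real M - p * real M * (real M - 1) / 2 + p * real M0 * (real M0 - 1) / 2" using step by simp
  finally show ?case by (simp add: field_simps)
qed

lemma small_components_bound:
  assumes p: "0 < p" "p < 1" and q: "q > 0" and e: "0 \<le> \<epsilon>" "\<epsilon> < 1"
    and M0: "M0 \<ge> 1" "real J \<le> \<epsilon> * real M0" and M: "M0 \<le> M" and pM: "p * (real M - 1) \<le> 1"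
  shows "partition_sum (small_part J (\<lambda>j. q * conn_coeff p j)) m
     \<le> fact m / small_point \<epsilon> p M ^ m
       * exp (q * (real M - p * real M * (real M - 1) / 2 + p * real M0 * (real M0 - 1) / 2))"
proof -
  let ?x = "small_point \<epsilon> p M" and ?w = "small_part J (\<lambda>j. q * conn_coeff p j)"
  have c: "conn_coeff p j \<ge> 0" for j using p by (intro conn_coeff_nonneg) auto
  have x: "?x > 0" using e p M M0 by (simp add: small_point_def)
  have "partition_sum ?w m * ?x ^ m / fact m \<le> exp (\<Sum>j=1..m. ?w j * ?x ^ j / fact j)"
    using c q x by (intro partition_sum_chernoff) (auto simp: small_part_def)
  also have "(\<Sum>j=1..m. ?w j * ?x ^ j / fact j) \<le> q * small_gf p J ?x"
  proof -
    have "(\<Sum>j=1..m. ?w j * ?x ^ j / fact j) \<le> (\<Sum>j\<in>{1..m} \<union> {1..J}. ?w j * ?x ^ j / fact j)"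
      using c q x by (intro sum_mono2) (auto simp: small_part_def)
    also have "\<dots> = (\<Sum>j=1..J. ?w j * ?x ^ j / fact j)"
      by (rule sum.mono_neutral_right) (auto simp: small_part_def)
    also have "\<dots> = q * small_gf p J ?x"
      unfolding small_gf_def sum_distrib_left by (intro sum.cong) (auto simp: small_part_def)
    finally show ?thesis .
  qed
  also have "q * small_gf p J ?x \<le> q * (real M - p * real M * (real M - 1) / 2 + p * real M0 * (real M0 - 1) / 2)"
    using q small_gf_le[OF p e M0 M pM] by (intro mult_left_mono) auto
  finally have "partition_sum ?w m * ?x ^ m / fact m
     \<le> exp (q * (real M - p * real M * (real M - 1) / 2 + p * real M0 * (real M0 - 1) / 2))"
    by simp
  then show ?thesis using x by (simp add: field_simps)
qed

lemma rc_Z_split: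
  assumes p: "p < 1"
  shows "rc_Z p q n = (\<Sum>k\<le>n. real (n choose k) * (1 - p) ^ (k * (n - k))
     * ((1 - p) ^ (k choose 2) * partition_sum (large_part J (\<lambda>j. q * conn_coeff p j)) k)
     * ((1 - p) ^ ((n - k) choose 2) * partition_sum (small_part J (\<lambda>j. q * conn_coeff p j)) (n - k)))"
proof -
  let ?w = "\<lambda>j. q * conn_coeff p j"
  have "?w = (\<lambda>j. large_part J ?w j + small_part J ?w j)"
    by (auto simp: large_part_def small_part_def)
  then have "rc_Z p q n = (1 - p) ^ (n choose 2) * partition_sum (\<lambda>j. large_part J ?w j + small_part J ?w j) n"
    using rc_Z_partition_sum[OF p] by simp
  also have "\<dots> = (\<Sum>k\<le>n. (1 - p) ^ (n choose 2) * (real (n choose k)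
      * partition_sum (large_part J ?w) k * partition_sum (small_part J ?w) (n - k)))"
    unfolding partition_sum_add sum_distrib_left ..
  also have "\<dots> = (\<Sum>k\<le>n. real (n choose k) * (1 - p) ^ (k * (n - k))
     * ((1 - p) ^ (k choose 2) * partition_sum (large_part J ?w) k)
     * ((1 - p) ^ ((n - k) choose 2) * partition_sum (small_part J ?w) (n - k)))"
  proof (rule sum.cong, goal_cases)
    case (2 k)
    then have e: "n choose 2 = (k choose 2) + ((n - k) choose 2) + k * (n - k)"
      using choose_two_add[of k "n - k"] by simp
    show ?case unfolding e power_add by (simp only: mult_ac)
  qed simp
  finally show ?thesis .
qed

text \<open>
  Each large component has more than \<open>J\<close> vertices, so its factor \<open>q\<close> can be distributed over them.
\<close>
lemma large_part_scale_q:
  assumes p: "0 < p" "p < 1" and q: "q > 0" and J: "J \<ge> 1"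
  shows "partition_sum (large_part J (\<lambda>j. q * conn_coeff p j)) k
     \<le> max 1 q powr (real k / real J) * partition_sum (large_part J (conn_coeff p)) k"
proof -
  let ?a = "max 1 q powr (1 / real J)"
  have c: "conn_coeff p j \<ge> 0" for j using p by (intro conn_coeff_nonneg) auto
  have a1: "?a \<ge> 1" by (intro ge_one_powr_ge_zero) auto
  have "partition_sum (large_part J (\<lambda>j. q * conn_coeff p j)) k
     \<le> ?a ^ k * partition_sum (large_part J (conn_coeff p)) k"
  proof (rule partition_sum_le_scale)
    fix j
    show "large_part J (\<lambda>j. q * conn_coeff p j) j \<le> ?a ^ j * large_part J (conn_coeff p) j"
    proof (cases "j \<le> J")
      case False
      have "q \<le> ?a ^ J" using J by (simp add: powr_realpow[symmetric] powr_powr)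
      also have "\<dots> \<le> ?a ^ j" using False a1 by (intro power_increasing) auto
      finally show ?thesis using False c by (simp add: large_part_def mult_right_mono)
    qed (simp add: large_part_def)
  qed (use c q a1 in \<open>auto simp: large_part_def\<close>)
  also have "?a ^ k = max 1 q powr (real k / real J)"
    by (simp add: powr_realpow[symmetric] powr_powr)
  finally show ?thesis .
qed

section \<open>Upper bound on the free energy\<close>

lemma neg_ln_one_minus_le:
  fixes p :: real
  assumes "0 \<le> p" "p \<le> 1 / 2"
  shows "- ln (1 - p) \<le> p + 2 * p\<^sup>2" "- ln (1 - p) \<le> 2 * p"
proof -
  have "ln (1 / (1 - p)) \<le> 1 / (1 - p) - 1" using assms by (intro ln_le_minus_one) auto
  then have 1: "- ln (1 - p) \<le> p / (1 - p)" using assms by (simp add: ln_div field_simps)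
  have sq: "p * p \<le> p * (1 / 2)" using assms by (intro mult_left_mono) auto
  have "p * p * (p * 2) \<le> p * p * 1" using assms by (intro mult_left_mono) auto
  then have "p \<le> (p + 2 * p\<^sup>2) * (1 - p)" by (simp add: algebra_simps power2_eq_square)
  then have "p / (1 - p) \<le> p + 2 * p\<^sup>2" using assms by (simp add: pos_divide_le_eq)
  then show "- ln (1 - p) \<le> p + 2 * p\<^sup>2" using 1 by linarith
  then show "- ln (1 - p) \<le> 2 * p" using sq by (simp add: power2_eq_square)
qed

text \<open>
  The left-hand side, as a function of \<open>\<tau> \<le> 1 / p\<close>, is minimal at this \<open>\<tau>\<close>.  The minimum is attained at the
  end point \<open>1 / p\<close> precisely when \<open>p * m / q \<ge> 1\<close>, which is the range in which \<open>Psi\<close> is given by its logarithmic formula.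
\<close>
lemma saddle_value:
  assumes p: "p > 0" and q: "q > 0" and m: "m > 0"
  defines "\<tau> \<equiv> min (m / q) (1 / p)"
  shows "m * ln m - m - p * m\<^sup>2 / 2 - m * ln \<tau> + m * p * \<tau> + q * \<tau> - q * p * \<tau>\<^sup>2 / 2
    = m * (Psi (p * m / q) - (q - 1) / (2 * q) * (p * m) + ln q)"
proof -
  have coeff: "(q - 1) / (2 * q) = 1 / 2 - 1 / (2 * q)" using q by (simp add: field_simps)
  show ?thesis
  proof (cases "p * m / q \<le> 1")
    case True
    then have t: "\<tau> = m / q" using p q by (simp add: \<tau>_def field_simps min_def)
    have P: "Psi (p * m / q) = 0" using True p q m by (intro Psi_le_1) auto
    have lt: "ln \<tau> = ln m - ln q" unfolding t using m q by (simp add: ln_div)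
    show ?thesis unfolding P coeff lt unfolding t using q by (simp add: field_simps power2_eq_square)
  next
    case False
    then have t: "\<tau> = 1 / p" using p q by (simp add: \<tau>_def field_simps min_def)
    have P: "Psi (p * m / q) = ln p + ln m - ln q - (p * m / q - q / (p * m)) / 2"
      using False p q m by (subst Psi_ge_1) (auto simp: ln_div ln_mult_pos)
    have lt: "ln \<tau> = - ln p" unfolding t using p by (simp add: ln_div)
    show ?thesis unfolding P coeff lt unfolding t using q p m by (simp add: field_simps power2_eq_square)
  qed
qed

text \<open>
  The parameter \<open>M\<close> is the integer above the optimal \<open>\<tau>\<close>, or \<open>M0\<close> if that is larger.  The rounding errors are of
  order \<open>1 + M0\<close>, hence negligible when \<open>M0\<close> is a small multiple of \<open>n\<close>.
\<close>
lemma small_components_exp_bound: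
  assumes p: "0 < p" "p \<le> 1 / 2" and q: "q > 0" and e: "0 \<le> \<epsilon>" "\<epsilon> \<le> 1 / 2"
    and M0: "M0 \<ge> 1" "real J \<le> \<epsilon> * real M0" "p * (real M0 - 1) \<le> 1" and m: "m \<ge> 1"
  shows "(1 - p) ^ (m choose 2) * partition_sum (small_part J (\<lambda>j. q * conn_coeff p j)) m
     \<le> exp (real m * (Psi (p * real m / q) - (q - 1) / (2 * q) * (p * real m) + ln q)
        + (1 + ln (real m) + 2 * \<epsilon> * real m + p * real m * (6 + real M0) + 2 * q * (1 + real M0)))"
proof -
  define \<tau> where "\<tau> = min (real m / q) (1 / p)"
  define M where "M = max M0 (nat \<lceil>\<tau>\<rceil>)"
  have p1: "p < 1" using p by simp
  have m0: "real m > 0" using m by simp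
  have t0: "\<tau> > 0" using m0 q p by (simp add: \<tau>_def)
  have Mt: "\<tau> \<le> real M" by (simp add: M_def) linarith
  have ct: "real (nat \<lceil>\<tau>\<rceil>) \<le> \<tau> + 1" using t0 by simp
  have "M \<le> nat \<lceil>\<tau>\<rceil> + M0" by (simp add: M_def)
  then have "real M \<le> real (nat \<lceil>\<tau>\<rceil> + M0)" by (simp only: of_nat_le_iff)
  then have Mu: "real M \<le> \<tau> + 1 + real M0" using ct unfolding of_nat_add by linarith
  have pM: "p * (real M - 1) \<le> 1"
  proof (cases "M = M0")
    case False
    then have "real M - 1 \<le> \<tau>" using ct by (auto simp: M_def max_def split: if_splits)
    also have "\<dots> \<le> 1 / p" by (simp add: \<tau>_def)
    finally show ?thesis using p by (simp add: field_simps)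
  qed (use M0 in simp)
  have M1: "M0 \<le> M" by (simp add: M_def)
  have pM2: "p * real M \<le> 2" and pM02: "p * real M0 \<le> 2" using pM M0(3) p by (simp_all add: algebra_simps)
  have M0r: "real M \<ge> 1" using M1 M0 by linarith
  let ?x = "small_point \<epsilon> p M"
  have x: "?x > 0" using e p M0r by (simp add: small_point_def)
  let ?Q = "q * (real M - p * real M * (real M - 1) / 2 + p * real M0 * (real M0 - 1) / 2)"
  have "(1 - p) ^ (m choose 2) * partition_sum (small_part J (\<lambda>j. q * conn_coeff p j)) m
     \<le> (1 - p) ^ (m choose 2) * (fact m / ?x ^ m * exp ?Q)"
    using p1 e by (intro mult_left_mono small_components_bound p q M0 M1 pM) auto
  also have "\<dots> = exp (real (m choose 2) * ln (1 - p) + ln (fact m) - real m * ln ?x + ?Q)"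
    using p1 x by (simp add: exp_add exp_diff exp_of_nat_mult)
  also have "\<dots> \<le> exp (real m * (Psi (p * real m / q) - (q - 1) / (2 * q) * (p * real m) + ln q)
        + (1 + ln (real m) + 2 * \<epsilon> * real m + p * real m * (6 + real M0) + 2 * q * (1 + real M0)))"
  proof -
    have lnp: "ln (1 - p) \<le> - p" using ln_add_one_self_le_self2[of "- p"] p by simp
    have c0: "real m * (real m - 1) / 2 \<ge> 0" using m by simp
    have 1: "real (m choose 2) * ln (1 - p) \<le> - (p * (real m)\<^sup>2 / 2) + p * real m / 2"
      unfolding choose_two_real using mult_left_mono[OF lnp c0] by (simp add: algebra_simps power2_eq_square)
    have 2: "ln (fact m) \<le> real m * ln (real m) - real m + 1 + ln (real m)"
      using ln_fact_bounds(2)[of m] by (simp add: xlnx_def)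
    have lx: "ln ?x = ln (1 - \<epsilon>) + ln (real M) + real M * ln (1 - p)"
      unfolding small_point_def using e p1 M0r by (simp add: ln_mult_pos ln_realpow)
    have "real m * (- ln (1 - \<epsilon>)) \<le> real m * (2 * \<epsilon>)"
      using neg_ln_one_minus_le(2)[of \<epsilon>] e by (intro mult_left_mono) auto
    moreover have "real m * ln \<tau> \<le> real m * ln (real M)" using Mt t0 by (intro mult_left_mono) auto
    moreover have "real m * real M * (- ln (1 - p)) \<le> real m * real M * (p + 2 * p\<^sup>2)"
      using neg_ln_one_minus_le(1)[of p] p by (intro mult_left_mono) auto
    moreover have "real m * p * real M \<le> real m * p * (\<tau> + 1 + real M0)"
      using Mu p by (intro mult_left_mono) auto
    moreover have "2 * (p * real m) * (p * real M) \<le> 2 * (p * real m) * 2"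
      using pM2 p by (intro mult_left_mono) auto
    ultimately have 3: "- (real m * ln ?x) \<le> 2 * \<epsilon> * real m - real m * ln \<tau> + real m * p * \<tau>
        + p * real m * (1 + real M0) + 4 * (p * real m)"
      unfolding lx by (simp add: algebra_simps power2_eq_square)
    have "\<tau>\<^sup>2 \<le> (real M)\<^sup>2" using Mt t0 by (intro power_mono) auto
    then have a: "p * \<tau>\<^sup>2 \<le> p * (real M)\<^sup>2" using p by (intro mult_left_mono) auto
    have b: "p * real M0 * (real M0 - 1) \<le> 2 * real M0"
      using pM02 M0 p mult_mono[of "p * real M0" 2 "real M0 - 1" "real M0"] by simp
    have "real M - p * real M * (real M - 1) / 2 + p * real M0 * (real M0 - 1) / 2
       = real M - p * (real M)\<^sup>2 / 2 + p * real M / 2 + p * real M0 * (real M0 - 1) / 2"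
      by (simp add: algebra_simps power2_eq_square add_divide_distrib diff_divide_distrib)
    also have "\<dots> \<le> (\<tau> + 1 + real M0) - p * \<tau>\<^sup>2 / 2 + 1 + real M0"
      using Mu a b pM2 by linarith
    finally have "?Q \<le> q * ((\<tau> + 1 + real M0) - p * \<tau>\<^sup>2 / 2 + 1 + real M0)"
      using q by (intro mult_left_mono) auto
    then have 4: "?Q \<le> q * \<tau> - q * p * \<tau>\<^sup>2 / 2 + 2 * q * (1 + real M0)" by (simp add: algebra_simps)
    have s: "real m * ln (real m) - real m - p * (real m)\<^sup>2 / 2 - real m * ln \<tau> + real m * p * \<tau> + q * \<tau> - q * p * \<tau>\<^sup>2 / 2
      = real m * (Psi (p * real m / q) - (q - 1) / (2 * q) * (p * real m) + ln q)"
      unfolding \<tau>_def by (rule saddle_value[OF p(1) q m0])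
    have pm: "p * real m * (1 + real M0) + 4 * (p * real m) + p * real m / 2 \<le> p * real m * (6 + real M0)"
    proof -
      have "p * real m \<ge> 0" using p by simp
      then show ?thesis by (simp add: algebra_simps)
    qed
    show ?thesis using 1 2 3 4 s pm by (subst exp_le_cancel_iff) linarith
  qed
  finally show ?thesis .
qed

lemma rc_Z_summand_le:
  assumes l: "l > 0" and q: "q > 0" and e: "0 < \<epsilon>" "\<epsilon> \<le> 1 / 2" "\<epsilon> * l \<le> 1"
    and n: "2 * l \<le> real n" "1 \<le> J" "real J \<le> \<epsilon> * real M0" "real M0 \<le> \<epsilon> * real n + 1" "1 \<le> M0"
    and k: "k \<le> n"
  defines "p \<equiv> l / real n"
  defines "E \<equiv> 3 + 2 * ln (real n) + real n / real J * (ln (max 1 q) + ln 2) + ln (2 * real J)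
     + 4 / (real J * p) + 2 * l + 2 * \<epsilon> * real n + l * (6 + real M0) + 2 * q * (1 + real M0)"
  shows "real (n choose k) * (1 - p) ^ (k * (n - k))
     * ((1 - p) ^ (k choose 2) * partition_sum (large_part J (\<lambda>j. q * conn_coeff p j)) k)
     * ((1 - p) ^ ((n - k) choose 2) * partition_sum (small_part J (\<lambda>j. q * conn_coeff p j)) (n - k))
    \<le> exp (real n * Phi (real k / real n) l q + E)"
proof -
  have n0: "real n > 0" using n(1) l by linarith
  have n1: "real n \<ge> 1" using n0 by (cases n) auto
  have p: "0 < p" "p \<le> 1 / 2" "p < 1" using n(1) l n0 by (auto simp: p_def field_simps)
  define m where "m = n - k"
  define \<theta> where "\<theta> = real k / real n"
  have mr: "real m = real n - real k" using k by (simp add: m_def)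
  have kn: "real k = \<theta> * real n" using n0 by (simp add: \<theta>_def)
  moreover have "real m = (1 - \<theta>) * real n" unfolding mr left_diff_distrib using kn by simp
  ultimately have kn: "real k = \<theta> * real n" "real m = (1 - \<theta>) * real n" .
  have th: "0 \<le> \<theta>" "\<theta> \<le> 1" using k n0 by (auto simp: \<theta>_def field_simps)
  have pn: "p * real k = l * \<theta>" "p * real m = l * (1 - \<theta>)" using kn n0 by (auto simp: p_def)
  have c: "conn_coeff p j \<ge> 0" for j using p by (intro conn_coeff_nonneg) auto
  have J0: "real J > 0" using n(2) by simp
  let ?LT = "real n / real J * (ln (max 1 q) + ln 2) + ln (2 * real J) + 4 / (real J * p) + 2 * l"
  have lnq: "ln (max 1 q) \<ge> 0" by simp
  have LT0: "?LT \<ge> 0" using lnq J0 p l n(2) by (intro add_nonneg_nonneg mult_nonneg_nonneg) auto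
  \<comment> \<open>the number of choices of the vertices in large components gives the entropy term\<close>
  have cpos: "real (n choose k) > 0" using k by simp
  have "ln (real (n choose k)) \<le> xlnx (real n) - xlnx (real k) - xlnx (real m) + 1 + ln (real n)"
    using ln_binomial_bounds(1)[OF k] mr by simp
  also have "xlnx (real n) - xlnx (real k) - xlnx (real m) = real n * (- xlnx \<theta> - xlnx (1 - \<theta>))"
    unfolding kn using xlnx_scale[of \<theta> "real n"] xlnx_scale[of "1 - \<theta>" "real n"] th n0
    by (simp add: xlnx_def algebra_simps)
  finally have "ln (real (n choose k)) \<le> real n * (- xlnx \<theta> - xlnx (1 - \<theta>)) + 1 + ln (real n)" .
  then have "exp (ln (real (n choose k))) \<le> exp (real n * (- xlnx \<theta> - xlnx (1 - \<theta>)) + 1 + ln (real n))"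
    by (simp only: exp_le_cancel_iff)
  then have T1: "real (n choose k) \<le> exp (real n * (- xlnx \<theta> - xlnx (1 - \<theta>)) + 1 + ln (real n))"
    using cpos by (simp only: exp_ln)
  \<comment> \<open>the edges between the two parts are closed\<close>
  have "(1 - p) ^ (k * m) \<le> exp (- p) ^ (k * m)"
    using p exp_ge_add_one_self[of "- p"] by (intro power_mono) auto
  also have "\<dots> = exp (real n * (- l * \<theta> * (1 - \<theta>)))"
    using pn kn by (simp add: mult_ac flip: exp_of_nat_mult)
  finally have T2: "(1 - p) ^ (k * m) \<le> exp (real n * (- l * \<theta> * (1 - \<theta>)))" .
  have T3: "(1 - p) ^ (k choose 2) * partition_sum (large_part J (\<lambda>j. q * conn_coeff p j)) k
     \<le> exp (real n * (\<theta> * ln (pi1 (l * \<theta>))) + ?LT)"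
  proof (cases "k = 0")
    case True
    then show ?thesis using LT0 by (simp add: \<theta>_def numeral_2_eq_2)
  next
    case False
    then have k1: "k \<ge> 1" by simp
    let ?D = "partition_sum (large_part J (conn_coeff p)) k"
    have pi: "pi1 (p * real k) > 0" using p k1 by (simp add: pi1_def)
    have "(1 - p) ^ (k choose 2) * partition_sum (large_part J (\<lambda>j. q * conn_coeff p j)) k
      \<le> (1 - p) ^ (k choose 2) * (max 1 q powr (real k / real J) * ?D)"
      using p by (intro mult_left_mono large_part_scale_q q n) auto
    also have "\<dots> = max 1 q powr (real k / real J) * ((1 - p) ^ (k choose 2) * ?D)" by simp
    also have "\<dots> \<le> max 1 q powr (real k / real J) *
      (2 * real J * 2 powr (real k / real J) * exp (4 / (real J * p)) * exp (2 * p * real k) * pi1 (p * real k) ^ k)"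
      using p n k1 by (intro mult_left_mono large_components_bound) auto
    also have "\<dots> = exp (real k / real J * (ln (max 1 q) + ln 2) + ln (2 * real J) + 4 / (real J * p)
       + 2 * p * real k + real k * ln (pi1 (p * real k)))"
      using J0 pi by (simp add: exp_add powr_def exp_of_nat_mult distrib_left)
    also have "\<dots> \<le> exp (real n * (\<theta> * ln (pi1 (l * \<theta>))) + ?LT)"
    proof -
      have "real k / real J * (ln (max 1 q) + ln 2) \<le> real n / real J * (ln (max 1 q) + ln 2)"
        using k J0 lnq by (intro mult_right_mono divide_right_mono) auto
      moreover have "2 * p * real k \<le> 2 * l"
        using pn(1) th l mult_left_mono[of \<theta> 1 l] by (simp add: mult.assoc)
      moreover have "real k * ln (pi1 (p * real k)) = real n * (\<theta> * ln (pi1 (l * \<theta>)))"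
        unfolding pn(1) unfolding kn(1) by simp
      ultimately show ?thesis by (subst exp_le_cancel_iff) linarith
    qed
    finally show ?thesis .
  qed
  let ?ST = "1 + ln (real n) + 2 * \<epsilon> * real n + l * (6 + real M0) + 2 * q * (1 + real M0)"
  have T4: "(1 - p) ^ (m choose 2) * partition_sum (small_part J (\<lambda>j. q * conn_coeff p j)) m
     \<le> exp (real n * ((1 - \<theta>) * (Psi (l * (1 - \<theta>) / q) - (q - 1) / (2 * q) * (l * (1 - \<theta>)) + ln q)) + ?ST)"
  proof (cases "m = 0")
    case True
    then have "1 - \<theta> = 0" using kn n0 by simp
    moreover have "?ST \<ge> 0" using n1 e l q by (intro add_nonneg_nonneg mult_nonneg_nonneg) auto
    ultimately show ?thesis using True by (simp add: numeral_2_eq_2)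
  next
    case False
    then have m1: "m \<ge> 1" by simp
    have "p * (real M0 - 1) \<le> p * (\<epsilon> * real n)" using n(4) p by (intro mult_left_mono) auto
    also have "\<dots> = \<epsilon> * l" using n0 by (simp add: p_def)
    finally have pM0: "p * (real M0 - 1) \<le> 1" using e by linarith
    have "(1 - p) ^ (m choose 2) * partition_sum (small_part J (\<lambda>j. q * conn_coeff p j)) m
      \<le> exp (real m * (Psi (p * real m / q) - (q - 1) / (2 * q) * (p * real m) + ln q)
        + (1 + ln (real m) + 2 * \<epsilon> * real m + p * real m * (6 + real M0) + 2 * q * (1 + real M0)))"
      using e by (intro small_components_exp_bound p q n pM0 m1) auto
    also have "\<dots> \<le> exp (real n * ((1 - \<theta>) * (Psi (l * (1 - \<theta>) / q) - (q - 1) / (2 * q) * (l * (1 - \<theta>)) + ln q)) + ?ST)"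
    proof -
      have mn: "real m \<le> real n" using mr by simp
      have "ln (real m) \<le> ln (real n)" using mn m1 by simp
      moreover have "2 * \<epsilon> * real m \<le> 2 * \<epsilon> * real n" using mn e by (intro mult_left_mono) auto
      moreover have "p * real m * (6 + real M0) \<le> l * (6 + real M0)"
        using pn(2) th l mult_left_mono[of "1 - \<theta>" 1 l] by (intro mult_right_mono) auto
      moreover have "real m * (Psi (p * real m / q) - (q - 1) / (2 * q) * (p * real m) + ln q)
        = real n * ((1 - \<theta>) * (Psi (l * (1 - \<theta>) / q) - (q - 1) / (2 * q) * (l * (1 - \<theta>)) + ln q))"
        unfolding pn(2) unfolding kn(2) by simp
      ultimately show ?thesis by (subst exp_le_cancel_iff) linarith
    qed
    finally show ?thesis .
  qed
  have nonneg: "0 \<le> (1 - p) ^ (k choose 2) * partition_sum (large_part J (\<lambda>j. q * conn_coeff p j)) k"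
    "0 \<le> (1 - p) ^ (m choose 2) * partition_sum (small_part J (\<lambda>j. q * conn_coeff p j)) m"
    using p q c by (auto intro!: mult_nonneg_nonneg partition_sum_nonneg simp: large_part_def small_part_def)
  have "real (n choose k) * (1 - p) ^ (k * m)
     * ((1 - p) ^ (k choose 2) * partition_sum (large_part J (\<lambda>j. q * conn_coeff p j)) k)
     * ((1 - p) ^ (m choose 2) * partition_sum (small_part J (\<lambda>j. q * conn_coeff p j)) m)
    \<le> exp (real n * (- xlnx \<theta> - xlnx (1 - \<theta>)) + 1 + ln (real n)) * exp (real n * (- l * \<theta> * (1 - \<theta>)))
      * exp (real n * (\<theta> * ln (pi1 (l * \<theta>))) + ?LT)
      * exp (real n * ((1 - \<theta>) * (Psi (l * (1 - \<theta>) / q) - (q - 1) / (2 * q) * (l * (1 - \<theta>)) + ln q)) + ?ST)"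
    using p by (intro mult_mono T1 T2 T3 T4 nonneg mult_nonneg_nonneg) auto
  also have "\<dots> = exp (real n * Phi \<theta> l q + (?LT + ?ST + 1 + ln (real n)))"
    unfolding exp_add[symmetric] Phi_eq_Phi_forest Phi_forest_def
    by (rule arg_cong[where f = exp]) (simp add: algebra_simps)
  also have "\<dots> \<le> exp (real n * Phi \<theta> l q + E)" unfolding E_def by simp
  finally show ?thesis unfolding m_def \<theta>_def .
qed

text \<open>
  With \<open>J\<close> about \<open>\<epsilon>\<^sup>2 * n\<close> and \<open>M0\<close> about \<open>\<epsilon> * n\<close>, the error terms are \<open>O(1) + O(ln n) + O(\<epsilon> * n)\<close>, with
  constants that may depend on \<open>\<epsilon>\<close> in the first term only.
\<close>
lemma free_energy_le_sup_Phi: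
  assumes l: "l > 0" and q: "q > 0" and eta: "\<eta> > 0"
  shows "\<forall>\<^sub>F n in sequentially.
    (1 / real n) * ln (rc_Z (l / real n) q n) \<le> (SUP \<theta>\<in>{0..1}. Phi \<theta> l q) + \<eta>"
proof -
  define S where "S = (SUP \<theta>\<in>{0..1}. Phi \<theta> l q)"
  define K where "K = 2 + l + 2 * q"
  have K: "K > 0" using l q by (simp add: K_def)
  define \<epsilon> where "\<epsilon> = min (1 / 2) (min (1 / l) (\<eta> / (2 * K)))"
  have e: "0 < \<epsilon>" "\<epsilon> \<le> 1 / 2" "\<epsilon> \<le> 1 / l" "\<epsilon> \<le> \<eta> / (2 * K)"
    using l K eta by (auto simp: \<epsilon>_def)
  have el: "\<epsilon> * l \<le> 1" using e(3) l by (simp add: field_simps)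
  have eK: "\<epsilon> * K \<le> \<eta> / 2" using e(4) K by (simp add: field_simps)
  define C where "C = 3 + 2 / \<epsilon>\<^sup>2 * (ln (max 1 q) + ln 2) + 2 * ln 2 + 8 / (\<epsilon>\<^sup>2 * l) + 2 * l + 7 * l + 4 * q"
  have "(\<lambda>n. C / real n + 4 * (ln (real n) / real n)) \<longlonglongrightarrow> 0 + 4 * 0"
    by (intro tendsto_intros lim_const_over_n lim_ln_over_n)
  then have ev: "\<forall>\<^sub>F n in sequentially. C / real n + 4 * (ln (real n) / real n) < \<eta> / 2"
    using eta by (intro order_tendstoD) auto
  show ?thesis unfolding S_def[symmetric]
    using ev eventually_ge_real[of "2 * l"] eventually_ge_real[of "2 / \<epsilon>\<^sup>2"] eventually_ge_real[of 1]
  proof eventually_elim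
    case (elim n)
    define p J M0 where "p = l / real n" and "J = nat \<lfloor>\<epsilon>\<^sup>2 * real n\<rfloor>" and "M0 = nat \<lceil>\<epsilon> * real n\<rceil>"
    have n0: "real n > 0" using elim by simp
    have p: "0 < p" "p < 1" using elim(2) l n0 by (auto simp: p_def field_simps)
    have en: "\<epsilon>\<^sup>2 * real n \<ge> 2" using elim(3) e by (simp add: field_simps)
    have J: "real J \<le> \<epsilon>\<^sup>2 * real n" "real J > \<epsilon>\<^sup>2 * real n - 1" using en by (simp_all add: J_def)
    then have J1: "1 \<le> J" and Jh: "\<epsilon>\<^sup>2 * real n / 2 \<le> real J" using en by linarith+
    have M0: "\<epsilon> * real n \<le> real M0" "real M0 \<le> \<epsilon> * real n + 1" using e n0 by (simp_all add: M0_def)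
    have "0 < \<epsilon> * real n" using e n0 by simp
    then have M1: "1 \<le> M0" using M0 by linarith
    have "\<epsilon> * (\<epsilon> * real n) \<le> \<epsilon> * real M0" using M0 e by (intro mult_left_mono) auto
    then have JM: "real J \<le> \<epsilon> * real M0" using J by (simp add: power2_eq_square)
    define E where "E = 3 + 2 * ln (real n) + real n / real J * (ln (max 1 q) + ln 2) + ln (2 * real J)
     + 4 / (real J * p) + 2 * l + 2 * \<epsilon> * real n + l * (6 + real M0) + 2 * q * (1 + real M0)"
    have "rc_Z p q n \<le> (\<Sum>k\<le>n. exp (real n * S + E))"
      unfolding rc_Z_split[OF p(2), of q n J]
    proof (rule sum_mono)
      fix k assume "k \<in> {..n}"
      then have k: "k \<le> n" by simp
      have "real k / real n \<in> {0..1}" using k n0 by simp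
      then have "Phi (real k / real n) l q \<le> S"
        unfolding S_def by (rule cSUP_upper) (rule bdd_above_Phi[OF q l])
      then have "real n * Phi (real k / real n) l q \<le> real n * S" by (rule mult_left_mono) simp
      then have "exp (real n * Phi (real k / real n) l q + E) \<le> exp (real n * S + E)" by simp
      with rc_Z_summand_le[OF l q e(1,2) el elim(2) J1 JM M0(2) M1 k]
      show "real (n choose k) * (1 - p) ^ (k * (n - k))
       * ((1 - p) ^ (k choose 2) * partition_sum (large_part J (\<lambda>j. q * conn_coeff p j)) k)
       * ((1 - p) ^ ((n - k) choose 2) * partition_sum (small_part J (\<lambda>j. q * conn_coeff p j)) (n - k))
        \<le> exp (real n * S + E)"
        unfolding p_def[symmetric] E_def[symmetric] by (rule order_trans)
    qed
    also have "\<dots> = real (Suc n) * exp (real n * S + E)" by simp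
    finally have "ln (rc_Z p q n) \<le> ln (real (Suc n) * exp (real n * S + E))"
      using rc_Z_pos[OF p q] by (subst ln_le_cancel_iff) auto
    also have "\<dots> = ln (real (Suc n)) + (real n * S + E)" by (simp add: ln_mult_pos del: of_nat_Suc)
    also have "ln (real (Suc n)) \<le> ln (2 * real n)" using elim(4) by (subst ln_le_cancel_iff) auto
    also have "ln (2 * real n) = ln 2 + ln (real n)" using n0 by (simp add: ln_mult_pos)
    also have "E \<le> C - ln 2 + 3 * ln (real n) + \<epsilon> * K * real n"
    proof -
      have "real n / real J \<le> real n / (\<epsilon>\<^sup>2 * real n / 2)" using Jh J1 e n0 by (intro divide_left_mono) auto
      also have "\<dots> = 2 / \<epsilon>\<^sup>2" using n0 by simp
      finally have nJ: "real n / real J \<le> 2 / \<epsilon>\<^sup>2" .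
      then have 1: "real n / real J * (ln (max 1 q) + ln 2) \<le> 2 / \<epsilon>\<^sup>2 * (ln (max 1 q) + ln 2)"
        by (rule mult_right_mono) simp
      have "\<epsilon>\<^sup>2 \<le> 1\<^sup>2" using e by (intro power_mono) auto
      then have "\<epsilon>\<^sup>2 * real n \<le> 1 * real n" using n0 by (intro mult_right_mono) auto
      then have "2 * real J \<le> 2 * real n" using J by simp
      then have 2: "ln (2 * real J) \<le> ln 2 + ln (real n)"
        using J1 n0 ln_le_cancel_iff[of "2 * real J" "2 * real n"] by (simp add: ln_mult_pos)
      have "4 / (real J * p) = (real n / real J) * (4 / l)" using n0 J1 by (simp add: p_def)
      also have "\<dots> \<le> 2 / \<epsilon>\<^sup>2 * (4 / l)" using nJ l by (intro mult_right_mono) auto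
      finally have 3: "4 / (real J * p) \<le> 8 / (\<epsilon>\<^sup>2 * l)" by simp
      have 4: "l * real M0 \<le> l * (\<epsilon> * real n + 1)" "q * real M0 \<le> q * (\<epsilon> * real n + 1)"
        using M0 l q by (auto intro: mult_left_mono)
      show ?thesis unfolding E_def C_def K_def using 1 2 3 4 by (simp add: algebra_simps)
    qed
    finally have "ln (rc_Z p q n) \<le> real n * S + C + 4 * ln (real n) + \<epsilon> * K * real n" by simp
    then have "1 / real n * ln (rc_Z p q n) \<le> 1 / real n * (real n * S + C + 4 * ln (real n) + \<epsilon> * K * real n)"
      by (rule mult_left_mono) simp
    also have "\<dots> = S + (C / real n + 4 * (ln (real n) / real n)) + \<epsilon> * K"
      using n0 by (simp add: field_simps)
    also have "\<dots> \<le> S + \<eta>" using elim(1) eK by linarith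
    finally show ?case by (simp add: p_def)
  qed
qed

theorem theorem2p7:
  fixes q l :: real
  assumes "q > 0" and "l > 0"
  shows "(\<lambda>n. (1 / real n) * ln (rc_partition n l q))
           \<longlonglongrightarrow> (SUP \<theta>\<in>{0..1}. Phi \<theta> l q)"
proof (rule tendstoI)
  fix e :: real assume "e > 0"
  then have e: "e / 2 > 0" by simp
  show "\<forall>\<^sub>F n in sequentially. dist ((1 / real n) * ln (rc_partition n l q)) (SUP \<theta>\<in>{0..1}. Phi \<theta> l q) < e"
    using free_energy_ge_sup_Phi[OF assms(2,1) e] free_energy_le_sup_Phi[OF assms(2,1) e]
  proof eventually_elim
    case (elim n)
    then show ?case unfolding rc_partition_eq dist_real_def using e by linarith
  qed
qed

end
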